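(* Let $G$ be a connected finite or infinite and countable weighted graph with Laplacian $\mathcal{L}$ as in the context. Suppose that $\Xi=\{\Omega_j\}$ is a disjoint cover of $V(G)$ by connected and finite subgraphs $\Omega_j$ (each with more than one vertex), let $\lambda_{1,j}$ be the first nonzero eigenvalue of the Laplacian of the induced graph $\Omega_j$, and assume $\Lambda_\Xi=\inf_j\lambda_{1,j}>0$. Let $\alpha>0$ and $\omega>0$ satisfy $$\gamma=\frac{1+\alpha}{\alpha}\frac{\omega}{\Lambda_\Xi}<1 .$$ Then every function $f\in PW_\omega(\mathcal{L})$ is uniquely determined by its averages $\langle f,\xi_j\rangle$, $\xi_j=|\Omega_j|^{-1/2}\chi_{\Omega_j}$, and can be reconstructed from this set of values in a stable way.
   Context: $G$ is an undirected weighted graph with vertex set $V(G)$ and weight function $w:V(G)\times V(G)\to[0,\infty)$, $w(u,v)=w(v,u)$, $w(u,u)=0$; edges are the pairs with $w(u,v)\ne0$. If $G$ is infinite, the degrees are assumed uniformly bounded: $\sum_{u}w(u,v)\le c$ for all $v$ and some constant $c$. $L_2(G)$ is the Hilbert space of complex functions on $V(G)$ with $\langle f,g\rangle=\sum_vf(v)\overline{g(v)}$ and finite norm. $\mathcal{L}$ is the bounded non-negative self-adjoint operator $(\mathcal{L}f)(v)=\sum_{u\in V(G)}(f(v)-f(u))w(v,u)$ on $L_2(G)$. The induced graph on $\Omega\subset V(G)$ has vertex set $\Omega$ and all edges of $G$ with both ends in $\Omega$, with weights the restriction of $w$; its Laplacian is given by the same formula with $V(G)$ replaced by $\Omega$.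 $|\Omega|$ is the number of vertices of $\Omega$, $\chi_\Omega$ its characteristic function. $PW_\omega(\mathcal{L})$ is the range of the spectral projector $\mathbf{1}_{[0,\omega]}(\mathcal{L})$. "Reconstructed in a stable way" means: there is a bounded linear operator $R:l_2\to PW_\omega(\mathcal{L})$ with $R(\{\langle f,\xi_j\rangle\}_j)=f$ for all $f\in PW_\omega(\mathcal{L})$. *)

theory Defs
  imports "HOL-Analysis.Analysis"
begin

text \<open>A weighted graph is given by its vertex set \<open>V\<close> and a weight function \<open>w\<close>, of which only
  the values on \<open>V \<times> V\<close> matter.\<close>

definition weighted_graph :: "'v set \<Rightarrow> ('v \<Rightarrow> 'v \<Rightarrow> real) \<Rightarrow> bool" where
  "weighted_graph V w \<longleftrightarrow>
     countable V \<and>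
     (\<forall>u\<in>V. \<forall>v\<in>V. 0 \<le> w u v \<and> w u v = w v u) \<and>
     (\<forall>v\<in>V. w v v = 0) \<and>
     (infinite V \<longrightarrow> (\<exists>c. \<forall>v\<in>V. (\<lambda>u. w u v) summable_on V \<and> (\<Sum>\<^sub>\<infinity>u\<in>V. w u v) \<le> c))"

text \<open>Connectedness of the graph induced on \<open>S\<close>: paths must stay inside \<open>S\<close>.\<close>

definition graph_connected :: "'v set \<Rightarrow> ('v \<Rightarrow> 'v \<Rightarrow> real) \<Rightarrow> bool" where
  "graph_connected S w \<longleftrightarrow>
     (\<forall>u\<in>S. \<forall>v\<in>S. (u, v) \<in> {(x, y). x \<in> S \<and> y \<in> S \<and> w x y \<noteq> 0}\<^sup>*)"

text \<open>The Hilbert space \<open>\<ell>\<^sub>2(S)\<close>. Functions on \<open>S\<close> are represented as functions on the whole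
  type that vanish outside \<open>S\<close>, so that equality of functions is equality on \<open>S\<close>.\<close>

definition ell2 :: "'a set \<Rightarrow> ('a \<Rightarrow> complex) set" where
  "ell2 S = {f. (\<forall>x. x \<notin> S \<longrightarrow> f x = 0) \<and> (\<lambda>x. (cmod (f x))\<^sup>2) summable_on S}"

definition ell2_inner :: "'a set \<Rightarrow> ('a \<Rightarrow> complex) \<Rightarrow> ('a \<Rightarrow> complex) \<Rightarrow> complex" where
  "ell2_inner S f g = (\<Sum>\<^sub>\<infinity>x\<in>S. f x * cnj (g x))"

definition ell2_norm :: "'a set \<Rightarrow> ('a \<Rightarrow> complex) \<Rightarrow> real" where
  "ell2_norm S f = sqrt (\<Sum>\<^sub>\<infinity>x\<in>S. (cmod (f x))\<^sup>2)"

definition bounded_operator ::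
    "'a set \<Rightarrow> 'b set \<Rightarrow> (('a \<Rightarrow> complex) \<Rightarrow> ('b \<Rightarrow> complex)) \<Rightarrow> bool" where
  "bounded_operator S T A \<longleftrightarrow>
     (\<forall>f\<in>ell2 S. A f \<in> ell2 T) \<and>
     (\<forall>f\<in>ell2 S. \<forall>g\<in>ell2 S. A (\<lambda>x. f x + g x) = (\<lambda>y. A f y + A g y)) \<and>
     (\<forall>c. \<forall>f\<in>ell2 S. A (\<lambda>x. c * f x) = (\<lambda>y. c * A f y)) \<and>
     (\<exists>C. \<forall>f\<in>ell2 S. ell2_norm T (A f) \<le> C * ell2_norm S f)"

definition orthogonal_projection ::
    "'a set \<Rightarrow> (('a \<Rightarrow> complex) \<Rightarrow> ('a \<Rightarrow> complex)) \<Rightarrow> bool" where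
  "orthogonal_projection S P \<longleftrightarrow>
     bounded_operator S S P \<and>
     (\<forall>f\<in>ell2 S. P (P f) = P f) \<and>
     (\<forall>f\<in>ell2 S. \<forall>g\<in>ell2 S. ell2_inner S (P f) g = ell2_inner S f (P g))"

definition scalar_spectral_measure ::
    "'a set \<Rightarrow> (real set \<Rightarrow> ('a \<Rightarrow> complex) \<Rightarrow> ('a \<Rightarrow> complex)) \<Rightarrow> ('a \<Rightarrow> complex) \<Rightarrow> real measure" where
  "scalar_spectral_measure S E f =
     measure_of UNIV (sets borel) (\<lambda>B. ennreal (Re (ell2_inner S (E B f) f)))"

text \<open>\<open>E\<close> is a compactly supported projection-valued Borel measure on the real line with
  \<open>A = \<integral> t dE(t)\<close>. The latter is expressed through the quadratic forms \<open>\<langle>A f, f\<rangle>\<close>, which determine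
  a bounded operator on a complex Hilbert space.\<close>

definition is_spectral_measure ::
    "'a set \<Rightarrow> (('a \<Rightarrow> complex) \<Rightarrow> ('a \<Rightarrow> complex)) \<Rightarrow>
     (real set \<Rightarrow> ('a \<Rightarrow> complex) \<Rightarrow> ('a \<Rightarrow> complex)) \<Rightarrow> bool" where
  "is_spectral_measure S A E \<longleftrightarrow>
     (\<forall>B\<in>sets borel. orthogonal_projection S (E B)) \<and>
     (\<forall>f\<in>ell2 S. E {} f = (\<lambda>x. 0)) \<and>
     (\<exists>a. \<forall>f\<in>ell2 S. E {-a..a} f = f) \<and>
     (\<forall>B\<in>sets borel. \<forall>C\<in>sets borel. \<forall>f\<in>ell2 S. E (B \<inter> C) f = E B (E C f)) \<and>
     (\<forall>B :: nat \<Rightarrow> real set. range B \<subseteq> sets borel \<longrightarrow> disjoint_family B \<longrightarrow>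
        (\<forall>f\<in>ell2 S.
           (\<lambda>n. ell2_norm S (\<lambda>x. E (\<Union>i. B i) f x - (\<Sum>i<n. E (B i) f x))) \<longlonglongrightarrow> 0)) \<and>
     (\<forall>f\<in>ell2 S.
        ell2_inner S (A f) f = complex_of_real (\<integral>t. t \<partial>scalar_spectral_measure S E f))"

text \<open>The spectral projector \<open>1\<^sub>B(A)\<close> of a bounded self-adjoint operator \<open>A\<close> on \<open>\<ell>\<^sub>2(S)\<close>, for a
  Borel set \<open>B\<close>. By the spectral theorem a spectral measure of \<open>A\<close> exists, and its values on
  Borel sets, as operators on \<open>\<ell>\<^sub>2(S)\<close>, do not depend on the choice.\<close>

definition spectral_projector ::
    "'a set \<Rightarrow> (('a \<Rightarrow> complex) \<Rightarrow> ('a \<Rightarrow> complex)) \<Rightarrow> real set \<Rightarrow>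
     ('a \<Rightarrow> complex) \<Rightarrow> ('a \<Rightarrow> complex)" where
  "spectral_projector S A B = (SOME E. is_spectral_measure S A E) B"

text \<open>The Laplacian of the graph induced on \<open>S\<close>; the whole graph is the case \<open>S = V\<close>.\<close>

definition laplacian ::
    "'v set \<Rightarrow> ('v \<Rightarrow> 'v \<Rightarrow> real) \<Rightarrow> ('v \<Rightarrow> complex) \<Rightarrow> ('v \<Rightarrow> complex)" where
  "laplacian S w f =
     (\<lambda>v. if v \<in> S then \<Sum>\<^sub>\<infinity>u\<in>S. (f v - f u) * complex_of_real (w v u) else 0)"

definition paley_wiener ::
    "'v set \<Rightarrow> ('v \<Rightarrow> 'v \<Rightarrow> real) \<Rightarrow> real \<Rightarrow> ('v \<Rightarrow> complex) set" where
  "paley_wiener V w \<omega> = spectral_projector V (laplacian V w) {0..\<omega>} ` ell2 V"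

text \<open>Only real eigenvalues are considered, the Laplacian being self-adjoint.\<close>

definition laplacian_eigenvalues :: "'v set \<Rightarrow> ('v \<Rightarrow> 'v \<Rightarrow> real) \<Rightarrow> real set" where
  "laplacian_eigenvalues S w =
     {l. \<exists>f\<in>ell2 S. f \<noteq> (\<lambda>v. 0) \<and> laplacian S w f = (\<lambda>v. complex_of_real l * f v)}"

text \<open>For finite connected \<open>S\<close> with more than one vertex, the infimum is over a finite nonempty set
  of positive numbers, hence a minimum.\<close>

definition first_nonzero_eigenvalue :: "'v set \<Rightarrow> ('v \<Rightarrow> 'v \<Rightarrow> real) \<Rightarrow> real" where
  "first_nonzero_eigenvalue S w = Inf {l \<in> laplacian_eigenvalues S w. l \<noteq> 0}"

definition cover_bound :: "'v set set \<Rightarrow> ('v \<Rightarrow> 'v \<Rightarrow> real) \<Rightarrow> real" where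
  "cover_bound \<Xi> w = (INF \<Omega>\<in>\<Xi>. first_nonzero_eigenvalue \<Omega> w)"

definition normalized_indicator :: "'v set \<Rightarrow> 'v \<Rightarrow> complex" where
  "normalized_indicator \<Omega> = (\<lambda>v. complex_of_real (indicator \<Omega> v / sqrt (real (card \<Omega>))))"

text \<open>The cover is indexed by its own members, so the sequence of averages lives on \<open>\<Xi>\<close>.\<close>

definition averages :: "'v set \<Rightarrow> 'v set set \<Rightarrow> ('v \<Rightarrow> complex) \<Rightarrow> 'v set \<Rightarrow> complex" where
  "averages V \<Xi> f = (\<lambda>\<Omega>. if \<Omega> \<in> \<Xi> then ell2_inner V f (normalized_indicator \<Omega>) else 0)"

end

theory Submission
  imports Defs "HOL-Probability.Probability"
begin

text \<open>If \<open>Q\<close> denotes subtraction of the block averages, the Poincare inequality on each block and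
  summation over the blocks give \<open>cover_bound \<Xi> w * \<parallel>Q f\<parallel>\<^sup>2 \<le> \<langle>L f, f\<rangle>\<close>, and \<open>\<langle>L f, f\<rangle> \<le> \<omega> * \<parallel>f\<parallel>\<^sup>2\<close> on
  the Paley-Wiener space. With \<open>P\<close> the spectral projector, \<open>P Q P\<close> is therefore a contraction, and
  the fixed point equation \<open>f = P (T a + Q (P f))\<close>, where \<open>T\<close> spreads the values \<open>a\<close> over the blocks,
  defines the reconstruction operator.

  The projector is only meaningful once the Laplacian is known to have a spectral measure. For a
  positive operator \<open>A \<le> M\<close> the Bernstein weights \<open>\<langle>(n choose k) A\<^sup>k (M - A)\<^sup>n\<^sup>-\<^sup>k x, x\<rangle> / M\<^sup>n\<close> are
  nonnegative;
  as masses at \<open>M k / n\<close> they converge along a subsequence to a measure with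
  \<open>\<integral> p d\<mu> = \<langle>p(A) x, x\<rangle>\<close>. Hence \<open>p \<mapsto> p(A) x\<close> is isometric for the norm of \<open>L\<^sup>2(\<mu>)\<close>, and the spectral
  projection of a Borel set is the limit of \<open>p(A) x\<close> as \<open>p\<close> tends to its indicator.\<close>

section \<open>Spectral measures of positive operators on a real Hilbert space\<close>

text \<open>The operator theory has to live on a type, while \<open>ell2 V\<close> is a set of
  functions. It is therefore carried out on the type \<open>'a l2\<close> of all square-summable
  functions, viewed as a real Hilbert space with inner product Re <f, g>, and \<open>V\<close>
  re-enters through a cutoff. Cutoff and multiplication by complex numbers commute with the
  operator, hence with its spectral projections, and this restores both the subspace and the complex
  structure at the end. Bernstein polynomials are chosen because their positivity at
  \<open>A\<close> is pure algebra, so the measure can be built before any functional calculus is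
  available. Their factorial moments are exact, which reduces convergence to an estimate on binomial
  coefficients. The contraction constant is the square root of \<omega> / \<Lambda>, since the
  Poincare inequality bounds squares of norms. The hypothesis on \<gamma> puts it below 1, because
  (1 + \<alpha>) / \<alpha> is at least 1.\<close>

definition poly_op :: "('a::real_vector \<Rightarrow> 'a) \<Rightarrow> real poly \<Rightarrow> 'a \<Rightarrow> 'a" where
  "poly_op A p x = (\<Sum>i\<le>degree p. coeff p i *\<^sub>R (A ^^ i) x)"

lemma poly_op_altdef:
  assumes "degree p \<le> n"
  shows "poly_op A p x = (\<Sum>i\<le>n. coeff p i *\<^sub>R (A ^^ i) x)"
  unfolding poly_op_def
  by (intro sum.mono_neutral_left) (use assms in \<open>auto simp: coeff_eq_0\<close>)

lemma poly_op_0 [simp]: "poly_op A 0 x = 0"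
  by (simp add: poly_op_def)

lemma poly_op_1 [simp]: "poly_op A 1 x = x"
  by (simp add: poly_op_def)

lemma poly_op_add: "poly_op A (p + q) x = poly_op A p x + poly_op A q x"
proof -
  define n where "n = max (degree p) (degree q)"
  have "degree (p + q) \<le> n" "degree p \<le> n" "degree q \<le> n"
    by (auto simp: n_def degree_add_le_max)
  then show ?thesis
    by (simp add: poly_op_altdef[where n = n] scaleR_left_distrib sum.distrib)
qed

lemma poly_op_smult: "poly_op A (smult c p) x = c *\<^sub>R poly_op A p x"
  by (simp add: poly_op_altdef[where n = "degree p"] degree_smult_le scaleR_sum_right)

lemma poly_op_diff: "poly_op A (p - q) x = poly_op A p x - poly_op A q x"
  using poly_op_add[of A "p - q" q x] by (simp add: algebra_simps)

lemma poly_op_sum: "poly_op A (sum f I) x = (\<Sum>i\<in>I. poly_op A (f i) x)"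
  by (induction I rule: infinite_finite_induct) (auto simp: poly_op_add)

text \<open>The Horner step, and the first place where \<open>A\<close> must be linear. It matches
  induction over \<open>pCons\<close>, by which multiplicativity, commutation, boundedness and
  symmetry of p(A) follow.\<close>

lemma poly_op_pCons:
  assumes "linear A"
  shows "poly_op A (pCons a p) x = a *\<^sub>R x + A (poly_op A p x)"
proof -
  have "poly_op A (pCons a p) x
      = (\<Sum>i\<le>Suc (degree p). coeff (pCons a p) i *\<^sub>R (A ^^ i) x)"
    by (rule poly_op_altdef) (simp add: degree_pCons_le)
  also have "\<dots> = a *\<^sub>R x + (\<Sum>i\<le>degree p. coeff p i *\<^sub>R A ((A ^^ i) x))"
    by (simp only: sum.atMost_Suc_shift coeff_pCons_0 coeff_pCons_Suc funpow.simps o_def id_def)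
  also have "(\<Sum>i\<le>degree p. coeff p i *\<^sub>R A ((A ^^ i) x)) = A (poly_op A p x)"
    by (simp add: poly_op_def linear_sum[OF assms] linear_scale[OF assms])
  finally show ?thesis .
qed

lemma poly_op_mult:
  assumes "linear A"
  shows "poly_op A (p * q) x = poly_op A p (poly_op A q x)"
  by (induction p)
     (auto simp: poly_op_add poly_op_smult poly_op_pCons[OF assms])

lemma poly_op_commute:
  assumes "linear A" "linear T" "\<And>x. T (A x) = A (T x)"
  shows "T (poly_op A p x) = poly_op A p (T x)"
  by (induction p) (auto simp: poly_op_pCons assms linear_add linear_scale linear_0)

lemma bounded_linear_poly_op:
  assumes "bounded_linear A"
  shows "bounded_linear (poly_op A p)"
proof (induction p)
  case 0
  then show ?case by (simp add: poly_op_def bounded_linear_zero)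
next
  case (pCons a p)
  have "poly_op A (pCons a p) = (\<lambda>x. a *\<^sub>R x + A (poly_op A p x))"
    using poly_op_pCons[OF bounded_linear.linear[OF assms]] by blast
  then show ?case
    using bounded_linear_add[OF bounded_linear_scaleR_right bounded_linear_compose[OF assms pCons.IH]]
    by simp
qed

lemma poly_op_selfadjoint:
  assumes "linear A" "\<And>x y. inner (A x) y = inner x (A y)"
  shows "inner (poly_op A p x) y = inner x (poly_op A p y)"
proof (induction p arbitrary: x y)
  case (pCons a p)
  then show ?case
    \<comment> \<open>Symmetry of \<open>A\<close> and the induction hypothesis leave p(A) A y on
      the right; \<open>A\<close> has to be moved back in front of p(A).\<close>
    using poly_op_commute[OF assms(1) assms(1), of p y]
    by (simp add: poly_op_pCons assms inner_add_left inner_add_right)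
qed auto

text \<open>Factorial moments of the binomial distribution: for X + Y = 1 the right side is (n
  choose m) X^m. A commutative semiring is the right generality because X and Y will be the
  polynomials X and M - X, whose sum is the constant M. The proof shifts k = m + j and factors (n
  choose k) (k choose m) = (n choose m) (n - m choose j).\<close>

lemma sum_choose_mult_binomial:
  fixes X Y :: "'a::comm_semiring_1"
  assumes "m \<le> n"
  shows "(\<Sum>k\<le>n. of_nat (k choose m) * (of_nat (n choose k) * X ^ k * Y ^ (n - k)))
       = of_nat (n choose m) * X ^ m * (X + Y) ^ (n - m)"
proof -
  have "(\<Sum>k\<le>n. of_nat (k choose m) * (of_nat (n choose k) * X ^ k * Y ^ (n - k)))
      = (\<Sum>k\<in>{m..n}. of_nat (k choose m) * (of_nat (n choose k) * X ^ k * Y ^ (n - k)))"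
    by (rule sum.mono_neutral_right) (auto simp: binomial_eq_0)
  also have "\<dots> = (\<Sum>j\<le>n - m. of_nat ((m + j) choose m) *
      (of_nat (n choose (m + j)) * X ^ (m + j) * Y ^ (n - (m + j))))"
    by (rule sum.reindex_bij_witness[of _ "\<lambda>j. m + j" "\<lambda>k. k - m"]) (use assms in auto)
  also have "\<dots> = (\<Sum>j\<le>n - m. of_nat (n choose m) * X ^ m *
      (of_nat ((n - m) choose j) * X ^ j * Y ^ (n - m - j)))"
  proof (rule sum.cong[OF refl])
    fix j assume "j \<in> {..n - m}"
    then have "(n choose (m + j)) * ((m + j) choose m) = (n choose m) * ((n - m) choose j)"
      using choose_mult[of m "m + j" n] assms by auto
    then have "of_nat ((m + j) choose m) * (of_nat (n choose (m + j)) :: 'a)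
        = of_nat (n choose m) * of_nat ((n - m) choose j)"
      by (metis of_nat_mult mult.commute)
    then have *: "of_nat ((m + j) choose m) * (of_nat (n choose (m + j)) * Z)
        = of_nat (n choose m) * (of_nat ((n - m) choose j) * Z)" for Z :: 'a
      by (metis mult.assoc)
    show "of_nat ((m + j) choose m) * (of_nat (n choose (m + j)) * X ^ (m + j) * Y ^ (n - (m + j)))
        = of_nat (n choose m) * X ^ m * (of_nat ((n - m) choose j) * X ^ j * Y ^ (n - m - j))"
      by (simp add: mult.assoc *) (simp add: power_add mult_ac)
  qed
  also have "\<dots> = of_nat (n choose m) * X ^ m * (X + Y) ^ (n - m)"
    by (simp add: binomial_ring sum_distrib_left)
  finally show ?thesis .
qed

text \<open>The ratio is the product over \<open>i < m\<close> of \<open>(k - i) / (n - i)\<close>, and each factor is close to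
  \<open>k / n\<close>.\<close>

lemma choose_ratio_approx:
  assumes "k \<le> n" "2 * m < n"
  shows "\<bar>real (k choose m) / real (n choose m) - (real k / real n) ^ m\<bar>
       \<le> real m * (real m / (real n - real m))"
proof -
  have "real (k choose m) / real (n choose m) = (\<Prod>i<m. (real k - real i) / (real n - real i))"
    by (simp add: binomial_gbinomial gbinomial_prod_rev prod_dividef atLeast0LessThan)
  moreover have "(real k / real n) ^ m = (\<Prod>i<m. real k / real n)"
    by simp
  moreover have "norm ((\<Prod>i<m. (real k - real i) / (real n - real i)) - (\<Prod>i<m. real k / real n))
      \<le> (\<Sum>i<m. norm ((real k - real i) / (real n - real i) - real k / real n))"
    by (rule norm_prod_diff) (use assms in \<open>auto simp: field_simps abs_if\<close>)
  moreover have "\<dots> \<le> (\<Sum>i<m. real m / (real n - real m))"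
  proof (rule sum_mono)
    fix i assume "i \<in> {..<m}"
    then have i: "i < m" by simp
    have "real k / real n - (real k - real i) / (real n - real i)
        = (real i / (real n - real i)) * ((real n - real k) / real n)"
      using i assms by (simp add: field_simps)
    moreover have "0 \<le> (real i / (real n - real i)) * ((real n - real k) / real n)"
      using i assms by simp
    moreover have "(real i / (real n - real i)) * ((real n - real k) / real n)
        \<le> (real m / (real n - real m)) * 1"
      by (intro mult_mono frac_le) (use i assms in \<open>auto simp: field_simps\<close>)
    ultimately show "norm ((real k - real i) / (real n - real i) - real k / real n)
        \<le> real m / (real n - real m)"
      unfolding real_norm_def by linarith
  qed
  ultimately show ?thesis by simp
qed

section \<open>Approximating indicators by polynomials in mean square\<close>

lemma finite_measure_compact_inner_approx:
  fixes \<mu> :: "real measure"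
  assumes "finite_measure \<mu>" "sets \<mu> = sets borel" "B \<in> sets borel" "0 < \<delta>"
  obtains K where "K \<subseteq> B" "compact K" "measure \<mu> (B - K) < \<delta>"
proof -
  interpret finite_measure \<mu> by fact
  have "\<exists>K\<subseteq>B. compact K \<and> measure \<mu> B - \<delta> < measure \<mu> K"
  \<comment> \<open>\<open>inner_regular\<close> speaks about \<open>ennreal\<close>, so \<mu>(B) -
    \<delta> must be nonnegative to be compared there; a set of mass below \<delta> is approximated
    by the empty set.\<close>
  proof (cases "measure \<mu> B < \<delta>")
    case True
    then show ?thesis by (intro exI[of _ "{}"]) auto
  next
    case False
    then have "ennreal (measure \<mu> B - \<delta>) < emeasure \<mu> B"
      using assms(4) by (simp add: emeasure_eq_measure ennreal_less_iff)
    also have "emeasure \<mu> B = (SUP K \<in> {K. K \<subseteq> B \<and> compact K}. emeasure \<mu> K)"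
      by (rule inner_regular) (use assms in auto)
    finally obtain K where "K \<subseteq> B" "compact K" "ennreal (measure \<mu> B - \<delta>) < emeasure \<mu> K"
      by (auto simp: less_SUP_iff)
    then show ?thesis using False
      by (intro exI[of _ K]) (auto simp: emeasure_eq_measure ennreal_less_iff)
  qed
  then obtain K where K: "K \<subseteq> B" "compact K" "measure \<mu> B - \<delta> < measure \<mu> K" by blast
  moreover have "measure \<mu> (B - K) = measure \<mu> B - measure \<mu> K"
    by (rule finite_measure_Diff) (use K assms in \<open>auto intro: borel_compact\<close>)
  ultimately show ?thesis by (intro that[of K]) auto
qed

lemma poly_bounded_on_interval:
  fixes a b :: real
  obtains C where "\<And>t. t \<in> {a..b} \<Longrightarrow> \<bar>poly p t\<bar> \<le> C"
proof -
  have "bounded (poly p ` {a..b})"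
    by (intro compact_imp_bounded compact_continuous_image continuous_intros compact_Icc)
  then show ?thesis
    using that by (fastforce simp: bounded_iff)
qed

lemma integrable_bounded_on_carrier:
  fixes f :: "real \<Rightarrow> real"
  assumes "finite_measure \<mu>" "sets \<mu> = sets borel" "emeasure \<mu> (- S) = 0" "S \<in> sets borel"
    and [measurable]: "f \<in> borel_measurable borel" and "\<And>t. t \<in> S \<Longrightarrow> \<bar>f t\<bar> \<le> C"
  shows "integrable \<mu> f"
proof (rule finite_measure.integrable_const_bound[where B = C])
  have "AE t in \<mu>. t \<in> S"
    by (rule AE_I[of _ _ "- S"]) (use assms in auto)
  then show "AE t in \<mu>. norm (f t) \<le> C"
    by eventually_elim (use assms in auto)
  show "f \<in> borel_measurable \<mu>"
    using assms(2,5) measurable_cong_sets by blast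
qed fact

text \<open>Compact inner approximations of \<open>B\<close> and of its complement are separated by a continuous
  function, to which the Weierstrass theorem applies.\<close>

lemma ex_poly_approx_indicator:
  fixes \<mu> :: "'i \<Rightarrow> real measure"
  assumes I: "finite I"
    and \<mu>: "\<And>i. i \<in> I \<Longrightarrow> finite_measure (\<mu> i)" "\<And>i. i \<in> I \<Longrightarrow> sets (\<mu> i) = sets borel"
      "\<And>i. i \<in> I \<Longrightarrow> emeasure (\<mu> i) (- {a..b}) = 0"
    and B: "B \<in> sets borel" and "0 < \<epsilon>"
  shows "\<exists>p. \<forall>i\<in>I. (\<integral>t. (poly p t - indicator B t)\<^sup>2 \<partial>\<mu> i) < \<epsilon>"
proof -
  \<comment> \<open>Error budget: the uniform error \<eta> contributes 2 \<eta>^2 C = \<epsilon> /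
    4, and the region \<open>W\<close> outside the compact sets contributes less than 2 * 2 \<delta>
    = \<epsilon> / 2.\<close>
  define \<delta> where "\<delta> = \<epsilon> / 8"
  have "0 < \<delta>" using \<open>0 < \<epsilon>\<close> by (simp add: \<delta>_def)
  have "\<exists>K. K \<subseteq> B \<and> compact K \<and> measure (\<mu> i) (B - K) < \<delta>" if "i \<in> I" for i
    using finite_measure_compact_inner_approx[OF \<mu>(1,2)[OF that] B \<open>0 < \<delta>\<close>] by metis
  then obtain K where K: "\<And>i. i \<in> I \<Longrightarrow> K i \<subseteq> B" "\<And>i. i \<in> I \<Longrightarrow> compact (K i)"
    "\<And>i. i \<in> I \<Longrightarrow> measure (\<mu> i) (B - K i) < \<delta>"
    by metis
  have "- B \<in> sets borel" using B by auto
  then have "\<exists>L. L \<subseteq> - B \<and> compact L \<and> measure (\<mu> i) (- B - L) < \<delta>" if "i \<in> I" for i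
    using finite_measure_compact_inner_approx[OF \<mu>(1,2)[OF that] _ \<open>0 < \<delta>\<close>] by metis
  then obtain L where L: "\<And>i. i \<in> I \<Longrightarrow> L i \<subseteq> - B" "\<And>i. i \<in> I \<Longrightarrow> compact (L i)"
    "\<And>i. i \<in> I \<Longrightarrow> measure (\<mu> i) (- B - L i) < \<delta>"
    by metis
  \<comment> \<open>One separating function must serve every measure of the family. Taking unions
    over the index set keeps \<open>S\<close> inside \<open>B\<close> and \<open>T\<close> inside
    the complement, while the uncovered region only shrinks; finiteness of \<open>I\<close> keeps
    both compact.\<close>
  define S T where "S = (\<Union>i\<in>I. K i)" and "T = (\<Union>i\<in>I. L i)"
  define W where "W = - (S \<union> T)"
  have ST: "S \<subseteq> B" "T \<subseteq> - B" "compact S" "compact T"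
    using K(1,2) L(1,2) I by (force simp: S_def T_def intro!: compact_UN)+
  then have "closed S" "closed T" "S \<inter> T = {}" by (auto dest: compact_imp_closed)
  then obtain f :: "real \<Rightarrow> real" where f: "continuous_on UNIV f"
    "\<And>t. f t \<in> closed_segment 1 0" "\<And>t. t \<in> S \<Longrightarrow> f t = 1" "\<And>t. t \<in> T \<Longrightarrow> f t = 0"
    using Urysohn[of S T "1::real" "0::real"] by metis
  have f01: "0 \<le> f t" "f t \<le> 1" for t
    using f(2)[of t] by (auto simp: closed_segment_eq_real_ivl)
  \<comment> \<open>The summand 1 keeps \<open>C\<close> positive, hence usable as a divisor in
    \<eta>, even when all masses vanish.\<close>
  define C where "C = 1 + (\<Sum>i\<in>I. measure (\<mu> i) UNIV)"
  have C: "measure (\<mu> i) UNIV \<le> C" if "i \<in> I" for i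
    using member_le_sum[of i I "\<lambda>i. measure (\<mu> i) UNIV"] that I by (simp add: C_def)
  have "1 \<le> C" by (simp add: C_def sum_nonneg)
  define \<eta> where "\<eta> = sqrt (\<epsilon> / (8 * C))"
  have \<eta>: "0 < \<eta>" "\<eta>\<^sup>2 = \<epsilon> / (8 * C)"
    using \<open>0 < \<epsilon>\<close> \<open>1 \<le> C\<close> by (simp_all add: \<eta>_def)
  obtain g where g: "real_polynomial_function g" "\<And>t. t \<in> {a..b} \<Longrightarrow> \<bar>f t - g t\<bar> < \<eta>"
    using Stone_Weierstrass_real_polynomial_function[OF compact_Icc continuous_on_subset[OF f(1)] \<eta>(1)]
    by auto
  obtain c n where c: "g = (\<lambda>t. \<Sum>i\<le>n. c i * t ^ i)"
    using g(1) by (auto simp: real_polynomial_function_iff_sum)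
  define p where "p = (\<Sum>i\<le>n. monom (c i) i)"
  have gp: "g t = poly p t" for t
    by (simp add: c p_def poly_sum poly_monom)
  have bound: "(poly p t - indicator B t)\<^sup>2 \<le> 2 * \<eta>\<^sup>2 + 2 * indicator W t"
    if t: "t \<in> {a..b}" for t
  proof -
    have "\<bar>poly p t - f t\<bar> \<le> \<eta>" using g(2)[OF t] by (simp add: gp abs_minus_commute)
    then have 1: "(poly p t - f t)\<^sup>2 \<le> \<eta>\<^sup>2"
      using \<eta>(1) by (simp add: abs_le_square_iff[symmetric])
    have "\<bar>f t - indicator B t\<bar> \<le> indicator W t"
      using f(3,4)[of t] f01[of t] ST by (auto simp: indicator_def W_def)
    then have "\<bar>f t - indicator B t\<bar>\<^sup>2 \<le> (indicator W t)\<^sup>2"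
      by (intro power_mono) auto
    also have "(indicator W t)\<^sup>2 = (indicator W t :: real)"
      by (cases "t \<in> W") auto
    finally have 2: "(f t - indicator B t)\<^sup>2 \<le> indicator W t"
      by simp
    have "(poly p t - indicator B t)\<^sup>2 \<le> 2 * (poly p t - f t)\<^sup>2 + 2 * (f t - indicator B t)\<^sup>2"
      using sum_squares_bound[of "poly p t - f t" "f t - indicator B t"]
      by (simp add: power2_eq_square algebra_simps)
    with 1 2 show ?thesis by simp
  qed
  have "(\<integral>t. (poly p t - indicator B t)\<^sup>2 \<partial>\<mu> i) < \<epsilon>" if i: "i \<in> I" for i
  proof -
    interpret finite_measure "\<mu> i" by (rule \<mu>(1)[OF i])
    note [simp] = \<mu>(2)[OF i]
    have [simp]: "space (\<mu> i) = UNIV" using \<mu>(2)[OF i] sets_eq_imp_space_eq by force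
    have KL: "K i \<in> sets borel" "L i \<in> sets borel" using K(2)[OF i] L(2)[OF i] by (auto intro: borel_compact)
    have meas: "W \<in> sets (\<mu> i)"
      using ST unfolding W_def \<mu>(2)[OF i]
      by (intro borel_open open_Compl closed_Un compact_imp_closed)
    have "(\<integral>t. (poly p t - indicator B t)\<^sup>2 \<partial>\<mu> i)
        \<le> (\<integral>t. 2 * \<eta>\<^sup>2 + 2 * indicator W t \<partial>\<mu> i)"
    proof (rule integral_mono_AE')
      have "AE t in \<mu> i. t \<in> {a..b}"
        by (rule AE_I[of _ _ "- {a..b}"]) (use \<mu>(3)[OF i] in auto)
      then show "AE t in \<mu> i. (poly p t - indicator B t)\<^sup>2 \<le> 2 * \<eta>\<^sup>2 + 2 * indicator W t"
        by eventually_elim (rule bound)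
      show "integrable (\<mu> i) (\<lambda>t. 2 * \<eta>\<^sup>2 + 2 * indicator W t)"
        using meas by (auto intro!: integrable_real_indicator simp: emeasure_eq_measure)
    qed (auto simp: indicator_def)
    also have "\<dots> = 2 * \<eta>\<^sup>2 * measure (\<mu> i) UNIV + 2 * measure (\<mu> i) W"
      using meas by (subst Bochner_Integration.integral_add)
        (auto intro!: integrable_real_indicator simp: emeasure_eq_measure)
    also have "measure (\<mu> i) W \<le> measure (\<mu> i) ((B - K i) \<union> (- B - L i))"
      using B KL i by (intro finite_measure_mono) (auto simp: W_def S_def T_def)
    also have "\<dots> \<le> measure (\<mu> i) (B - K i) + measure (\<mu> i) (- B - L i)"
      using B KL by (intro measure_Un_le) auto
    also have "\<dots> < 2 * \<delta>" using K(3)[OF i] L(3)[OF i] by simp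
    also have "2 * \<eta>\<^sup>2 * measure (\<mu> i) UNIV \<le> 2 * \<eta>\<^sup>2 * C"
      by (intro mult_left_mono C i) auto
    also have "2 * \<eta>\<^sup>2 * C = \<epsilon> / 4"
      using \<open>1 \<le> C\<close> by (simp add: \<eta>)
    finally show ?thesis using \<open>0 < \<epsilon>\<close> by (simp add: \<delta>_def)
  qed
  then show ?thesis by blast
qed

text \<open>Cauchy-Schwarz against the constant function 1, read off from the nonnegativity of the
  integral of (g - c)^2 at c = G / m. Taking m as 1 plus the total mass gives a slightly weaker
  constant but keeps the division legal for the zero measure.\<close>

lemma integral_squared_le:
  fixes g :: "'b \<Rightarrow> real"
  assumes "finite_measure \<mu>" "integrable \<mu> g" "integrable \<mu> (\<lambda>t. (g t)\<^sup>2)"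
  shows "(\<integral>t. g t \<partial>\<mu>)\<^sup>2 \<le> (1 + measure \<mu> (space \<mu>)) * (\<integral>t. (g t)\<^sup>2 \<partial>\<mu>)"
proof -
  interpret finite_measure \<mu> by fact
  define m where "m = 1 + measure \<mu> (space \<mu>)"
  define G where "G = (\<integral>t. g t \<partial>\<mu>)"
  define c where "c = G / m"
  have "1 \<le> m" by (simp add: m_def)
  have "0 \<le> (\<integral>t. (g t - c)\<^sup>2 \<partial>\<mu>)" by simp
  also have "\<dots> = (\<integral>t. (g t)\<^sup>2 - 2 * c * g t + c\<^sup>2 \<partial>\<mu>)"
    by (intro Bochner_Integration.integral_cong refl) (simp add: power2_eq_square algebra_simps)
  also have "\<dots> = (\<integral>t. (g t)\<^sup>2 \<partial>\<mu>) - 2 * c * G + c\<^sup>2 * (m - 1)"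
    using assms by (simp add: G_def m_def)
  also have "\<dots> \<le> (\<integral>t. (g t)\<^sup>2 \<partial>\<mu>) - 2 * c * G + c\<^sup>2 * m"
    by (simp add: algebra_simps)
  also have "\<dots> = (\<integral>t. (g t)\<^sup>2 \<partial>\<mu>) - G\<^sup>2 / m"
    using \<open>1 \<le> m\<close> by (simp add: c_def power2_eq_square field_simps)
  finally show ?thesis
    using \<open>1 \<le> m\<close> by (simp add: G_def[symmetric] m_def[symmetric] field_simps)
qed

lemma tendsto_of_norm_sq_le:
  fixes X :: "nat \<Rightarrow> 'a::real_normed_vector"
  assumes "\<And>n. (norm (X n - L))\<^sup>2 \<le> c * e n" "e \<longlonglongrightarrow> 0"
  shows "X \<longlonglongrightarrow> L"
proof -
  have "(\<lambda>n. sqrt (c * e n)) \<longlonglongrightarrow> sqrt (c * 0)"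
    by (intro tendsto_intros assms)
  moreover have "norm (X n - L) \<le> sqrt (c * e n)" for n
    using assms(1) real_le_rsqrt by blast
  ultimately have "(\<lambda>n. X n - L) \<longlonglongrightarrow> 0"
    by (intro Lim_null_comparison[of "\<lambda>n. X n - L"]) auto
  then show ?thesis by (simp add: LIM_zero_iff)
qed

section \<open>Measures representing the moments of a positive operator\<close>

locale positive_operator =
  fixes A :: "'a::{real_inner, complete_space} \<Rightarrow> 'a" and M :: real
  assumes bounded_linear_A: "bounded_linear A"
    and selfadjoint: "inner (A x) y = inner x (A y)"
    and form_nonneg: "0 \<le> inner (A x) x"
    and form_le: "inner (A x) x \<le> M * inner x x"
    and M_pos: "0 < M"
begin

lemma linear_A: "linear A"
  using bounded_linear_A by (rule bounded_linear.linear)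

text \<open>Positivity of A (M - A), the one mixed case in the positivity of Bernstein polynomials.
  It comes from testing the form of \<open>A\<close> at y = x - A x / M and bounding <A A x, A x> by
  M |A x|^2, so no square root of \<open>A\<close> enters.\<close>

lemma inner_A_le: "inner (A x) (A x) \<le> M * inner (A x) x"
proof -
  interpret A: bounded_linear A by (rule bounded_linear_A)
  define N where "N = inner (A x) (A x)"
  define y where "y = x - (1 / M) *\<^sub>R A x"
  have "0 \<le> inner (A y) y" by (rule form_nonneg)
  also have "inner (A y) y = inner (A x) x - 2 * (1 / M) * N + (1 / M)\<^sup>2 * inner (A (A x)) (A x)"
    using selfadjoint[of "A x" x]
    by (simp add: y_def N_def A.diff A.scaleR inner_diff_left inner_diff_right power2_eq_square
        inner_commute)
  also have "\<dots> \<le> inner (A x) x - 2 * (1 / M) * N + (1 / M)\<^sup>2 * (M * N)"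
    unfolding N_def by (intro add_left_mono mult_left_mono form_le) auto
  also have "\<dots> = inner (A x) x - N / M"
    using M_pos by (simp add: field_simps power2_eq_square)
  finally show ?thesis using M_pos by (simp add: N_def field_simps)
qed

text \<open>Up to a square, the polynomial is one of \<open>1\<close>, \<open>X\<close>, \<open>M - X\<close>, \<open>X (M - X)\<close>.\<close>

lemma bernstein_form_nonneg:
  "0 \<le> inner (poly_op A ([:0, 1:] ^ k * [:M, -1:] ^ l) x) x"
proof -
  define r :: "real poly" where "r = [:0, 1:] ^ (k div 2) * [:M, -1:] ^ (l div 2)"
  define s :: "real poly" where "s = [:0, 1:] ^ (k mod 2) * [:M, -1:] ^ (l mod 2)"
  define y where "y = poly_op A r x"
  have k: "[:0, 1:] ^ k = [:0, 1:] ^ (k mod 2) * ([:0, 1:] ^ (k div 2) * [:0, 1:] ^ (k div 2) :: real poly)"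
    by (simp only: power_add[symmetric]) (metis add.commute mult_2 mult_div_mod_eq)
  have l: "[:M, -1:] ^ l = [:M, -1:] ^ (l mod 2) * ([:M, -1:] ^ (l div 2) * [:M, -1:] ^ (l div 2))"
    by (simp only: power_add[symmetric]) (metis add.commute mult_2 mult_div_mod_eq)
  have "[:0, 1:] ^ k * [:M, -1:] ^ l = r * (s * r)"
    unfolding k l r_def s_def by (simp only: mult_ac)
  \<comment> \<open>One factor r(A) is moved across the inner product, which leaves the form of s(A)
    at y = r(A) x, with exponents 0 or 1 in \<open>s\<close>.\<close>
  then have eq: "inner (poly_op A ([:0, 1:] ^ k * [:M, -1:] ^ l) x) x = inner (poly_op A s y) y"
    by (simp only: poly_op_mult[OF linear_A] y_def poly_op_selfadjoint[OF linear_A selfadjoint])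
  have A0: "A 0 = 0" using linear_A by (rule linear_0)
  have "k mod 2 = 0 \<or> k mod 2 = 1" "l mod 2 = 0 \<or> l mod 2 = 1"
    by auto
  then have "s = 1 \<or> s = [:0, 1:] \<or> s = [:M, -1:] \<or> s = [:0, 1:] * [:M, -1:]"
    by (auto simp: s_def simp del: mod2_eq_if)
  moreover have "poly_op A [:0, 1:] y = A y" "poly_op A [:M, -1:] y = M *\<^sub>R y - A y"
    "poly_op A ([:0, 1:] * [:M, -1:]) y = M *\<^sub>R A y - A (A y)"
    by (simp_all add: poly_op_pCons[OF linear_A] A0 linear_diff[OF linear_A] linear_scale[OF linear_A]
        linear_neg[OF linear_A] del: mult_pCons_left mult_pCons_right
        add: poly_op_mult[OF linear_A])
  ultimately have "0 \<le> inner (poly_op A s y) y"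
    using form_nonneg[of y] form_le[of y] inner_A_le[of y]
    by (auto simp: inner_diff_left selfadjoint[of "A y" y])
  then show ?thesis unfolding eq .
qed

definition bernstein_weight :: "nat \<Rightarrow> 'a \<Rightarrow> nat \<Rightarrow> real" where
  "bernstein_weight n x k =
     real (n choose k) * inner (poly_op A ([:0, 1:] ^ k * [:M, -1:] ^ (n - k)) x) x / M ^ n"

lemma bernstein_weight_nonneg: "0 \<le> bernstein_weight n x k"
  using bernstein_form_nonneg[of k "n - k" x] M_pos by (simp add: bernstein_weight_def)

text \<open>Factorial moments of the weights are exact for every n, without a limit: the binomial
  identity collapses the sum since X + (M - X) is the constant M. The case m = 0 gives the total
  mass |x|^2.\<close>

lemma bernstein_weight_factorial_moment:
  assumes "m \<le> n"
  shows "(\<Sum>k\<le>n. real (k choose m) / real (n choose m) * bernstein_weight n x k)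
       = inner (poly_op A ([:0, 1:] ^ m) x) x / M ^ m"
proof -
  define X Y where "X = ([:0, 1:] :: real poly)" and "Y = [:M, -1:]"
  have "(\<Sum>k\<le>n. real (k choose m) / real (n choose m) * bernstein_weight n x k)
      = inner (poly_op A (\<Sum>k\<le>n. of_nat (k choose m) * (of_nat (n choose k) * X ^ k * Y ^ (n - k))) x) x
          / (real (n choose m) * M ^ n)"
    unfolding poly_op_sum inner_sum_left sum_divide_distrib
    by (rule sum.cong)
       (simp_all add: bernstein_weight_def X_def Y_def of_nat_poly poly_op_smult mult.assoc)
  also have "(\<Sum>k\<le>n. of_nat (k choose m) * (of_nat (n choose k) * X ^ k * Y ^ (n - k)))
      = smult (real (n choose m) * M ^ (n - m)) (X ^ m)"
    unfolding sum_choose_mult_binomial[OF assms]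
    by (simp add: X_def Y_def of_nat_poly poly_const_pow mult.commute)
  also have "M ^ n = M ^ (n - m) * M ^ m"
    using assms by (simp flip: power_add)
  finally show ?thesis
    using M_pos assms by (simp add: poly_op_smult X_def)
qed

text \<open>Ordinary moments differ from the exact factorial ones by an error of order 1 / n,
  uniformly in k. As the weights are nonnegative with total mass |x|^2 for every n, the error
  survives summation.\<close>

lemma bernstein_weight_moment_tendsto:
  "(\<lambda>n. \<Sum>k\<le>n. (M * real k / real n) ^ m * bernstein_weight n x k)
     \<longlonglongrightarrow> inner (poly_op A ([:0, 1:] ^ m) x) x"
proof -
  let ?b = "\<lambda>n k. bernstein_weight n x k"
  let ?L = "inner (poly_op A ([:0, 1:] ^ m) x) x"
  have total: "(\<Sum>k\<le>n. ?b n k) = inner x x" for n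
    using bernstein_weight_factorial_moment[of 0 n x] by simp
  have bd: "\<bar>(\<Sum>k\<le>n. (real k / real n) ^ m * ?b n k) - ?L / M ^ m\<bar>
      \<le> real m * (real m / (real n - real m)) * inner x x" if n: "2 * m < n" for n
  proof -
    have "(\<Sum>k\<le>n. (real k / real n) ^ m * ?b n k) - ?L / M ^ m
        = (\<Sum>k\<le>n. ((real k / real n) ^ m - real (k choose m) / real (n choose m)) * ?b n k)"
      using n by (simp add: bernstein_weight_factorial_moment[symmetric, of m n] sum_subtractf
          left_diff_distrib)
    also have "\<bar>\<dots>\<bar> \<le> (\<Sum>k\<le>n. \<bar>((real k / real n) ^ m - real (k choose m) / real (n choose m)) * ?b n k\<bar>)"
      by (rule sum_abs)
    also have "\<dots> \<le> (\<Sum>k\<le>n. real m * (real m / (real n - real m)) * ?b n k)"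
    proof (rule sum_mono)
      fix k assume "k \<in> {..n}"
      then have "\<bar>(real k / real n) ^ m - real (k choose m) / real (n choose m)\<bar>
          \<le> real m * (real m / (real n - real m))"
        using choose_ratio_approx[of k n m] n by (simp only: abs_minus_commute atMost_iff)
      then show "\<bar>((real k / real n) ^ m - real (k choose m) / real (n choose m)) * ?b n k\<bar>
          \<le> real m * (real m / (real n - real m)) * ?b n k"
        using bernstein_weight_nonneg[of n x k]
        by (simp only: abs_mult abs_of_nonneg mult_right_mono)
    qed
    also have "\<dots> = real m * (real m / (real n - real m)) * inner x x"
      by (simp only: sum_distrib_left[symmetric] total)
    finally show ?thesis .
  qed
  have "(\<lambda>n. real m * (real m / (real n - real m)) * inner x x) \<longlonglongrightarrow> 0"
    by real_asymp
  then have "(\<lambda>n. (\<Sum>k\<le>n. (real k / real n) ^ m * ?b n k) - ?L / M ^ m) \<longlonglongrightarrow> 0"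
    by (rule Lim_null_comparison[rotated])
       (use bd in \<open>auto simp: eventually_sequentially intro!: exI[of _ "Suc (2 * m)"]\<close>)
  then have "(\<lambda>n. M ^ m * (\<Sum>k\<le>n. (real k / real n) ^ m * ?b n k)) \<longlonglongrightarrow> M ^ m * (?L / M ^ m)"
    by (intro tendsto_intros) (simp add: LIM_zero_iff)
  then show ?thesis
    using M_pos by (simp add: sum_distrib_left power_mult_distrib power_divide mult_ac)
qed

text \<open>Unit length turns the weights into probability distributions, so that tightness and
  Helly selection apply. Weak convergence transfers only integrals of bounded continuous functions,
  whereas powers of t are unbounded on the line; a truncation bridges the gap.\<close>

lemma ex_moment_measure_unit:
  assumes x: "inner x x = 1"
  shows "\<exists>\<mu>. finite_measure \<mu> \<and> sets \<mu> = sets borel \<and> emeasure \<mu> (- {0..M}) = 0 \<and>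
           (\<forall>p. (\<integral>t. poly p t \<partial>\<mu>) = inner (poly_op A p x) x)"
proof -
  let ?b = "\<lambda>n k. bernstein_weight n x k"
  define D where "D n = point_measure {..n} (\<lambda>k. ennreal (?b n k))" for n
  \<comment> \<open>For n = 0 the only mass point is M * 0 / 0 = 0, which still lies in
    [0, M].\<close>
  define X where "X n k = M * real k / real n" for n k :: nat
  define \<mu> where "\<mu> n = distr (D n) borel (X n)" for n
  have total: "(\<Sum>k\<le>n. ?b n k) = 1" for n
    using bernstein_weight_factorial_moment[of 0 n x] x by simp
  have "prob_space (D n)" for n
    by rule (simp add: D_def space_point_measure emeasure_point_measure_finite
        bernstein_weight_nonneg total sum_ennreal)
  then interpret D: prob_space "D n" for n .
  have X [measurable]: "X n \<in> borel_measurable (D n)" for n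
    by (simp add: D_def)
  then have rd: "real_distribution (\<mu> n)" for n
    unfolding \<mu>_def by (rule D.real_distribution_distr)
  have X_range: "0 \<le> X n k" "X n k \<le> M" if "k \<le> n" for n k
    using that M_pos by (auto simp: X_def field_simps divide_le_eq)
  \<comment> \<open>Tightness is phrased with half-open intervals; the left end -1 keeps a possible
    atom at 0 inside.\<close>
  have "measure (\<mu> n) {-1<..M} = 1" for n
  proof -
    have "X n -` {-1<..M} \<inter> space (D n) = space (D n)"
      using X_range by (force simp: D_def space_point_measure intro: less_le_trans[of _ 0])
    then show ?thesis
      by (simp add: \<mu>_def measure_distr D.prob_space)
  qed
  then have "tight \<mu>"
    unfolding tight_def
  proof (intro conjI allI impI)
    fix \<epsilon> :: real assume "0 < \<epsilon>"
    then show "\<exists>a b. a < b \<and> (\<forall>n. 1 - \<epsilon> < measure (\<mu> n) {a<..b})"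
      using M_pos \<open>\<And>n. measure (\<mu> n) {-1<..M} = 1\<close> by (intro exI[of _ "-1"] exI[of _ M]) auto
  qed (rule rd)
  from tight_imp_convergent_subsubsequence[OF this strict_mono_id]
  obtain r N where r: "strict_mono (r :: nat \<Rightarrow> nat)" and N: "real_distribution N"
    and conv: "weak_conv_m (\<mu> \<circ> r) N"
    by auto
  interpret N: real_distribution N by (rule N)
  \<comment> \<open>Truncation to [0, M] makes the powers bounded and continuous and changes nothing
    at the mass points. The image of the limit measure under it is carried by [0, M] by
    construction.\<close>
  define clamp where "clamp t = max 0 (min M t)" for t :: real
  have clamp: "0 \<le> clamp t" "clamp t \<le> M" "t \<in> {0..M} \<Longrightarrow> clamp t = t" for t
    using M_pos by (auto simp: clamp_def)
  have cont: "isCont clamp t" for t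
    unfolding clamp_def by (intro continuous_intros)
  have [measurable]: "clamp \<in> borel_measurable borel"
    unfolding clamp_def by measurable
  define \<nu> where "\<nu> = distr N borel clamp"
  interpret \<nu>: prob_space \<nu>
    unfolding \<nu>_def by (rule N.prob_space_distr) simp
  have "clamp -` (- {0..M}) \<inter> space N = {}"
    using clamp(1,2) by auto
  then have \<nu>: "finite_measure \<nu>" "sets \<nu> = sets borel" "emeasure \<nu> (- {0..M}) = 0"
    by (simp_all add: \<nu>_def emeasure_distr N.finite_measure_distr)
  have moment: "(\<integral>t. t ^ m \<partial>\<nu>) = inner (poly_op A ([:0, 1:] ^ m) x) x" for m
  proof -
    have "(\<lambda>n. integral\<^sup>L ((\<mu> \<circ> r) n) (\<lambda>t. clamp t ^ m)) \<longlonglongrightarrow> integral\<^sup>L N (\<lambda>t. clamp t ^ m)"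
    proof (rule weak_conv_imp_integral_bdd_continuous_conv)
      show "norm (clamp t ^ m) \<le> M ^ m" for t
        using clamp[of t] by (auto simp: power_abs intro!: power_mono)
      show "real_distribution ((\<mu> \<circ> r) n)" for n using rd by simp
      show "isCont (\<lambda>t. clamp t ^ m) t" for t
        by (rule isCont_power[OF cont])
      show "weak_conv_m (\<lambda>n. (\<mu> \<circ> r) n) N" using conv by (simp add: o_def)
    qed (rule N)
    also have "(\<lambda>n. integral\<^sup>L ((\<mu> \<circ> r) n) (\<lambda>t. clamp t ^ m))
        = (\<lambda>n. \<Sum>k\<le>r n. (M * real k / real (r n)) ^ m * ?b (r n) k)"
    proof
      fix n
      have "integral\<^sup>L ((\<mu> \<circ> r) n) (\<lambda>t. clamp t ^ m) = integral\<^sup>L (D (r n)) (\<lambda>k. clamp (X (r n) k) ^ m)"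
        by (simp add: \<mu>_def integral_distr)
      also have "\<dots> = (\<Sum>k\<le>r n. ?b (r n) k * clamp (X (r n) k) ^ m)"
        by (simp add: D_def lebesgue_integral_point_measure_finite bernstein_weight_nonneg)
      also have "\<dots> = (\<Sum>k\<le>r n. (M * real k / real (r n)) ^ m * ?b (r n) k)"
        using X_range by (intro sum.cong) (auto simp: clamp(3) X_def)
      finally show "integral\<^sup>L ((\<mu> \<circ> r) n) (\<lambda>t. clamp t ^ m)
        = (\<Sum>k\<le>r n. (M * real k / real (r n)) ^ m * ?b (r n) k)" .
    qed
    finally have "(\<lambda>n. \<Sum>k\<le>r n. (M * real k / real (r n)) ^ m * ?b (r n) k)
      \<longlonglongrightarrow> integral\<^sup>L N (\<lambda>t. clamp t ^ m)" .
    moreover have "(\<lambda>n. \<Sum>k\<le>r n. (M * real k / real (r n)) ^ m * ?b (r n) k)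
      \<longlonglongrightarrow> inner (poly_op A ([:0, 1:] ^ m) x) x"
      using LIMSEQ_subseq_LIMSEQ[OF bernstein_weight_moment_tendsto[of m x] r] by (simp add: o_def)
    ultimately show ?thesis
      using LIMSEQ_unique by (fastforce simp: \<nu>_def integral_distr)
  qed
  have "(\<integral>t. poly p t \<partial>\<nu>) = inner (poly_op A p x) x" for p
  proof -
    have int: "integrable \<nu> (\<lambda>t. t ^ i)" for i
      by (rule integrable_bounded_on_carrier[OF \<nu>, of _ "M ^ i"])
         (auto simp: power_abs intro!: power_mono)
    have "(\<integral>t. poly p t \<partial>\<nu>) = (\<Sum>i\<le>degree p. coeff p i * (\<integral>t. t ^ i \<partial>\<nu>))"
      by (simp add: poly_altdef int Bochner_Integration.integral_sum)
    also have "\<dots> = inner (poly_op A (\<Sum>i\<le>degree p. smult (coeff p i) ([:0, 1:] ^ i)) x) x"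
      by (simp add: moment poly_op_sum poly_op_smult inner_sum_left)
    also have "(\<Sum>i\<le>degree p. smult (coeff p i) ([:0, 1:] ^ i)) = p"
      using poly_as_sum_of_monoms[of p] by (simp add: monom_altdef)
    finally show ?thesis .
  qed
  with \<nu> show ?thesis by blast
qed

text \<open>Both sides of the moment identity are homogeneous of degree two in x, so the measure of
  x / |x| is multiplied by |x|^2; the zero vector gets the zero measure.\<close>

lemma ex_moment_measure:
  "\<exists>\<mu>. finite_measure \<mu> \<and> sets \<mu> = sets borel \<and> emeasure \<mu> (- {0..M}) = 0 \<and>
     (\<forall>p. (\<integral>t. poly p t \<partial>\<mu>) = inner (poly_op A p x) x)"
proof (cases "x = 0")
  case True
  have "linear (poly_op A p)" for p
    by (rule bounded_linear.linear[OF bounded_linear_poly_op[OF bounded_linear_A]])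
  then have "poly_op A p 0 = 0" for p by (rule linear_0)
  moreover have "finite_measure (null_measure borel)"
    by (rule finite_measureI) simp
  moreover have "(\<integral>t. poly p t \<partial>null_measure borel) = 0" for p
    by (simp add: integral_null_measure)
  ultimately show ?thesis
    unfolding True by (intro exI[of _ "null_measure borel"] conjI allI) simp_all
next
  case False
  define u where "u = (1 / norm x) *\<^sub>R x"
  have "inner u u = 1" using False by (simp add: u_def dot_square_norm power2_eq_square)
  from ex_moment_measure_unit[OF this] obtain \<mu> where \<mu>: "finite_measure \<mu>" "sets \<mu> = sets borel"
    "emeasure \<mu> (- {0..M}) = 0" "\<And>p. (\<integral>t. poly p t \<partial>\<mu>) = inner (poly_op A p u) u" by metis
  interpret finite_measure \<mu> by fact
  define \<nu> where "\<nu> = density \<mu> (\<lambda>_. ennreal ((norm x)\<^sup>2))"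
  have "emeasure \<nu> (space \<nu>) \<noteq> \<infinity>"
    by (simp add: \<nu>_def emeasure_density_const emeasure_eq_measure ennreal_mult_eq_top_iff)
  then have "finite_measure \<nu>" by (rule finite_measureI)
  moreover have "sets \<nu> = sets borel" "emeasure \<nu> (- {0..M}) = 0"
    using \<mu>(2,3) by (simp_all add: \<nu>_def emeasure_density_const)
  moreover have "(\<integral>t. poly p t \<partial>\<nu>) = inner (poly_op A p x) x" for p
  proof -
    interpret L: bounded_linear "poly_op A p"
      by (rule bounded_linear_poly_op[OF bounded_linear_A])
    have "poly p \<in> borel_measurable borel"
      by (intro borel_measurable_continuous_onI continuous_intros)
    then have "poly p \<in> borel_measurable \<mu>"
      using \<mu>(2) measurable_cong_sets by blast
    then have "(\<integral>t. poly p t \<partial>\<nu>) = (norm x)\<^sup>2 * inner (poly_op A p u) u"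
      by (simp add: \<nu>_def integral_density \<mu>(4))
    also have "\<dots> = inner (poly_op A p x) x"
      using False by (simp add: u_def L.scaleR power2_eq_square)
    finally show ?thesis .
  qed
  ultimately show ?thesis by blast
qed

definition moment_measure :: "'a \<Rightarrow> real measure" where
  "moment_measure x = (SOME \<mu>. finite_measure \<mu> \<and> sets \<mu> = sets borel \<and> emeasure \<mu> (- {0..M}) = 0 \<and>
     (\<forall>p. (\<integral>t. poly p t \<partial>\<mu>) = inner (poly_op A p x) x))"

lemma finite_measure_moment: "finite_measure (moment_measure x)"
  and sets_moment [simp]: "sets (moment_measure x) = sets borel"
  and null_moment: "emeasure (moment_measure x) (- {0..M}) = 0"
  and integral_poly_moment: "(\<integral>t. poly p t \<partial>moment_measure x) = inner (poly_op A p x) x"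
  using someI_ex[OF ex_moment_measure[of x], folded moment_measure_def] by blast+

lemma space_moment [simp]: "space (moment_measure x) = UNIV"
  using sets_eq_imp_space_eq[OF sets_moment[of x]] by simp

lemma AE_moment: "AE t in moment_measure x. t \<in> {0..M}"
  by (rule AE_I[of _ _ "- {0..M}"]) (auto simp: null_moment)

lemma measure_moment_UNIV: "measure (moment_measure x) UNIV = inner x x"
  using integral_poly_moment[of x 1] by simp

lemma integrable_moment:
  fixes f :: "real \<Rightarrow> real"
  assumes "f \<in> borel_measurable borel" "\<And>t. t \<in> {0..M} \<Longrightarrow> \<bar>f t\<bar> \<le> C"
  shows "integrable (moment_measure x) f"
  by (rule integrable_bounded_on_carrier[OF finite_measure_moment sets_moment null_moment])
     (use assms in auto)

lemma borel_measurable_poly [measurable]: "poly p \<in> borel_measurable (borel :: real measure)"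
  by (intro borel_measurable_continuous_onI continuous_intros)

lemma integrable_poly_moment: "integrable (moment_measure x) (poly p)"
  by (rule poly_bounded_on_interval[of 0 M p]) (blast intro: integrable_moment borel_measurable_poly)

lemma integrable_poly_sq_moment: "integrable (moment_measure x) (\<lambda>t. (poly p t)\<^sup>2)"
proof -
  have "poly (p * p) = (\<lambda>t. (poly p t)\<^sup>2)" by (simp add: fun_eq_iff power2_eq_square)
  then show ?thesis using integrable_poly_moment[of x "p * p"] by simp
qed

lemma integrable_err_moment:
  assumes [measurable]: "B \<in> sets borel"
  shows "integrable (moment_measure x) (\<lambda>t. poly p t - indicator B t)"
    and "integrable (moment_measure x) (\<lambda>t. (poly p t - indicator B t)\<^sup>2)"
proof -
  obtain C where C: "\<And>t. t \<in> {0..M} \<Longrightarrow> \<bar>poly p t\<bar> \<le> C"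
    using poly_bounded_on_interval by blast
  have bd: "\<bar>poly p t - indicator B t\<bar> \<le> C + 1" if "t \<in> {0..M}" for t
    using C[OF that] by (auto simp: indicator_def)
  then show "integrable (moment_measure x) (\<lambda>t. poly p t - indicator B t)"
    by (intro integrable_moment[where C = "C + 1"]) simp_all
  have "\<bar>(poly p t - indicator B t)\<^sup>2\<bar> \<le> (C + 1)\<^sup>2" if "t \<in> {0..M}" for t
    using power_mono[OF bd[OF that], of 2] by simp
  then show "integrable (moment_measure x) (\<lambda>t. (poly p t - indicator B t)\<^sup>2)"
    by (intro integrable_moment[where C = "(C + 1)\<^sup>2"]) simp_all
qed

section \<open>Spectral projections as mean-square limits of polynomials in the operator\<close>

definition sq_err :: "real set \<Rightarrow> real poly \<Rightarrow> 'a \<Rightarrow> real" where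
  "sq_err B p x = (\<integral>t. (poly p t - indicator B t)\<^sup>2 \<partial>moment_measure x)"

lemma sq_err_nonneg [simp]: "0 \<le> sq_err B p x"
  by (simp add: sq_err_def)

lemma norm_poly_op: "(norm (poly_op A p x))\<^sup>2 = (\<integral>t. (poly p t)\<^sup>2 \<partial>moment_measure x)"
proof -
  have "(norm (poly_op A p x))\<^sup>2 = inner (poly_op A (p * p) x) x"
    by (simp add: power2_norm_eq_inner poly_op_mult[OF linear_A]
        poly_op_selfadjoint[OF linear_A selfadjoint])
  then show ?thesis by (simp flip: integral_poly_moment add: power2_eq_square)
qed

lemma norm_poly_op_diff_le:
  assumes "B \<in> sets borel"
  shows "(norm (poly_op A p x - poly_op A q x))\<^sup>2 \<le> 2 * sq_err B p x + 2 * sq_err B q x"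
proof -
  have "(norm (poly_op A p x - poly_op A q x))\<^sup>2 = (\<integral>t. (poly (p - q) t)\<^sup>2 \<partial>moment_measure x)"
    by (simp only: poly_op_diff[symmetric] norm_poly_op)
  also have "\<dots> \<le> (\<integral>t. 2 * (poly p t - indicator B t)\<^sup>2 + 2 * (poly q t - indicator B t)\<^sup>2 \<partial>moment_measure x)"
  proof (intro integral_mono integrable_poly_sq_moment)
    show "(poly (p - q) t)\<^sup>2 \<le> 2 * (poly p t - indicator B t)\<^sup>2 + 2 * (poly q t - indicator B t)\<^sup>2" for t
      using zero_le_power2[of "(poly p t - indicator B t) + (poly q t - indicator B t)"]
      by (simp add: power2_eq_square algebra_simps)
  qed (intro Bochner_Integration.integrable_add integrable_mult_right integrable_err_moment assms)
  also have "\<dots> = 2 * sq_err B p x + 2 * sq_err B q x"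
    by (simp add: sq_err_def integrable_err_moment assms)
  finally show ?thesis .
qed

text \<open>The moment measures of different vectors are linked only through polynomials.
  Additivity, symmetry and the product rule compare several vectors, so one polynomial sequence must
  approximate the indicator for all of them at once.\<close>

lemma ex_approx_seq:
  assumes "finite X" "B \<in> sets borel"
  obtains P where "\<And>x. x \<in> X \<Longrightarrow> (\<lambda>n. sq_err B (P n) x) \<longlonglongrightarrow> 0"
    "\<And>x n. x \<in> X \<Longrightarrow> sq_err B (P n) x < 1 / real (Suc n)"
proof -
  have "\<exists>p. \<forall>x\<in>X. sq_err B p x < 1 / real (Suc n)" for n
    unfolding sq_err_def
    by (rule ex_poly_approx_indicator[OF assms(1) finite_measure_moment sets_moment null_moment assms(2)]) simp
  then obtain P where P: "\<And>x n. x \<in> X \<Longrightarrow> sq_err B (P n) x < 1 / real (Suc n)" by metis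
  have "(\<lambda>n. sq_err B (P n) x) \<longlonglongrightarrow> 0" if "x \<in> X" for x
    by (rule tendsto_sandwich[OF _ _ tendsto_const LIMSEQ_Suc[OF lim_1_over_n]])
       (use P[OF that] in \<open>auto intro!: always_eventually less_imp_le\<close>)
  then show ?thesis using P that by blast
qed

lemma ex_approx_seq_on:
  assumes "finite X" "B \<in> sets borel"
  shows "\<exists>P. \<forall>x\<in>X. (\<lambda>n. sq_err B (P n) x) \<longlonglongrightarrow> 0"
  using ex_approx_seq[OF assms] by metis

lemma ex_approx_seq_single:
  assumes "B \<in> sets borel"
  obtains P where "(\<lambda>n. sq_err B (P n) x) \<longlonglongrightarrow> 0" "\<And>n. sq_err B (P n) x < 1 / real (Suc n)"
proof -
  obtain P where "\<And>z. z \<in> {x} \<Longrightarrow> (\<lambda>n. sq_err B (P n) z) \<longlonglongrightarrow> 0"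
    "\<And>z n. z \<in> {x} \<Longrightarrow> sq_err B (P n) z < 1 / real (Suc n)"
    using ex_approx_seq[of "{x}" B] assms by blast
  then show ?thesis using that by blast
qed

text \<open>The limit along one approximating sequence satisfies the bound for every polynomial, so
  it does not remember the sequence: p(A) x tends to it along any sequence whose error tends to
  0.\<close>

lemma ex_spectral_op:
  assumes B: "B \<in> sets borel"
  shows "\<exists>y. \<forall>p. (norm (poly_op A p x - y))\<^sup>2 \<le> 2 * sq_err B p x"
proof -
  obtain P where P: "(\<lambda>n. sq_err B (P n) x) \<longlonglongrightarrow> 0"
    "\<And>n. sq_err B (P n) x < 1 / real (Suc n)"
    using ex_approx_seq_single[OF B] by blast
  have "Cauchy (\<lambda>n. poly_op A (P n) x)"
  proof (rule metric_CauchyI)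
    fix e :: real assume "0 < e"
    \<comment> \<open>Both squared errors enter the distance estimate with a factor 2, hence the
      quarter.\<close>
    then have "0 < e\<^sup>2 / 4" by simp
    then obtain N where N: "1 / real (Suc N) < e\<^sup>2 / 4"
      using reals_Archimedean[of "e\<^sup>2 / 4"] by (auto simp only: inverse_eq_divide)
    have "dist (poly_op A (P m) x) (poly_op A (P n) x) < e" if "N \<le> m" "N \<le> n" for m n
    proof (rule power2_less_imp_less)
      have "1 / real (Suc m) \<le> 1 / real (Suc N)" "1 / real (Suc n) \<le> 1 / real (Suc N)"
        using that by (auto intro!: divide_left_mono)
      then show "(dist (poly_op A (P m) x) (poly_op A (P n) x))\<^sup>2 < e\<^sup>2"
        using norm_poly_op_diff_le[OF B, of "P m" x "P n"] P(2)[of m] P(2)[of n] N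
        by (simp add: dist_norm)
    qed (use \<open>0 < e\<close> in simp)
    then show "\<exists>N. \<forall>m\<ge>N. \<forall>n\<ge>N. dist (poly_op A (P m) x) (poly_op A (P n) x) < e" by blast
  qed
  then obtain y where y: "(\<lambda>n. poly_op A (P n) x) \<longlonglongrightarrow> y"
    using Cauchy_convergent convergent_def by blast
  have "(norm (poly_op A p x - y))\<^sup>2 \<le> 2 * sq_err B p x" for p
  proof (rule LIMSEQ_le)
    show "(\<lambda>n. (norm (poly_op A p x - poly_op A (P n) x))\<^sup>2) \<longlonglongrightarrow> (norm (poly_op A p x - y))\<^sup>2"
      by (intro tendsto_intros y)
    have "(\<lambda>n. 2 * sq_err B p x + 2 * sq_err B (P n) x) \<longlonglongrightarrow> 2 * sq_err B p x + 2 * 0"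
      by (intro tendsto_intros P)
    then show "(\<lambda>n. 2 * sq_err B p x + 2 * sq_err B (P n) x) \<longlonglongrightarrow> 2 * sq_err B p x" by simp
  qed (use norm_poly_op_diff_le[OF B] in blast)
  then show ?thesis by blast
qed

definition spectral_op :: "real set \<Rightarrow> 'a \<Rightarrow> 'a" where
  "spectral_op B x = (SOME y. \<forall>p. (norm (poly_op A p x - y))\<^sup>2 \<le> 2 * sq_err B p x)"

lemma spectral_op_approx:
  assumes "B \<in> sets borel"
  shows "(norm (poly_op A p x - spectral_op B x))\<^sup>2 \<le> 2 * sq_err B p x"
  using someI_ex[OF ex_spectral_op[OF assms, of x], folded spectral_op_def] by blast

lemma spectral_op_tendsto:
  assumes "B \<in> sets borel" "(\<lambda>n. sq_err B (P n) x) \<longlonglongrightarrow> 0"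
  shows "(\<lambda>n. poly_op A (P n) x) \<longlonglongrightarrow> spectral_op B x"
  by (rule tendsto_of_norm_sq_le[OF spectral_op_approx[OF assms(1)] assms(2)])

text \<open>Meant for two operators: the cutoff to \<open>V\<close>, so that projections preserve
  \<open>ell2 V\<close>, and multiplication by a complex scalar, so that they are complex linear
  although the space here is real.\<close>

lemma spectral_op_commute:
  assumes "B \<in> sets borel" "bounded_linear T" "\<And>x. T (A x) = A (T x)"
  shows "T (spectral_op B x) = spectral_op B (T x)"
proof -
  obtain P where P: "\<And>z. z \<in> {x, T x} \<Longrightarrow> (\<lambda>n. sq_err B (P n) z) \<longlonglongrightarrow> 0"
    using ex_approx_seq_on[OF _ assms(1), of "{x, T x}"] by (meson finite.emptyI finite.insertI)
  have "(\<lambda>n. T (poly_op A (P n) x)) \<longlonglongrightarrow> T (spectral_op B x)"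
    by (rule bounded_linear.tendsto[OF assms(2) spectral_op_tendsto[OF assms(1) P]]) simp
  then have "(\<lambda>n. poly_op A (P n) (T x)) \<longlonglongrightarrow> T (spectral_op B x)"
    by (simp only: poly_op_commute[OF linear_A bounded_linear.linear[OF assms(2)] assms(3)])
  moreover have "(\<lambda>n. poly_op A (P n) (T x)) \<longlonglongrightarrow> spectral_op B (T x)"
    by (rule spectral_op_tendsto[OF assms(1) P]) simp
  ultimately show ?thesis by (rule LIMSEQ_unique)
qed

lemma spectral_op_add:
  assumes "B \<in> sets borel"
  shows "spectral_op B (x + y) = spectral_op B x + spectral_op B y"
proof -
  obtain P where P: "\<And>z. z \<in> {x, y, x + y} \<Longrightarrow> (\<lambda>n. sq_err B (P n) z) \<longlonglongrightarrow> 0"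
    using ex_approx_seq_on[OF _ assms, of "{x, y, x + y}"] by (meson finite.emptyI finite.insertI)
  note lim = spectral_op_tendsto[OF assms P]
  have "poly_op A (P n) (x + y) = poly_op A (P n) x + poly_op A (P n) y" for n
    by (rule linear_add[OF bounded_linear.linear[OF bounded_linear_poly_op[OF bounded_linear_A]]])
  then have "(\<lambda>n. poly_op A (P n) (x + y)) \<longlonglongrightarrow> spectral_op B x + spectral_op B y"
    using tendsto_add[OF lim[of x] lim[of y]] by simp
  with lim[of "x + y"] show ?thesis by (intro LIMSEQ_unique) simp_all
qed

lemma spectral_op_selfadjoint:
  assumes "B \<in> sets borel"
  shows "inner (spectral_op B x) y = inner x (spectral_op B y)"
proof -
  obtain P where P: "\<And>z. z \<in> {x, y} \<Longrightarrow> (\<lambda>n. sq_err B (P n) z) \<longlonglongrightarrow> 0"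
    using ex_approx_seq_on[OF _ assms, of "{x, y}"] by (meson finite.emptyI finite.insertI)
  note lim = spectral_op_tendsto[OF assms P]
  have "(\<lambda>n. inner (poly_op A (P n) x) y) \<longlonglongrightarrow> inner (spectral_op B x) y"
    by (intro tendsto_intros lim) simp
  moreover have "(\<lambda>n. inner (poly_op A (P n) x) y) \<longlonglongrightarrow> inner x (spectral_op B y)"
    unfolding poly_op_selfadjoint[OF linear_A selfadjoint] by (intro tendsto_intros lim) simp
  ultimately show ?thesis by (rule LIMSEQ_unique)
qed

text \<open>Identifies the moment measure as the scalar spectral measure of x. Mean-square
  convergence to the indicator implies convergence of integrals because the measure is
  finite.\<close>

lemma inner_spectral_op:
  assumes B: "B \<in> sets borel"
  shows "inner (spectral_op B x) x = measure (moment_measure x) B"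
proof -
  interpret finite_measure "moment_measure x" by (rule finite_measure_moment)
  obtain P where P: "(\<lambda>n. sq_err B (P n) x) \<longlonglongrightarrow> 0"
    using ex_approx_seq_single[OF B] by blast
  have "(\<lambda>n. inner (poly_op A (P n) x) x) \<longlonglongrightarrow> inner (spectral_op B x) x"
    by (intro tendsto_intros spectral_op_tendsto B P)
  moreover have "(\<lambda>n. inner (poly_op A (P n) x) x) \<longlonglongrightarrow> measure (moment_measure x) B"
  proof (rule tendsto_of_norm_sq_le[OF _ P])
    fix n
    have "inner (poly_op A (P n) x) x - measure (moment_measure x) B
        = (\<integral>t. poly (P n) t - indicator B t \<partial>moment_measure x)"
      using B integrable_poly_moment[of x "P n"]
      by (simp add: integral_poly_moment[symmetric] emeasure_eq_measure)
    also have "\<dots>\<^sup>2 \<le> (1 + measure (moment_measure x) (space (moment_measure x))) * sq_err B (P n) x"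
      unfolding sq_err_def
      by (intro integral_squared_le finite_measure_moment integrable_err_moment B)
    finally show "(norm (inner (poly_op A (P n) x) x - measure (moment_measure x) B))\<^sup>2
      \<le> (1 + measure (moment_measure x) (space (moment_measure x))) * sq_err B (P n) x"
      by simp
  qed
  ultimately show ?thesis by (rule LIMSEQ_unique)
qed

text \<open>Splits p q - 1_B 1_C as p (q - 1_C) + (p - 1_B) 1_C. The bound \<open>S\<close> depends
  on \<open>p\<close>, which dictates the order of limits in the product rule below.\<close>

lemma sq_err_Int_mult_le:
  assumes [measurable]: "B \<in> sets borel" "C \<in> sets borel"
    and S: "\<And>t. t \<in> {0..M} \<Longrightarrow> \<bar>poly p t\<bar> \<le> S"
  shows "sq_err (B \<inter> C) (p * q) x \<le> 2 * S\<^sup>2 * sq_err C q x + 2 * sq_err B p x"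
proof -
  have "sq_err (B \<inter> C) (p * q) x
      \<le> (\<integral>t. 2 * S\<^sup>2 * (poly q t - indicator C t)\<^sup>2 + 2 * (poly p t - indicator B t)\<^sup>2 \<partial>moment_measure x)"
    unfolding sq_err_def
  proof (rule integral_mono_AE)
    show "AE t in moment_measure x. (poly (p * q) t - indicator (B \<inter> C) t)\<^sup>2
        \<le> 2 * S\<^sup>2 * (poly q t - indicator C t)\<^sup>2 + 2 * (poly p t - indicator B t)\<^sup>2"
      using AE_moment
    proof eventually_elim
      case (elim t)
      define a b where "a = poly p t * (poly q t - indicator C t)"
        and "b = (poly p t - indicator B t) * indicator C t"
      have "poly (p * q) t - indicator (B \<inter> C) t = a + b"
        by (simp add: a_def b_def indicator_inter_arith algebra_simps)
      also have "(a + b)\<^sup>2 \<le> 2 * a\<^sup>2 + 2 * b\<^sup>2"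
        using zero_le_power2[of "a - b"] by (simp add: power2_eq_square algebra_simps)
      also have "a\<^sup>2 \<le> S\<^sup>2 * (poly q t - indicator C t)\<^sup>2"
        unfolding a_def power_mult_distrib
        using power_mono[OF S[OF elim], of 2] by (intro mult_right_mono) auto
      also have "b\<^sup>2 \<le> (poly p t - indicator B t)\<^sup>2"
        by (simp add: b_def indicator_def)
      finally show ?case by simp
    qed
  qed (intro Bochner_Integration.integrable_add integrable_mult_right integrable_err_moment
      sets.Int assms)+
  also have "\<dots> = 2 * S\<^sup>2 * sq_err C q x + 2 * sq_err B p x"
    by (simp add: sq_err_def integrable_err_moment assms)
  finally show ?thesis .
qed

text \<open>An iterated limit. For fixed n, letting m tend to infinity removes the term with
  \<open>S\<close>, however large; only then does n grow. The sequence \<open>P\<close> has to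
  approximate the indicator of \<open>B\<close> for x, where the error is measured, and for y, where
  the limit is identified.\<close>

lemma spectral_op_Int:
  assumes B: "B \<in> sets borel" and C: "C \<in> sets borel"
  shows "spectral_op (B \<inter> C) x = spectral_op B (spectral_op C x)"
proof -
  define y where "y = spectral_op C x"
  have BC: "B \<inter> C \<in> sets borel" using B C by simp
  obtain P where P: "\<And>z. z \<in> {x, y} \<Longrightarrow> (\<lambda>n. sq_err B (P n) z) \<longlonglongrightarrow> 0"
    using ex_approx_seq_on[OF _ B, of "{x, y}"] by (meson finite.emptyI finite.insertI)
  obtain Q where Q: "(\<lambda>n. sq_err C (Q n) x) \<longlonglongrightarrow> 0"
    using ex_approx_seq_single[OF C] by blast
  have "(norm (poly_op A (P n) y - spectral_op (B \<inter> C) x))\<^sup>2 \<le> 4 * sq_err B (P n) x" for n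
  proof -
    obtain S where S: "\<And>t. t \<in> {0..M} \<Longrightarrow> \<bar>poly (P n) t\<bar> \<le> S"
      using poly_bounded_on_interval by blast
    show ?thesis
    proof (rule LIMSEQ_le)
      have "(\<lambda>m. poly_op A (P n) (poly_op A (Q m) x)) \<longlonglongrightarrow> poly_op A (P n) y"
        unfolding y_def
        by (intro bounded_linear.tendsto[OF bounded_linear_poly_op[OF bounded_linear_A]]
            spectral_op_tendsto C Q)
      then show "(\<lambda>m. (norm (poly_op A (P n * Q m) x - spectral_op (B \<inter> C) x))\<^sup>2)
          \<longlonglongrightarrow> (norm (poly_op A (P n) y - spectral_op (B \<inter> C) x))\<^sup>2"
        unfolding poly_op_mult[OF linear_A] by (intro tendsto_intros)
      have "(\<lambda>m. 2 * (2 * S\<^sup>2 * sq_err C (Q m) x + 2 * sq_err B (P n) x))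
          \<longlonglongrightarrow> 2 * (2 * S\<^sup>2 * 0 + 2 * sq_err B (P n) x)"
        by (intro tendsto_intros Q)
      then show "(\<lambda>m. 2 * (2 * S\<^sup>2 * sq_err C (Q m) x + 2 * sq_err B (P n) x)) \<longlonglongrightarrow> 4 * sq_err B (P n) x"
        by simp
      have "(norm (poly_op A (P n * Q m) x - spectral_op (B \<inter> C) x))\<^sup>2
          \<le> 2 * (2 * S\<^sup>2 * sq_err C (Q m) x + 2 * sq_err B (P n) x)" for m
        using spectral_op_approx[OF BC, of "P n * Q m" x] sq_err_Int_mult_le[OF B C, of "P n" S "Q m" x] S
        by fastforce
      then show "\<exists>N. \<forall>m\<ge>N. (norm (poly_op A (P n * Q m) x - spectral_op (B \<inter> C) x))\<^sup>2
          \<le> 2 * (2 * S\<^sup>2 * sq_err C (Q m) x + 2 * sq_err B (P n) x)" by blast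
    qed
  qed
  then have "(\<lambda>n. poly_op A (P n) y) \<longlonglongrightarrow> spectral_op (B \<inter> C) x"
    by (rule tendsto_of_norm_sq_le[OF _ P]) simp
  moreover have "(\<lambda>n. poly_op A (P n) y) \<longlonglongrightarrow> spectral_op B y"
    by (intro spectral_op_tendsto B P) simp
  ultimately show ?thesis unfolding y_def by (rule LIMSEQ_unique)
qed

lemma norm_spectral_op:
  assumes "B \<in> sets borel"
  shows "(norm (spectral_op B x))\<^sup>2 = measure (moment_measure x) B"
  using spectral_op_Int[OF assms assms, of x]
  by (simp add: power2_norm_eq_inner spectral_op_selfadjoint[OF assms] inner_spectral_op[OF assms, symmetric]
      inner_commute)

lemma norm_spectral_op_le:
  assumes "B \<in> sets borel"
  shows "norm (spectral_op B x) \<le> norm x"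
proof (rule power2_le_imp_le)
  interpret finite_measure "moment_measure x" by (rule finite_measure_moment)
  show "(norm (spectral_op B x))\<^sup>2 \<le> (norm x)\<^sup>2"
    using bounded_measure[of B] measure_moment_UNIV[of x]
    unfolding norm_spectral_op[OF assms] by (simp add: power2_norm_eq_inner)
qed simp

lemma spectral_op_empty: "spectral_op {} x = 0"
  using norm_spectral_op[of "{}" x] by simp

lemma spectral_op_carrier: "spectral_op {0..M} x = x"
proof -
  have "AE t in moment_measure x. (poly 1 t - indicator {0..M} t)\<^sup>2 = (0::real)"
    using AE_moment by eventually_elim simp
  then have "sq_err {0..M} 1 x = 0"
    unfolding sq_err_def by (rule integral_eq_zero_AE)
  then show ?thesis using spectral_op_approx[of "{0..M}" 1 x] by simp
qed

lemma spectral_op_Un_disjoint: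
  assumes B: "B \<in> sets borel" and C: "C \<in> sets borel" and disj: "B \<inter> C = {}"
  shows "spectral_op (B \<union> C) x = spectral_op B x + spectral_op C x"
proof -
  obtain P where P: "(\<lambda>n. sq_err B (P n) x) \<longlonglongrightarrow> 0" using ex_approx_seq_single[OF B] by blast
  obtain Q where Q: "(\<lambda>n. sq_err C (Q n) x) \<longlonglongrightarrow> 0" using ex_approx_seq_single[OF C] by blast
  have BC: "B \<union> C \<in> sets borel" using B C by simp
  have "sq_err (B \<union> C) (P n + Q n) x \<le> 2 * sq_err B (P n) x + 2 * sq_err C (Q n) x" for n
  proof -
    have "sq_err (B \<union> C) (P n + Q n) x
      \<le> (\<integral>t. 2 * (poly (P n) t - indicator B t)\<^sup>2 + 2 * (poly (Q n) t - indicator C t)\<^sup>2 \<partial>moment_measure x)"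
      unfolding sq_err_def
    proof (intro integral_mono Bochner_Integration.integrable_add integrable_mult_right
        integrable_err_moment B C BC)
      fix t :: real
      define a b where "a = poly (P n) t - indicator B t" and "b = poly (Q n) t - indicator C t"
      have "poly (P n + Q n) t - indicator (B \<union> C) t = a + b"
        using disj by (simp add: a_def b_def indicator_add[symmetric] algebra_simps)
      also have "(a + b)\<^sup>2 \<le> 2 * a\<^sup>2 + 2 * b\<^sup>2"
        using zero_le_power2[of "a - b"] by (simp add: power2_eq_square algebra_simps)
      finally show "(poly (P n + Q n) t - indicator (B \<union> C) t)\<^sup>2
        \<le> 2 * (poly (P n) t - indicator B t)\<^sup>2 + 2 * (poly (Q n) t - indicator C t)\<^sup>2"
        by (simp add: a_def b_def)
    qed
    then show ?thesis by (simp add: sq_err_def integrable_err_moment B C)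
  qed
  then have "(norm (poly_op A (P n) x + poly_op A (Q n) x - spectral_op (B \<union> C) x))\<^sup>2
      \<le> 4 * (sq_err B (P n) x + sq_err C (Q n) x)" for n
    using spectral_op_approx[OF BC, of "P n + Q n" x] unfolding poly_op_add
    by (smt (verit) distrib_left)
  moreover have "(\<lambda>n. sq_err B (P n) x + sq_err C (Q n) x) \<longlonglongrightarrow> 0"
    using tendsto_add[OF P Q] by simp
  ultimately have "(\<lambda>n. poly_op A (P n) x + poly_op A (Q n) x) \<longlonglongrightarrow> spectral_op (B \<union> C) x"
    by (rule tendsto_of_norm_sq_le[where c = 4])
  moreover have "(\<lambda>n. poly_op A (P n) x + poly_op A (Q n) x) \<longlonglongrightarrow> spectral_op B x + spectral_op C x"
    by (intro tendsto_intros spectral_op_tendsto B C P Q)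
  ultimately show ?thesis by (rule LIMSEQ_unique)
qed

text \<open>Finite additivity leaves the projection of the tail \<open>T n\<close> as the remainder.
  Its squared norm is the moment measure of \<open>T n\<close>, and the tails decrease to the empty
  set.\<close>

lemma spectral_op_sums:
  assumes B: "range B \<subseteq> sets borel" and disj: "disjoint_family B"
  shows "(\<lambda>n. norm (spectral_op (\<Union>i. B i) x - (\<Sum>i<n. spectral_op (B i) x))) \<longlonglongrightarrow> 0"
proof -
  interpret finite_measure "moment_measure x" by (rule finite_measure_moment)
  have Bi: "B i \<in> sets borel" for i using B by blast
  define T where "T n = (\<Union>i\<in>{n..}. B i)" for n
  have T: "T n \<in> sets borel" for n using Bi by (auto simp: T_def)
  have split: "spectral_op (\<Union>i. B i) x = (\<Sum>i<n. spectral_op (B i) x) + spectral_op (T n) x" for n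
  proof (induction n)
    case 0
    have "T 0 = (\<Union>i. B i)" by (simp add: T_def atLeast_0)
    then show ?case by simp
  next
    case (Suc n)
    have "{n..} = insert n {Suc n..}" by auto
    then have "T n = B n \<union> T (Suc n)" by (simp add: T_def)
    moreover have "B n \<inter> B i = {}" if "Suc n \<le> i" for i
      using disjoint_family_onD[OF disj, of n i] that by simp
    then have "B n \<inter> T (Suc n) = {}" unfolding T_def by blast
    ultimately have "spectral_op (T n) x = spectral_op (B n) x + spectral_op (T (Suc n)) x"
      using spectral_op_Un_disjoint[OF Bi T] by simp
    then show ?case using Suc by simp
  qed
  have "(\<Inter>n. T n) = {}"
  proof (rule ccontr)
    assume "(\<Inter>n. T n) \<noteq> {}"
    then obtain t where t: "\<And>n. t \<in> T n" by blast
    then obtain i where i: "t \<in> B i" unfolding T_def by blast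
    obtain j where "j \<ge> Suc i" "t \<in> B j" using t[of "Suc i"] unfolding T_def by blast
    with i disjoint_family_onD[OF disj, of i j] show False by auto
  qed
  moreover have "(\<lambda>n. measure (moment_measure x) (T n)) \<longlonglongrightarrow> measure (moment_measure x) (\<Inter>n. T n)"
    by (rule finite_Lim_measure_decseq)
       (use T in \<open>auto simp: T_def decseq_def intro: order_trans\<close>)
  ultimately have "(\<lambda>n. (norm (spectral_op (T n) x))\<^sup>2) \<longlonglongrightarrow> 0"
    by (simp add: norm_spectral_op[OF T])
  from tendsto_real_sqrt[OF this] have "(\<lambda>n. norm (spectral_op (T n) x)) \<longlonglongrightarrow> 0" by simp
  moreover have "spectral_op (T n) x = spectral_op (\<Union>i. B i) x - (\<Sum>i<n. spectral_op (B i) x)" for n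
    using split[of n] by (simp add: algebra_simps)
  ultimately show ?thesis by simp
qed

lemma inner_A_eq_integral: "inner (A x) x = (\<integral>t. t \<partial>moment_measure x)"
  using integral_poly_moment[of x "[:0, 1:]"] linear_0[OF linear_A]
  by (simp add: poly_op_pCons[OF linear_A])

lemma emeasure_moment:
  assumes "B \<in> sets borel"
  shows "emeasure (moment_measure x) B = ennreal (inner (spectral_op B x) x)"
  using finite_measure.emeasure_eq_measure[OF finite_measure_moment]
  by (simp add: inner_spectral_op[OF assms])

end

section \<open>The Hilbert space of square-summable functions\<close>

text \<open>Reduces membership and norm bounds to uniform bounds on finite partial sums. The
  Laplacian, the averages, their adjoint and the residual are all estimated this way.\<close>

lemma ell2_sum_bound:
  assumes "\<And>x. x \<notin> S \<Longrightarrow> f x = 0"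
    and "\<And>F. finite F \<Longrightarrow> F \<subseteq> S \<Longrightarrow> (\<Sum>x\<in>F. (cmod (f x))\<^sup>2) \<le> C"
  shows "f \<in> ell2 S" "(\<Sum>\<^sub>\<infinity>x\<in>S. (cmod (f x))\<^sup>2) \<le> C"
proof -
  have "(\<lambda>x. (cmod (f x))\<^sup>2) summable_on S"
    by (rule nonneg_bdd_above_summable_on) (use assms(2) in \<open>auto intro!: bdd_aboveI2\<close>)
  then show "f \<in> ell2 S" "(\<Sum>\<^sub>\<infinity>x\<in>S. (cmod (f x))\<^sup>2) \<le> C"
    using assms by (auto simp: ell2_def intro!: infsum_le_finite_sums)
qed

lemma ell2_outside: "f \<in> ell2 S \<Longrightarrow> x \<notin> S \<Longrightarrow> f x = 0"
  by (simp add: ell2_def)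

lemma ell2_summable: "f \<in> ell2 S \<Longrightarrow> (\<lambda>x. (cmod (f x))\<^sup>2) summable_on S"
  by (simp add: ell2_def)

lemma ell2_zero: "(\<lambda>x. 0) \<in> ell2 S"
  by (simp add: ell2_def)

lemma ell2_add:
  assumes "f \<in> ell2 S" "g \<in> ell2 S"
  shows "(\<lambda>x. f x + g x) \<in> ell2 S"
proof -
  have "(\<lambda>x. (cmod (f x + g x))\<^sup>2) summable_on S"
  proof (rule summable_on_comparison_test)
    show "(\<lambda>x. 2 * (cmod (f x))\<^sup>2 + 2 * (cmod (g x))\<^sup>2) summable_on S"
      using assms by (intro summable_on_add summable_on_cmult_right ell2_summable)
    show "(cmod (f x + g x))\<^sup>2 \<le> 2 * (cmod (f x))\<^sup>2 + 2 * (cmod (g x))\<^sup>2" for x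
    proof -
      have "(cmod (f x + g x))\<^sup>2 \<le> (cmod (f x) + cmod (g x))\<^sup>2"
        by (intro power_mono norm_triangle_ineq) simp
      also have "\<dots> \<le> 2 * (cmod (f x))\<^sup>2 + 2 * (cmod (g x))\<^sup>2"
        using sum_squares_bound[of "cmod (f x)" "cmod (g x)"] by (simp add: power2_sum)
      finally show ?thesis .
    qed
  qed auto
  then show ?thesis using assms by (simp add: ell2_def)
qed

lemma ell2_cmult:
  assumes "f \<in> ell2 S"
  shows "(\<lambda>x. c * f x) \<in> ell2 S"
  using assms by (auto simp: ell2_def norm_mult power_mult_distrib intro: summable_on_cmult_right)

lemma ell2_diff:
  assumes "f \<in> ell2 S" "g \<in> ell2 S"
  shows "(\<lambda>x. f x - g x) \<in> ell2 S"
  using ell2_add[OF assms(1) ell2_cmult[OF assms(2), of "-1"]] by simp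

lemma ell2_inner_summable:
  assumes "f \<in> ell2 S" "g \<in> ell2 S"
  shows "(\<lambda>x. f x * cnj (g x)) summable_on S"
proof (rule abs_summable_summable, rule summable_on_comparison_test)
  show "(\<lambda>x. (cmod (f x))\<^sup>2 + (cmod (g x))\<^sup>2) summable_on S"
    using assms by (intro summable_on_add ell2_summable)
  show "cmod (f x * cnj (g x)) \<le> (cmod (f x))\<^sup>2 + (cmod (g x))\<^sup>2" for x
    using sum_squares_bound[of "cmod (f x)" "cmod (g x)"] mult_nonneg_nonneg[OF norm_ge_zero[of "f x"] norm_ge_zero[of "g x"]]
    unfolding norm_mult complex_mod_cnj mult.assoc by linarith
qed auto

lemma ell2_subset: "S \<subseteq> T \<Longrightarrow> ell2 S \<subseteq> ell2 T"
proof
  fix f :: "'a \<Rightarrow> complex" assume "S \<subseteq> T" "f \<in> ell2 S"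
  then show "f \<in> ell2 T"
    using summable_on_cong_neutral[of S T "\<lambda>x. (cmod (f x))\<^sup>2" "\<lambda>x. (cmod (f x))\<^sup>2"]
    by (auto simp: ell2_def)
qed

lemma ell2_subset_UNIV: "f \<in> ell2 S \<Longrightarrow> f \<in> ell2 UNIV"
  using ell2_subset by blast

lemma ell2_cutoff:
  assumes "f \<in> ell2 UNIV"
  shows "(\<lambda>x. if x \<in> S then f x else 0) \<in> ell2 S"
proof -
  have "(\<lambda>x. (cmod (if x \<in> S then f x else 0))\<^sup>2) summable_on S
      \<longleftrightarrow> (\<lambda>x. (cmod (f x))\<^sup>2) summable_on S"
    by (rule summable_on_cong) simp
  moreover have "(\<lambda>x. (cmod (f x))\<^sup>2) summable_on S"
    using ell2_summable[OF assms] by (rule summable_on_subset_banach) simp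
  ultimately show ?thesis by (simp add: ell2_def)
qed

lemma ell2_inner_UNIV: "f \<in> ell2 S \<Longrightarrow> ell2_inner S f g = ell2_inner UNIV f g"
  unfolding ell2_inner_def by (rule infsum_cong_neutral) (auto simp: ell2_outside)

lemma ell2_norm_UNIV: "f \<in> ell2 S \<Longrightarrow> ell2_norm S f = ell2_norm UNIV f"
  unfolding ell2_norm_def by (rule arg_cong[of _ _ sqrt], rule infsum_cong_neutral) (auto simp: ell2_outside)

lemma ell2_inner_commute: "ell2_inner S f g = cnj (ell2_inner S g f)"
  unfolding ell2_inner_def by (simp flip: infsum_cnj add: mult.commute)

lemma ell2_inner_add_left:
  assumes "f \<in> ell2 S" "g \<in> ell2 S" "h \<in> ell2 S"
  shows "ell2_inner S (\<lambda>x. f x + g x) h = ell2_inner S f h + ell2_inner S g h"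
  unfolding ell2_inner_def
  using assms by (simp add: distrib_right infsum_add ell2_inner_summable)

lemma ell2_inner_cmult_left: "ell2_inner S (\<lambda>x. c * f x) h = c * ell2_inner S f h"
  unfolding ell2_inner_def by (simp add: mult.assoc infsum_cmult_right')

lemma ell2_inner_cmult_right: "ell2_inner S f (\<lambda>x. c * h x) = cnj c * ell2_inner S f h"
  using ell2_inner_cmult_left[of S c h f] ell2_inner_commute[of S f "\<lambda>x. c * h x"]
    ell2_inner_commute[of S f h] by simp

lemma ell2_inner_self:
  assumes "f \<in> ell2 S"
  shows "ell2_inner S f f = complex_of_real (\<Sum>\<^sub>\<infinity>x\<in>S. (cmod (f x))\<^sup>2)"
proof -
  have "ell2_inner S f f = (\<Sum>\<^sub>\<infinity>x\<in>S. complex_of_real ((cmod (f x))\<^sup>2))"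
    unfolding ell2_inner_def by (simp only: complex_norm_square)
  then show ?thesis
    using infsumI[OF has_sum_of_real[OF has_sum_infsum[OF ell2_summable[OF assms]]]] by simp
qed

lemma ell2_norm_sq: "(ell2_norm S f)\<^sup>2 = (\<Sum>\<^sub>\<infinity>x\<in>S. (cmod (f x))\<^sup>2)"
  unfolding ell2_norm_def by (simp add: infsum_nonneg)

lemma ell2_norm_nonneg [simp]: "0 \<le> ell2_norm S f"
  by (simp add: ell2_norm_def infsum_nonneg)

text \<open>Supplies the type on which \<open>positive_operator\<close> can be instantiated.
  Functions on a set \<open>S\<close> become the fixed points of \<open>cutoff S\<close>. The inner
  product is the real part of the complex one; the imaginary part is recovered from
  \<open>cscale \<i>\<close>.\<close>

typedef 'a l2 = "ell2 (UNIV :: 'a set)"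
  morphisms l2_fun Abs_l2
  using ell2_zero by blast

setup_lifting type_definition_l2

instantiation l2 :: (type) real_inner
begin

lift_definition zero_l2 :: "'a l2" is "\<lambda>x. 0" by (rule ell2_zero)
lift_definition plus_l2 :: "'a l2 \<Rightarrow> 'a l2 \<Rightarrow> 'a l2" is "\<lambda>f g x. f x + g x" by (rule ell2_add)
lift_definition minus_l2 :: "'a l2 \<Rightarrow> 'a l2 \<Rightarrow> 'a l2" is "\<lambda>f g x. f x - g x" by (rule ell2_diff)
lift_definition uminus_l2 :: "'a l2 \<Rightarrow> 'a l2" is "\<lambda>f x. - f x"
  using ell2_cmult[of _ UNIV "-1"] by simp
lift_definition scaleR_l2 :: "real \<Rightarrow> 'a l2 \<Rightarrow> 'a l2" is "\<lambda>c f x. complex_of_real c * f x"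
  by (rule ell2_cmult)
lift_definition inner_l2 :: "'a l2 \<Rightarrow> 'a l2 \<Rightarrow> real" is "\<lambda>f g. Re (ell2_inner UNIV f g)" .

definition norm_l2 :: "'a l2 \<Rightarrow> real" where "norm_l2 x = sqrt (inner x x)"
definition sgn_l2 :: "'a l2 \<Rightarrow> 'a l2" where "sgn_l2 x = inverse (norm x) *\<^sub>R x"
definition dist_l2 :: "'a l2 \<Rightarrow> 'a l2 \<Rightarrow> real" where "dist_l2 x y = norm (x - y)"
definition uniformity_l2 :: "('a l2 \<times> 'a l2) filter"
  where "uniformity_l2 = (INF e\<in>{0 <..}. principal {(x, y). dist x y < e})"
definition open_l2 :: "'a l2 set \<Rightarrow> bool"
  where "open_l2 S \<longleftrightarrow> (\<forall>x\<in>S. \<forall>\<^sub>F (x', y) in uniformity. x' = x \<longrightarrow> y \<in> S)"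

instance
proof
  fix x y z :: "'a l2" and a b :: real
  show "x + y + z = x + (y + z)" by transfer (simp add: add.assoc)
  show "x + y = y + x" by transfer (simp add: add.commute)
  show "0 + x = x" by transfer simp
  show "- x + x = 0" by transfer simp
  show "x - y = x + - y" by transfer simp
  show "a *\<^sub>R (x + y) = a *\<^sub>R x + a *\<^sub>R y" by transfer (simp add: distrib_left)
  show "(a + b) *\<^sub>R x = a *\<^sub>R x + b *\<^sub>R x" by transfer (simp add: distrib_right)
  show "a *\<^sub>R b *\<^sub>R x = (a * b) *\<^sub>R x" by transfer (simp add: mult.assoc)
  show "1 *\<^sub>R x = x" by transfer simp
  show "dist x y = norm (x - y)" by (rule dist_l2_def)
  show "sgn x = inverse (norm x) *\<^sub>R x" by (rule sgn_l2_def)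
  show "uniformity = (INF e\<in>{0 <..}. principal {(x :: 'a l2, y). dist x y < e})"
    by (rule uniformity_l2_def)
  show "open U \<longleftrightarrow> (\<forall>x\<in>U. \<forall>\<^sub>F (x', y) in uniformity. x' = x \<longrightarrow> y \<in> U)" for U :: "'a l2 set"
    by (rule open_l2_def)
  show "inner x y = inner y x"
    by transfer (subst ell2_inner_commute, simp)
  show "inner (x + y) z = inner x z + inner y z"
    by transfer (simp add: ell2_inner_add_left)
  show "inner (a *\<^sub>R x) y = a * inner x y"
    by transfer (simp add: ell2_inner_cmult_left)
  show "0 \<le> inner x x"
    by transfer (simp add: ell2_inner_self infsum_nonneg)
  show "inner x x = 0 \<longleftrightarrow> x = 0"
  proof transfer
    fix f :: "'a \<Rightarrow> complex" assume f: "f \<in> ell2 UNIV"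
    have "f v = 0" if "(\<Sum>\<^sub>\<infinity>x. (cmod (f x))\<^sup>2) = 0" for v
    proof -
      have "(cmod (f v))\<^sup>2 = 0"
        by (rule nonneg_infsum_le_0D[of "\<lambda>x. (cmod (f x))\<^sup>2" UNIV])
           (use that ell2_summable[OF f] in simp_all)
      then show ?thesis by simp
    qed
    then have "(\<Sum>\<^sub>\<infinity>x. (cmod (f x))\<^sup>2) = 0 \<longleftrightarrow> (\<forall>x. f x = 0)"
      by (metis (mono_tags, lifting) infsum_0 norm_zero zero_power2)
    then show "Re (ell2_inner UNIV f f) = 0 \<longleftrightarrow> f = (\<lambda>x. 0)"
      unfolding ell2_inner_self[OF f] by (simp only: Re_complex_of_real fun_eq_iff)
  qed
  show "norm x = sqrt (inner x x)" by (rule norm_l2_def)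
qed

end

lemma norm_l2_sq: "(norm x)\<^sup>2 = (\<Sum>\<^sub>\<infinity>v. (cmod (l2_fun x v))\<^sup>2)"
proof -
  have "inner x x = (\<Sum>\<^sub>\<infinity>v. (cmod (l2_fun x v))\<^sup>2)"
    by transfer (simp add: ell2_inner_self)
  then show ?thesis by (simp only: power2_norm_eq_inner[of x])
qed

lemma norm_l2_eq: "norm x = ell2_norm UNIV (l2_fun x)"
  unfolding ell2_norm_def norm_l2_sq[symmetric] by simp

lemma finite_sum_le_norm_l2: "finite F \<Longrightarrow> (\<Sum>v\<in>F. (cmod (l2_fun x v))\<^sup>2) \<le> (norm x)\<^sup>2"
  unfolding norm_l2_sq by (rule finite_sum_le_infsum[OF ell2_summable[OF l2_fun]]) simp_all

lemma norm_coordinate_le: "cmod (l2_fun x v) \<le> norm x"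
proof (rule power2_le_imp_le)
  show "(cmod (l2_fun x v))\<^sup>2 \<le> (norm x)\<^sup>2"
    using finite_sum_le_norm_l2[of "{v}" x] by simp
qed simp

lemma l2_fun_simps [simp]:
  "l2_fun 0 v = 0" "l2_fun (x + y) v = l2_fun x v + l2_fun y v"
  "l2_fun (x - y) v = l2_fun x v - l2_fun y v" "l2_fun (a *\<^sub>R x) v = complex_of_real a * l2_fun x v"
  by (transfer, simp)+

lemma l2_fun_sum: "l2_fun (sum X I) v = (\<Sum>i\<in>I. l2_fun (X i) v)"
  by (induction I rule: infinite_finite_induct) auto

text \<open>Coordinates are contractions, so a pointwise limit exists. Squared differences are
  summed over a finite set, the limit is taken in one index, and the resulting bound does not depend
  on the finite set.\<close>

instance l2 :: (type) complete_space
proof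
  fix X :: "nat \<Rightarrow> 'a l2" assume X: "Cauchy X"
  have "convergent (\<lambda>n. l2_fun (X n) v)" for v
  proof (rule Cauchy_convergent, rule metric_CauchyI)
    fix e :: real assume "0 < e"
    then obtain N where "\<forall>m\<ge>N. \<forall>n\<ge>N. dist (X m) (X n) < e"
      using metric_CauchyD[OF X] by blast
    moreover have "dist (l2_fun (X m) v) (l2_fun (X n) v) \<le> dist (X m) (X n)" for m n
      using norm_coordinate_le[of "X m - X n" v] by (simp add: dist_norm)
    ultimately show "\<exists>N. \<forall>m\<ge>N. \<forall>n\<ge>N. dist (l2_fun (X m) v) (l2_fun (X n) v) < e"
      by (meson le_less_trans)
  qed
  then obtain f where f: "\<And>v. (\<lambda>n. l2_fun (X n) v) \<longlonglongrightarrow> f v"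
    unfolding convergent_def by metis
  have bound: "(\<Sum>v\<in>F. (cmod (l2_fun (X n) v - f v))\<^sup>2) \<le> e\<^sup>2"
    if N: "\<forall>m\<ge>N. \<forall>n\<ge>N. dist (X m) (X n) < e" and F: "finite F" and n: "N \<le> n" for F n N e
  proof (rule LIMSEQ_le_const2)
    show "(\<lambda>m. \<Sum>v\<in>F. (cmod (l2_fun (X n) v - l2_fun (X m) v))\<^sup>2)
        \<longlonglongrightarrow> (\<Sum>v\<in>F. (cmod (l2_fun (X n) v - f v))\<^sup>2)"
      by (intro tendsto_intros f)
    have "(\<Sum>v\<in>F. (cmod (l2_fun (X n) v - l2_fun (X m) v))\<^sup>2) \<le> e\<^sup>2" if "N \<le> m" for m
    proof -
      have "(\<Sum>v\<in>F. (cmod (l2_fun (X n - X m) v))\<^sup>2) \<le> (norm (X n - X m))\<^sup>2"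
        by (rule finite_sum_le_norm_l2[OF F])
      also have "\<dots> \<le> e\<^sup>2"
        using N n that by (intro power_mono) (auto simp: dist_norm less_imp_le)
      finally show ?thesis by simp
    qed
    then show "\<exists>N. \<forall>m\<ge>N. (\<Sum>v\<in>F. (cmod (l2_fun (X n) v - l2_fun (X m) v))\<^sup>2) \<le> e\<^sup>2" by blast
  qed
  have diff: "(\<lambda>v. l2_fun (X n) v - f v) \<in> ell2 UNIV \<and>
      (\<Sum>\<^sub>\<infinity>v. (cmod (l2_fun (X n) v - f v))\<^sup>2) \<le> e\<^sup>2"
    if "\<forall>m\<ge>N. \<forall>n\<ge>N. dist (X m) (X n) < e" "N \<le> n" for n N e
  proof
    have "(\<Sum>v\<in>F. (cmod (l2_fun (X n) v - f v))\<^sup>2) \<le> e\<^sup>2" if "finite F" for F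
      by (rule bound[OF _ that]) fact+
    note ell2_sum_bound[of UNIV "\<lambda>v. l2_fun (X n) v - f v", OF _ this]
    then show "(\<lambda>v. l2_fun (X n) v - f v) \<in> ell2 UNIV"
      "(\<Sum>\<^sub>\<infinity>v. (cmod (l2_fun (X n) v - f v))\<^sup>2) \<le> e\<^sup>2" by simp_all
  qed
  obtain N where N: "\<forall>m\<ge>N. \<forall>n\<ge>N. dist (X m) (X n) < 1"
    using metric_CauchyD[OF X zero_less_one] by blast
  \<comment> \<open>The pointwise limit is exhibited as a difference of two functions already known
    to be square-summable.\<close>
  have "(\<lambda>v. l2_fun (X N) v - (l2_fun (X N) v - f v)) \<in> ell2 UNIV"
    by (rule ell2_diff) (use diff[OF N order_refl] l2_fun in blast)+
  then have f_ell2: "f \<in> ell2 UNIV" by simp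
  define y where "y = Abs_l2 f"
  have y: "l2_fun y = f" by (simp add: y_def Abs_l2_inverse f_ell2)
  have "X \<longlonglongrightarrow> y"
  proof (rule metric_LIMSEQ_I)
    fix e :: real assume "0 < e"
    then have "0 < e / 2" by simp
    then obtain N where N: "\<forall>m\<ge>N. \<forall>n\<ge>N. dist (X m) (X n) < e / 2"
      using metric_CauchyD[OF X] by blast
    have "dist (X n) y < e" if "N \<le> n" for n
    proof -
      have "(norm (X n - y))\<^sup>2 \<le> (e / 2)\<^sup>2"
        unfolding norm_l2_sq l2_fun_simps y using diff[OF N that] by (rule conjunct2)
      then have "norm (X n - y) \<le> e / 2"
        by (rule power2_le_imp_le) (use \<open>0 < e\<close> in simp)
      then show ?thesis unfolding dist_norm using \<open>0 < e\<close> by linarith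
    qed
    then show "\<exists>N. \<forall>n\<ge>N. dist (X n) y < e" by blast
  qed
  then show "convergent X" by (rule convergentI)
qed

lift_definition cscale :: "complex \<Rightarrow> 'a l2 \<Rightarrow> 'a l2" is "\<lambda>c f x. c * f x"
  by (rule ell2_cmult)

lift_definition cutoff :: "'a set \<Rightarrow> 'a l2 \<Rightarrow> 'a l2" is "\<lambda>S f x. if x \<in> S then f x else 0"
  by (rule ell2_subset_UNIV[OF ell2_cutoff])

lemma l2_fun_cscale [simp]: "l2_fun (cscale c x) v = c * l2_fun x v"
  by transfer simp

lemma l2_fun_cutoff [simp]: "l2_fun (cutoff S x) v = (if v \<in> S then l2_fun x v else 0)"
  by transfer simp

lemma l2_eqI: "(\<And>v. l2_fun x v = l2_fun y v) \<Longrightarrow> x = y"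
  by transfer auto

lemma bounded_linear_cscale: "bounded_linear (cscale c :: 'a l2 \<Rightarrow> 'a l2)"
proof (rule bounded_linear_intro[where K = "cmod c"])
  show "cscale c (x + y) = cscale c x + cscale c y" for x y :: "'a l2"
    by (rule l2_eqI) (simp add: distrib_left)
  show "cscale c (r *\<^sub>R x) = r *\<^sub>R cscale c x" for r and x :: "'a l2"
    by (rule l2_eqI) simp
  show "norm (cscale c x) \<le> norm x * cmod c" for x :: "'a l2"
  proof (rule power2_le_imp_le)
    show "(norm (cscale c x))\<^sup>2 \<le> (norm x * cmod c)\<^sup>2"
      by (simp add: norm_l2_sq norm_mult power_mult_distrib infsum_cmult_right' mult.commute)
  qed simp
qed

lemma norm_cutoff_le: "norm (cutoff S x) \<le> norm x"
proof (rule power2_le_imp_le)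
  show "(norm (cutoff S x))\<^sup>2 \<le> (norm x)\<^sup>2"
    unfolding norm_l2_sq
  proof (rule infsum_mono)
    show "(cmod (l2_fun (cutoff S x) v))\<^sup>2 \<le> (cmod (l2_fun x v))\<^sup>2" for v by simp
  qed (rule ell2_summable[OF l2_fun])+
qed simp

lemma bounded_linear_cutoff: "bounded_linear (cutoff S :: 'a l2 \<Rightarrow> 'a l2)"
proof (rule bounded_linear_intro[where K = 1])
  show "cutoff S (x + y) = cutoff S x + cutoff S y" for x y :: "'a l2"
    by (rule l2_eqI) simp
  show "cutoff S (r *\<^sub>R x) = r *\<^sub>R cutoff S x" for r and x :: "'a l2"
    by (rule l2_eqI) simp
  show "norm (cutoff S x) \<le> norm x * 1" for x :: "'a l2"
    using norm_cutoff_le by simp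
qed

lemma l2_fun_cutoff_ell2: "l2_fun (cutoff S x) \<in> ell2 S"
  by transfer (rule ell2_cutoff)

lemma l2_fun_Abs: "f \<in> ell2 S \<Longrightarrow> l2_fun (Abs_l2 f) = f"
  by (simp add: Abs_l2_inverse ell2_subset_UNIV)

lemma cutoff_Abs: "f \<in> ell2 S \<Longrightarrow> cutoff S (Abs_l2 f) = Abs_l2 f"
  by (rule l2_eqI) (simp add: l2_fun_Abs ell2_outside)

lemma l2_fun_ell2_iff: "l2_fun x \<in> ell2 S \<longleftrightarrow> cutoff S x = x"
proof
  show "cutoff S x = x" if "l2_fun x \<in> ell2 S"
    using cutoff_Abs[OF that] by (simp only: l2_fun_inverse)
  show "l2_fun x \<in> ell2 S" if "cutoff S x = x"
    using l2_fun_cutoff_ell2[of S x] by (simp only: that)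
qed

lemma norm_Abs: "f \<in> ell2 S \<Longrightarrow> norm (Abs_l2 f) = ell2_norm S f"
  by (simp add: norm_l2_eq l2_fun_Abs ell2_norm_UNIV)

lemma ell2_norm_l2_fun: "l2_fun x \<in> ell2 S \<Longrightarrow> ell2_norm S (l2_fun x) = norm x"
  using norm_Abs[of "l2_fun x" S] by (simp add: l2_fun_inverse)

lemma Re_ell2_inner: "l2_fun x \<in> ell2 S \<Longrightarrow> Re (ell2_inner S (l2_fun x) (l2_fun y)) = inner x y"
  unfolding ell2_inner_UNIV by transfer simp

text \<open>The form is conjugate-linear in its second argument, so Re <x, i y> = Re (- i <x, y>) =
  Im <x, y>. Hence an operator that is symmetric for the real inner product and commutes with
  \<open>cscale\<close> is symmetric for the complex one.\<close>

lemma ell2_inner_l2_fun: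
  "l2_fun x \<in> ell2 S \<Longrightarrow>
     ell2_inner S (l2_fun x) (l2_fun y) = Complex (inner x y) (inner x (cscale \<i> y))"
proof (rule complex_eqI)
  assume x: "l2_fun x \<in> ell2 S"
  have "l2_fun (cscale \<i> y) = (\<lambda>v. \<i> * l2_fun y v)" by (simp add: fun_eq_iff)
  then have "inner x (cscale \<i> y) = Re (ell2_inner S (l2_fun x) (\<lambda>v. \<i> * l2_fun y v))"
    using Re_ell2_inner[OF x, of "cscale \<i> y"] by simp
  then show "Im (ell2_inner S (l2_fun x) (l2_fun y)) = Im (Complex (inner x y) (inner x (cscale \<i> y)))"
    by (simp add: ell2_inner_cmult_right)
qed (simp add: Re_ell2_inner)

lemma Abs_l2_diff:
  assumes "f \<in> ell2 S" "g \<in> ell2 S"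
  shows "Abs_l2 (\<lambda>v. f v - g v) = Abs_l2 f - Abs_l2 g"
  by (rule l2_eqI)
     (simp add: l2_fun_Abs[OF ell2_diff[OF assms]] l2_fun_Abs[OF assms(1)] l2_fun_Abs[OF assms(2)])

lemma Abs_l2_add:
  assumes "f \<in> ell2 S" "g \<in> ell2 S"
  shows "Abs_l2 (\<lambda>v. f v + g v) = Abs_l2 f + Abs_l2 g"
  by (rule l2_eqI)
     (simp add: l2_fun_Abs[OF ell2_add[OF assms]] l2_fun_Abs[OF assms(1)] l2_fun_Abs[OF assms(2)])


lemma ell2_norm_eq_0:
  assumes "f \<in> ell2 S" "ell2_norm S f = 0"
  shows "f = (\<lambda>x. 0)"
proof -
  have "Abs_l2 f = 0" using norm_Abs[OF assms(1)] assms(2) by simp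
  then have "l2_fun (Abs_l2 f) v = 0" for v by simp
  then show ?thesis by (simp add: l2_fun_Abs[OF assms(1)] fun_eq_iff)
qed

lemma ell2_inner_add_right:
  assumes "f \<in> ell2 S" "g \<in> ell2 S" "h \<in> ell2 S"
  shows "ell2_inner S f (\<lambda>x. g x + h x) = ell2_inner S f g + ell2_inner S f h"
  using ell2_inner_add_left[OF assms(2,3,1)] ell2_inner_commute[of S f] by simp

lemma ell2_finite: "finite S \<Longrightarrow> (\<And>x. x \<notin> S \<Longrightarrow> f x = 0) \<Longrightarrow> f \<in> ell2 S"
  by (simp add: ell2_def)

lemma ell2_norm_sq_finite: "finite S \<Longrightarrow> (ell2_norm S f)\<^sup>2 = (\<Sum>x\<in>S. (cmod (f x))\<^sup>2)"
  by (simp add: ell2_norm_sq)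

lemma ell2_norm_cmult: "ell2_norm S (\<lambda>x. c * f x) = cmod c * ell2_norm S f"
  by (simp add: ell2_norm_def norm_mult power_mult_distrib infsum_cmult_right' real_sqrt_mult)

text \<open>Compactness is taken in the product topology on all functions: a product of unit discs
  over \<open>S\<close> and of points elsewhere is compact by Tychonoff, and the two equations are
  closed because they involve finitely many coordinates.\<close>

lemma compact_unit_sphere_mean_zero:
  assumes S: "finite S"
  shows "compact {f :: 'a \<Rightarrow> complex. (\<forall>x. x \<notin> S \<longrightarrow> f x = 0) \<and> (\<Sum>x\<in>S. f x) = 0 \<and>
           (\<Sum>x\<in>S. (cmod (f x))\<^sup>2) = 1}" (is "compact ?K")
proof -
  let ?B = "PiE UNIV (\<lambda>x :: 'a. if x \<in> S then cball (0 :: complex) 1 else {0})"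
  have coord: "continuous_on UNIV (\<lambda>f :: 'a \<Rightarrow> complex. f x)" for x
    by (rule continuous_on_product_coordinates)
  have "compactin (product_topology (\<lambda>x. euclidean) UNIV) ?B"
    by (subst compactin_PiE) auto
  then have B: "compact ?B" by (simp add: euclidean_product_topology)
  have "closed {f :: 'a \<Rightarrow> complex. (\<Sum>x\<in>S. f x) = 0}"
    by (intro closed_Collect_eq continuous_on_sum coord continuous_on_const)
  moreover have "closed {f :: 'a \<Rightarrow> complex. (\<Sum>x\<in>S. (cmod (f x))\<^sup>2) = 1}"
    by (intro closed_Collect_eq continuous_on_sum continuous_on_power continuous_on_norm coord
        continuous_on_const)
  ultimately have "compact (?B \<inter> {f. (\<Sum>x\<in>S. f x) = 0} \<inter> {f. (\<Sum>x\<in>S. (cmod (f x))\<^sup>2) = 1})"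
    using B by (intro compact_Int_closed)
  also have "?B \<inter> {f. (\<Sum>x\<in>S. f x) = 0} \<inter> {f. (\<Sum>x\<in>S. (cmod (f x))\<^sup>2) = 1} = ?K"
  proof (intro set_eqI iffI)
    fix f assume f: "f \<in> ?K"
    have "cmod (f x) \<le> 1" if "x \<in> S" for x
    proof (rule power2_le_imp_le)
      show "(cmod (f x))\<^sup>2 \<le> 1\<^sup>2"
        using member_le_sum[OF that, of "\<lambda>x. (cmod (f x))\<^sup>2"] f S by simp
    qed simp
    then show "f \<in> ?B \<inter> {f. (\<Sum>x\<in>S. f x) = 0} \<inter> {f. (\<Sum>x\<in>S. (cmod (f x))\<^sup>2) = 1}"
      using f by (simp add: PiE_UNIV_domain)
  next
    fix f assume f: "f \<in> ?B \<inter> {f. (\<Sum>x\<in>S. f x) = 0} \<inter> {f. (\<Sum>x\<in>S. (cmod (f x))\<^sup>2) = 1}"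
    then have "f x \<in> (if x \<in> S then cball 0 1 else {0})" for x by blast
    then have "f x = 0" if "x \<notin> S" for x using that by (metis singletonD)
    then show "f \<in> ?K" using f by simp
  qed
  finally show ?thesis .
qed

lemma ell2_norm_triangle:
  assumes "f \<in> ell2 S" "g \<in> ell2 S"
  shows "ell2_norm S (\<lambda>v. f v + g v) \<le> ell2_norm S f + ell2_norm S g"
  using norm_triangle_ineq[of "Abs_l2 f" "Abs_l2 g"]
  unfolding Abs_l2_add[OF assms, symmetric] norm_Abs[OF ell2_add[OF assms]] norm_Abs[OF assms(1)]
    norm_Abs[OF assms(2)] .

lemma Re_ell2_inner_le:
  assumes "f \<in> ell2 S" "g \<in> ell2 S"
  shows "Re (ell2_inner S f g) \<le> ell2_norm S f * ell2_norm S g"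
  using norm_cauchy_schwarz[of "Abs_l2 f" "Abs_l2 g"] Re_ell2_inner[of "Abs_l2 f" S "Abs_l2 g"] assms
  by (simp add: norm_Abs l2_fun_Abs)

section \<open>Bounded operators, contractions and the reconstruction operator\<close>

lemma bounded_operatorD:
  assumes "bounded_operator S T A"
  shows "f \<in> ell2 S \<Longrightarrow> A f \<in> ell2 T"
    and "f \<in> ell2 S \<Longrightarrow> g \<in> ell2 S \<Longrightarrow> A (\<lambda>x. f x + g x) = (\<lambda>y. A f y + A g y)"
    and "f \<in> ell2 S \<Longrightarrow> A (\<lambda>x. c * f x) = (\<lambda>y. c * A f y)"
  using assms by (simp_all add: bounded_operator_def)

lemma bounded_operator_bound:
  assumes "bounded_operator S T A"
  obtains C where "0 \<le> C" "\<And>f. f \<in> ell2 S \<Longrightarrow> ell2_norm T (A f) \<le> C * ell2_norm S f"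
proof -
  obtain C where C: "\<And>f. f \<in> ell2 S \<Longrightarrow> ell2_norm T (A f) \<le> C * ell2_norm S f"
    using assms unfolding bounded_operator_def by blast
  have "ell2_norm T (A f) \<le> \<bar>C\<bar> * ell2_norm S f" if "f \<in> ell2 S" for f
    by (rule order_trans[OF C[OF that]]) (intro mult_right_mono, simp_all)
  then show ?thesis by (intro that[of "\<bar>C\<bar>"]) simp_all
qed

lemma bounded_operatorI:
  assumes "\<And>f. f \<in> ell2 S \<Longrightarrow> A f \<in> ell2 T"
    and "\<And>f g. f \<in> ell2 S \<Longrightarrow> g \<in> ell2 S \<Longrightarrow> A (\<lambda>x. f x + g x) = (\<lambda>y. A f y + A g y)"
    and "\<And>c f. f \<in> ell2 S \<Longrightarrow> A (\<lambda>x. c * f x) = (\<lambda>y. c * A f y)"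
    and "\<And>f. f \<in> ell2 S \<Longrightarrow> ell2_norm T (A f) \<le> C * ell2_norm S f"
  shows "bounded_operator S T A"
  unfolding bounded_operator_def using assms by blast

lemma bounded_operator_diff:
  assumes "bounded_operator S T A" "f \<in> ell2 S" "g \<in> ell2 S"
  shows "A (\<lambda>x. f x - g x) = (\<lambda>y. A f y - A g y)"
  using bounded_operatorD(2)[OF assms(1,2) ell2_cmult[OF assms(3), of "-1"]]
    bounded_operatorD(3)[OF assms(1,3), of "-1"] by simp

lemma bounded_operator_compose:
  assumes A: "bounded_operator S T A" and B: "bounded_operator T U B"
  shows "bounded_operator S U (\<lambda>f. B (A f))"
proof -
  obtain C where C: "0 \<le> C" "\<And>f. f \<in> ell2 S \<Longrightarrow> ell2_norm T (A f) \<le> C * ell2_norm S f"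
    using bounded_operator_bound[OF A] by metis
  obtain D where D: "0 \<le> D" "\<And>f. f \<in> ell2 T \<Longrightarrow> ell2_norm U (B f) \<le> D * ell2_norm T f"
    using bounded_operator_bound[OF B] by metis
  show ?thesis
  proof (rule bounded_operatorI[where C = "D * C"])
    fix f assume f: "f \<in> ell2 S"
    show "B (A f) \<in> ell2 U" by (intro bounded_operatorD(1)[OF A] bounded_operatorD(1)[OF B] f)
    show "B (A (\<lambda>x. c * f x)) = (\<lambda>y. c * B (A f) y)" for c
      by (simp only: bounded_operatorD(3)[OF A f] bounded_operatorD(3)[OF B bounded_operatorD(1)[OF A f]])
    have "ell2_norm U (B (A f)) \<le> D * ell2_norm T (A f)"
      by (intro D bounded_operatorD(1)[OF A] f)
    also have "\<dots> \<le> D * (C * ell2_norm S f)" by (intro mult_left_mono C D f)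
    finally show "ell2_norm U (B (A f)) \<le> D * C * ell2_norm S f" by simp
  next
    fix f g assume f: "f \<in> ell2 S" and g: "g \<in> ell2 S"
    show "B (A (\<lambda>x. f x + g x)) = (\<lambda>y. B (A f) y + B (A g) y)"
      by (simp only: bounded_operatorD(2)[OF A f g]
          bounded_operatorD(2)[OF B bounded_operatorD(1)[OF A f] bounded_operatorD(1)[OF A g]])
  qed
qed

lemma bounded_operator_minus:
  assumes A: "bounded_operator S S A"
  shows "bounded_operator S S (\<lambda>f v. f v - A f v)"
proof -
  obtain C where C: "0 \<le> C" "\<And>f. f \<in> ell2 S \<Longrightarrow> ell2_norm S (A f) \<le> C * ell2_norm S f"
    using bounded_operator_bound[OF A] by metis
  show ?thesis
  proof (rule bounded_operatorI[where C = "1 + C"])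
    fix f assume f: "f \<in> ell2 S"
    have Af: "A f \<in> ell2 S" by (rule bounded_operatorD(1)[OF A f])
    show "(\<lambda>v. f v - A f v) \<in> ell2 S" by (rule ell2_diff[OF f Af])
    show "(\<lambda>v. c * f v - A (\<lambda>x. c * f x) v) = (\<lambda>v. c * (f v - A f v))" for c
      by (simp add: bounded_operatorD(3)[OF A f] right_diff_distrib)
    have "ell2_norm S (\<lambda>v. f v + (- 1) * A f v) \<le> ell2_norm S f + ell2_norm S (\<lambda>v. (- 1) * A f v)"
      by (intro ell2_norm_triangle ell2_cmult f Af)
    also have "ell2_norm S (\<lambda>v. (- 1) * A f v) = ell2_norm S (A f)"
      by (simp add: ell2_norm_def)
    finally show "ell2_norm S (\<lambda>v. f v - A f v) \<le> (1 + C) * ell2_norm S f"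
      using C(2)[OF f] by (simp add: distrib_right)
  next
    fix f g assume f: "f \<in> ell2 S" and g: "g \<in> ell2 S"
    show "(\<lambda>v. f v + g v - A (\<lambda>x. f x + g x) v) = (\<lambda>v. f v - A f v + (g v - A g v))"
      by (simp add: bounded_operatorD(2)[OF A f g] algebra_simps)
  qed
qed

lemma orthogonal_projection_norm_le:
  assumes "orthogonal_projection S P" "f \<in> ell2 S"
  shows "ell2_norm S (P f) \<le> ell2_norm S f"
proof -
  have b: "bounded_operator S S P" and idem: "P (P f) = P f"
    and sa: "\<And>g. g \<in> ell2 S \<Longrightarrow> ell2_inner S (P f) g = ell2_inner S f (P g)"
    using assms by (simp_all add: orthogonal_projection_def)
  have Pf: "P f \<in> ell2 S" by (rule bounded_operatorD(1)[OF b assms(2)])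
  have "(ell2_norm S (P f))\<^sup>2 = Re (ell2_inner S (P f) (P f))"
    by (simp add: ell2_inner_self[OF Pf] ell2_norm_sq)
  also have "\<dots> = Re (ell2_inner S f (P f))" by (simp only: sa[OF Pf] idem)
  also have "\<dots> \<le> ell2_norm S f * ell2_norm S (P f)" by (rule Re_ell2_inner_le[OF assms(2) Pf])
  finally have "ell2_norm S (P f) * ell2_norm S (P f) \<le> ell2_norm S f * ell2_norm S (P f)"
    by (simp only: power2_eq_square)
  then show ?thesis
    by (cases "ell2_norm S (P f) = 0") (simp_all add: mult_le_cancel_right less_le)
qed

text \<open>\<open>J\<close> is the inverse of I - N. Banach's theorem solves f = b + N f for each b
  separately; linearity of \<open>J\<close> then comes from uniqueness, since sums and multiples of
  solutions solve the corresponding equations. The triangle inequality gives the norm bound 1 / (1 -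
  \<kappa>).\<close>

lemma ex_inverse_id_minus_contraction:
  assumes N: "bounded_operator S S N" and \<kappa>: "0 \<le> \<kappa>" "\<kappa> < 1"
    and contr: "\<And>f. f \<in> ell2 S \<Longrightarrow> ell2_norm S (N f) \<le> \<kappa> * ell2_norm S f"
  shows "\<exists>J. bounded_operator S S J \<and>
    (\<forall>b\<in>ell2 S. J b = (\<lambda>v. b v + N (J b) v) \<and> (\<forall>f\<in>ell2 S. f = (\<lambda>v. b v + N f v) \<longrightarrow> f = J b))"
proof -
  have cut: "l2_fun (cutoff S x) \<in> ell2 S" for x by (rule l2_fun_cutoff_ell2)
  have ex: "\<exists>f\<in>ell2 S. f = (\<lambda>v. b v + N f v)" if b: "b \<in> ell2 S" for b
  proof -
    \<comment> \<open>The fixed point theorem needs a map on a whole type, and the cutoff provides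
      one. All values of \<open>F\<close> lie in \<open>ell2 S\<close>, so its fixed point is
      unaffected by the cutoff.\<close>
    define F where "F x = Abs_l2 (\<lambda>v. b v + N (l2_fun (cutoff S x)) v)" for x
    have Nc: "N (l2_fun (cutoff S x)) \<in> ell2 S" for x by (rule bounded_operatorD(1)[OF N cut])
    have F_fun: "l2_fun (F x) = (\<lambda>v. b v + N (l2_fun (cutoff S x)) v)" for x
      unfolding F_def by (rule l2_fun_Abs[OF ell2_add[OF b Nc]])
    have "dist (F x) (F y) \<le> \<kappa> * dist x y" for x y
    proof -
      have "l2_fun (cutoff S (x - y)) = (\<lambda>v. l2_fun (cutoff S x) v - l2_fun (cutoff S y) v)" by auto
      then have "N (l2_fun (cutoff S (x - y)))
          = (\<lambda>v. N (l2_fun (cutoff S x)) v - N (l2_fun (cutoff S y)) v)"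
        by (simp only: bounded_operator_diff[OF N cut cut])
      then have "l2_fun (F x - F y) = N (l2_fun (cutoff S (x - y)))"
        by (simp add: F_fun fun_eq_iff)
      then have "norm (F x - F y) = ell2_norm S (N (l2_fun (cutoff S (x - y))))"
        using ell2_norm_l2_fun[of "F x - F y" S] Nc[of "x - y"] by simp
      also have "\<dots> \<le> \<kappa> * ell2_norm S (l2_fun (cutoff S (x - y)))" by (rule contr[OF cut])
      also have "ell2_norm S (l2_fun (cutoff S (x - y))) = norm (cutoff S (x - y))"
        by (rule ell2_norm_l2_fun[OF cut])
      also have "\<kappa> * \<dots> \<le> \<kappa> * norm (x - y)" by (intro mult_left_mono norm_cutoff_le \<kappa>)
      finally show ?thesis by (simp add: dist_norm)
    qed
    then obtain x where x: "F x = x" using banach_fix_type[OF \<kappa>, of F] by blast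
    have "l2_fun x \<in> ell2 S" using F_fun[of x] ell2_add[OF b Nc[of x]] unfolding x by simp
    moreover from this have "cutoff S x = x" by (simp only: l2_fun_ell2_iff)
    then have "l2_fun x = (\<lambda>v. b v + N (l2_fun x) v)" using F_fun[of x] unfolding x by simp
    ultimately show ?thesis by blast
  qed
  have unique: "f = g" if f: "f \<in> ell2 S" "f = (\<lambda>v. b v + N f v)"
    and g: "g \<in> ell2 S" "g = (\<lambda>v. b v + N g v)" for b f g
  proof -
    have d: "(\<lambda>v. f v - g v) \<in> ell2 S" by (rule ell2_diff[OF f(1) g(1)])
    have "f v - g v = N f v - N g v" for v
      using fun_cong[OF f(2), of v] fun_cong[OF g(2), of v] by simp
    then have "(\<lambda>v. f v - g v) = (\<lambda>v. N f v - N g v)" by (rule ext)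
    also have "\<dots> = N (\<lambda>v. f v - g v)" by (rule bounded_operator_diff[OF N f(1) g(1), symmetric])
    finally have "(\<lambda>v. f v - g v) = N (\<lambda>v. f v - g v)" .
    then have "ell2_norm S (\<lambda>v. f v - g v) \<le> \<kappa> * ell2_norm S (\<lambda>v. f v - g v)"
      using contr[OF d] by simp
    then have "(1 - \<kappa>) * ell2_norm S (\<lambda>v. f v - g v) \<le> 0" by (simp add: left_diff_distrib)
    then have "ell2_norm S (\<lambda>v. f v - g v) \<le> 0" using \<kappa> by (simp add: mult_le_0_iff)
    then have "norm (Abs_l2 f - Abs_l2 g) \<le> 0"
      unfolding Abs_l2_diff[OF f(1) g(1), symmetric] norm_Abs[OF d] .
    then have "l2_fun (Abs_l2 f) = l2_fun (Abs_l2 g)" by simp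
    then show ?thesis by (simp only: l2_fun_Abs[OF f(1)] l2_fun_Abs[OF g(1)])
  qed
  obtain J where J: "\<And>b. b \<in> ell2 S \<Longrightarrow> J b \<in> ell2 S \<and> J b = (\<lambda>v. b v + N (J b) v)"
    using bchoice[of "ell2 S" "\<lambda>b f. f \<in> ell2 S \<and> f = (\<lambda>v. b v + N f v)"] ex by blast
  have J_unique: "f = J b" if "b \<in> ell2 S" "f \<in> ell2 S" "f = (\<lambda>v. b v + N f v)" for b f
    using unique[OF that(2,3)] J[OF that(1)] by blast
  have "bounded_operator S S J"
  proof (rule bounded_operatorI[where C = "1 / (1 - \<kappa>)"])
    fix b assume b: "b \<in> ell2 S"
    show "J b \<in> ell2 S" using J[OF b] by blast
    note NJ = bounded_operatorD(1)[OF N this]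
    show "J (\<lambda>x. c * b x) = (\<lambda>y. c * J b y)" for c
    proof (rule J_unique[symmetric])
      have "(\<lambda>y. c * J b y) = (\<lambda>v. c * b v + c * N (J b) v)"
        using J[OF b] by (metis distrib_left)
      also have "\<dots> = (\<lambda>v. c * b v + N (\<lambda>y. c * J b y) v)"
        by (simp only: bounded_operatorD(3)[OF N \<open>J b \<in> ell2 S\<close>])
      finally show "(\<lambda>y. c * J b y) = (\<lambda>v. c * b v + N (\<lambda>y. c * J b y) v)" .
    qed (intro ell2_cmult b \<open>J b \<in> ell2 S\<close>)+
    have "ell2_norm S (J b) = ell2_norm S (\<lambda>v. b v + N (J b) v)" using J[OF b] by simp
    also have "\<dots> \<le> ell2_norm S b + ell2_norm S (N (J b))" by (rule ell2_norm_triangle[OF b NJ])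
    also have "\<dots> \<le> ell2_norm S b + \<kappa> * ell2_norm S (J b)"
      by (intro add_left_mono contr \<open>J b \<in> ell2 S\<close>)
    finally have "(1 - \<kappa>) * ell2_norm S (J b) \<le> ell2_norm S b" by (simp add: left_diff_distrib)
    then show "ell2_norm S (J b) \<le> 1 / (1 - \<kappa>) * ell2_norm S b"
      using \<kappa> by (simp add: field_simps)
  next
    fix b d assume b: "b \<in> ell2 S" and d: "d \<in> ell2 S"
    have Jb: "J b \<in> ell2 S" and Jd: "J d \<in> ell2 S" using J b d by blast+
    show "J (\<lambda>x. b x + d x) = (\<lambda>y. J b y + J d y)"
    proof (rule J_unique[symmetric])
      have "J b v + J d v = b v + d v + (N (J b) v + N (J d) v)" for v
        using fun_cong[OF conjunct2[OF J[OF b]], of v] fun_cong[OF conjunct2[OF J[OF d]], of v] by simp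
      then show "(\<lambda>y. J b y + J d y) = (\<lambda>v. b v + d v + N (\<lambda>y. J b y + J d y) v)"
        unfolding bounded_operatorD(2)[OF N Jb Jd] by (rule ext)
    qed (intro ell2_add b d Jb Jd)+
  qed
  moreover have "\<forall>b\<in>ell2 S. J b = (\<lambda>v. b v + N (J b) v) \<and> (\<forall>f\<in>ell2 S. f = (\<lambda>v. b v + N f v) \<longrightarrow> f = J b)"
    using conjunct2[OF J] J_unique by (intro ballI conjI impI)
  ultimately show ?thesis by (intro exI[of _ J] conjI)
qed

text \<open>The estimate for Q = I - T A is available only on the range of P. In P Q P the inner P
  makes it applicable to an arbitrary f, and the outer P forces the solution of f = P (T a) + P Q P
  f into the range.\<close>

lemma ex_stable_reconstruction:
  assumes P: "orthogonal_projection V P" and A: "bounded_operator V I A" and T: "bounded_operator I V T"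
    and \<kappa>: "0 \<le> \<kappa>" "\<kappa> < 1"
    and le: "\<And>f. f \<in> ell2 V \<Longrightarrow> P f = f \<Longrightarrow> ell2_norm V (\<lambda>v. f v - T (A f) v) \<le> \<kappa> * ell2_norm V f"
  shows "\<exists>R. bounded_operator I V R \<and> (\<forall>a\<in>ell2 I. R a \<in> P ` ell2 V) \<and> (\<forall>f\<in>P ` ell2 V. R (A f) = f)"
proof -
  have bP: "bounded_operator V V P" and idem: "\<And>f. f \<in> ell2 V \<Longrightarrow> P (P f) = P f"
    using P by (simp_all add: orthogonal_projection_def)
  note P_ell2 = bounded_operatorD(1)[OF bP]
  define Q where "Q f = (\<lambda>v. f v - T (A f) v)" for f
  have bQ: "bounded_operator V V Q"
    unfolding Q_def[abs_def] by (rule bounded_operator_minus[OF bounded_operator_compose[OF A T]])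
  note Q_ell2 = bounded_operatorD(1)[OF bQ]
  have bN: "bounded_operator V V (\<lambda>f. P (Q (P f)))"
    by (rule bounded_operator_compose[OF bounded_operator_compose[OF bP bQ] bP])
  have contr: "ell2_norm V (P (Q (P f))) \<le> \<kappa> * ell2_norm V f" if f: "f \<in> ell2 V" for f
  proof -
    have "ell2_norm V (P (Q (P f))) \<le> ell2_norm V (Q (P f))"
      by (intro orthogonal_projection_norm_le[OF P] Q_ell2 P_ell2 f)
    also have "\<dots> \<le> \<kappa> * ell2_norm V (P f)"
      unfolding Q_def by (rule le[OF P_ell2[OF f] idem[OF f]])
    also have "\<dots> \<le> \<kappa> * ell2_norm V f"
      by (intro mult_left_mono orthogonal_projection_norm_le[OF P f] \<kappa>)
    finally show ?thesis .
  qed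
  have "\<exists>J. bounded_operator V V J \<and> (\<forall>b\<in>ell2 V. J b = (\<lambda>v. b v + P (Q (P (J b))) v) \<and>
      (\<forall>f\<in>ell2 V. f = (\<lambda>v. b v + P (Q (P f)) v) \<longrightarrow> f = J b))"
    by (rule ex_inverse_id_minus_contraction[OF bN \<kappa> contr])
  then obtain J where J: "bounded_operator V V J"
    "\<And>b. b \<in> ell2 V \<Longrightarrow> J b = (\<lambda>v. b v + P (Q (P (J b))) v)"
    "\<And>b f. b \<in> ell2 V \<Longrightarrow> f \<in> ell2 V \<Longrightarrow> f = (\<lambda>v. b v + P (Q (P f)) v) \<Longrightarrow> f = J b"
    by blast
  show ?thesis
  proof (intro exI[of _ "\<lambda>a. J (P (T a))"] conjI ballI)
    show "bounded_operator I V (\<lambda>a. J (P (T a)))"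
      by (rule bounded_operator_compose[OF bounded_operator_compose[OF T bP] J(1)])
    show "J (P (T a)) \<in> P ` ell2 V" if a: "a \<in> ell2 I" for a
    proof -
      have Ta: "T a \<in> ell2 V" by (rule bounded_operatorD(1)[OF T a])
      note b = P_ell2[OF Ta]
      have QPJ: "Q (P (J (P (T a)))) \<in> ell2 V" by (intro Q_ell2 P_ell2 bounded_operatorD(1)[OF J(1)] b)
      have "J (P (T a)) = (\<lambda>v. P (T a) v + P (Q (P (J (P (T a))))) v)" by (rule J(2)[OF b])
      also have "\<dots> = P (\<lambda>v. T a v + Q (P (J (P (T a)))) v)"
        by (rule bounded_operatorD(2)[OF bP Ta QPJ, symmetric])
      finally show ?thesis using ell2_add[OF Ta QPJ] by (metis imageI)
    qed
    show "J (P (T (A f))) = f" if "f \<in> P ` ell2 V" for f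
    proof -
      have f: "f \<in> ell2 V" and Pf: "P f = f" using that P_ell2 idem by auto
      have TA: "T (A f) \<in> ell2 V" by (intro bounded_operatorD(1)[OF T] bounded_operatorD(1)[OF A] f)
      have "(\<lambda>v. P (T (A f)) v + P (Q f) v) = P (\<lambda>v. T (A f) v + Q f v)"
        by (rule bounded_operatorD(2)[OF bP TA Q_ell2[OF f], symmetric])
      also have "(\<lambda>v. T (A f) v + Q f v) = f" by (simp add: Q_def)
      finally have "f = (\<lambda>v. P (T (A f)) v + P (Q (P f)) v)" by (simp add: Pf)
      then show ?thesis using J(3)[OF P_ell2[OF TA] f] by simp
    qed
  qed
qed

section \<open>Spectral measures on square-summable functions\<close>

lemma inner_cutoff: "inner (cutoff S x) y = inner x (cutoff S y)"
  by transfer (auto simp: ell2_inner_def intro!: arg_cong[of _ _ Re] infsum_cong)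

text \<open>The countable additivity that \<open>measure_of\<close> asks for is inherited from
  \<mu>, which is a measure already.\<close>

lemma scalar_spectral_measure_eq:
  assumes "sets \<mu> = sets borel"
    and "\<And>B. B \<in> sets borel \<Longrightarrow> emeasure \<mu> B = ennreal (Re (ell2_inner S (E B f) f))"
  shows "scalar_spectral_measure S E f = \<mu>"
proof -
  have "space \<mu> = UNIV" using sets_eq_imp_space_eq[OF assms(1)] by simp
  then have "\<mu> = measure_of UNIV (sets borel) (emeasure \<mu>)"
    using measure_of_of_measure[of \<mu>] assms(1) by simp
  also have "\<dots> = scalar_spectral_measure S E f"
    unfolding scalar_spectral_measure_def
    by (rule measure_of_eq) (use assms(2) sets.sigma_sets_eq[of "borel :: real measure"] in simp_all)
  finally show ?thesis by simp
qed

text \<open>\<open>L\<close> is extended to the whole type by applying it after the cutoff. The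
  extension kills functions supported off \<open>V\<close>, so it stays symmetric and nonnegative,
  and its spectral projections restrict to \<open>ell2 V\<close>.\<close>

lemma ex_spectral_measure:
  fixes L :: "('v \<Rightarrow> complex) \<Rightarrow> 'v \<Rightarrow> complex"
  assumes L: "bounded_operator V V L"
    and sa: "\<And>f g. f \<in> ell2 V \<Longrightarrow> g \<in> ell2 V \<Longrightarrow> ell2_inner V (L f) g = ell2_inner V f (L g)"
    and nonneg: "\<And>f. f \<in> ell2 V \<Longrightarrow> 0 \<le> Re (ell2_inner V (L f) f)"
  shows "\<exists>E. is_spectral_measure V L E"
proof -
  have L_ell2: "L f \<in> ell2 V" if "f \<in> ell2 V" for f
    using L that by (simp add: bounded_operator_def)
  have L_add: "L (\<lambda>x. f x + g x) = (\<lambda>x. L f x + L g x)" if "f \<in> ell2 V" "g \<in> ell2 V" for f g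
    using L that by (simp add: bounded_operator_def)
  have L_cmult: "L (\<lambda>x. c * f x) = (\<lambda>x. c * L f x)" if "f \<in> ell2 V" for f c
    using L that by (simp add: bounded_operator_def)
  obtain C where C: "\<And>f. f \<in> ell2 V \<Longrightarrow> ell2_norm V (L f) \<le> C * ell2_norm V f"
    using L unfolding bounded_operator_def by blast
  define c :: "'v l2 \<Rightarrow> 'v l2" where "c = cutoff V"
  define A where "A x = Abs_l2 (L (l2_fun (c x)))" for x
  have c_ell2: "l2_fun (c x) \<in> ell2 V" for x
    unfolding c_def by (rule l2_fun_cutoff_ell2)
  have A_fun: "l2_fun (A x) = L (l2_fun (c x))" for x
    unfolding A_def by (rule l2_fun_Abs[OF L_ell2[OF c_ell2]])
  have A_ell2: "l2_fun (A x) \<in> ell2 V" for x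
    unfolding A_fun by (rule L_ell2[OF c_ell2])
  have c_add: "l2_fun (c (x + y)) = (\<lambda>v. l2_fun (c x) v + l2_fun (c y) v)" for x y
    by (auto simp: c_def)
  have c_cscale: "l2_fun (c (cscale a x)) = (\<lambda>v. a * l2_fun (c x) v)" for a x
    by (auto simp: c_def)
  have c_scaleR: "l2_fun (c (a *\<^sub>R x)) = (\<lambda>v. complex_of_real a * l2_fun (c x) v)" for a x
    by (auto simp: c_def)
  have A_cscale: "cscale a (A x) = A (cscale a x)" for a x
    by (rule l2_eqI) (simp add: A_fun c_cscale L_cmult c_ell2)
  have cA: "c (A x) = A x" for x
    using l2_fun_ell2_iff A_ell2 unfolding c_def by blast
  have cc: "c (c x) = c x" for x
    unfolding c_def by (rule l2_eqI) simp
  have Ac: "A (c x) = A x" for x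
    by (simp add: A_def cc)
  have norm_c: "norm (c x) \<le> norm x" for x
    unfolding c_def by (rule norm_cutoff_le)
  have norm_A: "norm (A x) \<le> norm x * \<bar>C\<bar>" for x
  proof -
    have "norm (A x) \<le> C * norm (c x)"
      using C[OF c_ell2[of x]] ell2_norm_l2_fun[OF A_ell2[of x]] ell2_norm_l2_fun[OF c_ell2[of x]]
      by (simp add: A_fun)
    also have "\<dots> \<le> \<bar>C\<bar> * norm x"
      by (intro mult_mono norm_c) auto
    finally show ?thesis by (simp add: mult.commute)
  qed
  have inner_A: "inner (A x) y = Re (ell2_inner V (L (l2_fun (c x))) (l2_fun (c y)))" for x y
  proof -
    have "inner (A x) y = inner (A x) (c y)"
      using inner_cutoff[of V "A x" y] cA[of x] by (simp add: c_def)
    also have "\<dots> = Re (ell2_inner V (l2_fun (A x)) (l2_fun (c y)))"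
      by (rule Re_ell2_inner[OF A_ell2, symmetric])
    finally show ?thesis by (simp add: A_fun)
  qed
  have A_sa: "inner (A x) y = inner x (A y)" for x y
  proof -
    have "inner x (A y) = Re (cnj (ell2_inner V (l2_fun (c x)) (L (l2_fun (c y)))))"
      using inner_A[of y x] by (simp only: inner_commute ell2_inner_commute[of V "L (l2_fun (c y))"])
    also have "\<dots> = inner (A x) y"
      unfolding inner_A by (simp add: sa c_ell2)
    finally show ?thesis by simp
  qed
  \<comment> \<open>The locale asks for a strictly positive bound on the form, while
    \<open>C\<close> may be zero or negative.\<close>
  interpret positive_operator A "\<bar>C\<bar> + 1"
  proof (rule positive_operator.intro)
    show "bounded_linear A"
    proof (rule bounded_linear_intro[OF _ _ norm_A])
      show "A (x + y) = A x + A y" for x y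
        by (rule l2_eqI) (simp add: A_fun c_add L_add c_ell2)
      show "A (r *\<^sub>R x) = r *\<^sub>R A x" for r x
        by (rule l2_eqI) (simp add: A_fun c_scaleR L_cmult c_ell2)
    qed
    show "0 \<le> inner (A x) x" for x
      unfolding inner_A by (rule nonneg[OF c_ell2])
    show "inner (A x) x \<le> (\<bar>C\<bar> + 1) * inner x x" for x
    proof -
      have "inner (A x) x \<le> norm (A x) * norm x" by (rule norm_cauchy_schwarz)
      also have "\<dots> \<le> (norm x * (\<bar>C\<bar> + 1)) * norm x"
        using add_increasing2[OF norm_ge_zero norm_A]
        by (intro mult_right_mono) (simp_all add: distrib_left)
      finally show ?thesis
        by (simp add: power2_norm_eq_inner[symmetric] power2_eq_square mult_ac)
    qed
  qed (use A_sa in auto)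
  let ?P = "\<lambda>B. spectral_op B"
  define E where "E B f = l2_fun (?P B (Abs_l2 f))" for B f
  \<comment> \<open>Commutation with the cutoff is what makes the projections map
    \<open>ell2 V\<close> into itself.\<close>
  have P_c: "c (?P B x) = ?P B (c x)" if "B \<in> sets borel" for B x
    unfolding c_def by (rule spectral_op_commute[OF that bounded_linear_cutoff])
      (simp add: cA[unfolded c_def] Ac[unfolded c_def])
  have P_cscale: "cscale a (?P B x) = ?P B (cscale a x)" if "B \<in> sets borel" for B a x
    by (rule spectral_op_commute[OF that bounded_linear_cscale A_cscale])
  have Abs_E: "Abs_l2 (E B f) = ?P B (Abs_l2 f)" for B f
    by (simp add: E_def l2_fun_inverse)
  have E_ell2: "E B f \<in> ell2 V" if "B \<in> sets borel" "f \<in> ell2 V" for B f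
    using P_c[OF that(1), of "Abs_l2 f"] cutoff_Abs[OF that(2)]
    unfolding E_def l2_fun_ell2_iff c_def by simp
  have Abs_cmult: "Abs_l2 (\<lambda>v. a * f v) = cscale a (Abs_l2 f)" if "f \<in> ell2 V" for f a
    by (rule l2_eqI) (simp add: l2_fun_Abs[OF ell2_cmult[OF that]] l2_fun_Abs[OF that])
  have proj: "orthogonal_projection V (E B)" if B: "B \<in> sets borel" for B
    unfolding orthogonal_projection_def bounded_operator_def
  proof (intro conjI ballI allI)
    fix f g a assume f: "f \<in> ell2 V" and g: "g \<in> ell2 V"
    show "E B (\<lambda>x. f x + g x) = (\<lambda>y. E B f y + E B g y)"
      by (simp add: E_def Abs_l2_add[OF f g] spectral_op_add[OF B] fun_eq_iff)
    have 1: "ell2_inner V (E B f) g = ell2_inner V (l2_fun (?P B (Abs_l2 f))) (l2_fun (Abs_l2 g))"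
      by (simp add: E_def l2_fun_Abs[OF g])
    have 2: "ell2_inner V f (E B g) = ell2_inner V (l2_fun (Abs_l2 f)) (l2_fun (?P B (Abs_l2 g)))"
      by (simp add: E_def l2_fun_Abs[OF f])
    have "l2_fun (?P B (Abs_l2 f)) \<in> ell2 V" "l2_fun (Abs_l2 f) \<in> ell2 V"
      using E_ell2[OF B f] f by (simp_all add: E_def l2_fun_Abs[OF f])
    then show "ell2_inner V (E B f) g = ell2_inner V f (E B g)"
      unfolding 1 2 by (simp only: ell2_inner_l2_fun spectral_op_selfadjoint[OF B] P_cscale[OF B])
  next
    fix f a assume f: "f \<in> ell2 V"
    show "E B f \<in> ell2 V" by (rule E_ell2[OF B f])
    show "E B (\<lambda>x. a * f x) = (\<lambda>y. a * E B f y)"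
      by (simp add: E_def Abs_cmult[OF f] P_cscale[OF B, symmetric] fun_eq_iff)
    show "E B (E B f) = E B f"
      unfolding E_def[of B "E B f"] Abs_E using spectral_op_Int[OF B B, of "Abs_l2 f"]
      by (simp add: E_def)
  next
    show "\<exists>C. \<forall>f\<in>ell2 V. ell2_norm V (E B f) \<le> C * ell2_norm V f"
    proof (intro exI[of _ 1] ballI)
      fix f assume f: "f \<in> ell2 V"
      have "ell2_norm V (E B f) = norm (?P B (Abs_l2 f))"
        using ell2_norm_l2_fun[of "?P B (Abs_l2 f)" V] E_ell2[OF B f] by (simp add: E_def)
      also have "\<dots> \<le> norm (Abs_l2 f)" by (rule norm_spectral_op_le[OF B])
      finally show "ell2_norm V (E B f) \<le> 1 * ell2_norm V f" by (simp add: norm_Abs[OF f])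
    qed
  qed
  \<comment> \<open>The definition asks for an interval symmetric about 0, whereas the construction
    yields [0, M]; the product rule passes from one to the other.\<close>
  have carrier: "E {- (\<bar>C\<bar> + 1)..\<bar>C\<bar> + 1} f = f" if f: "f \<in> ell2 V" for f
  proof -
    have "?P {- (\<bar>C\<bar> + 1)..\<bar>C\<bar> + 1} (Abs_l2 f) = ?P {- (\<bar>C\<bar> + 1)..\<bar>C\<bar> + 1} (?P {0..\<bar>C\<bar> + 1} (Abs_l2 f))"
      by (simp only: spectral_op_carrier)
    also have "\<dots> = ?P ({- (\<bar>C\<bar> + 1)..\<bar>C\<bar> + 1} \<inter> {0..\<bar>C\<bar> + 1}) (Abs_l2 f)"
      by (rule spectral_op_Int[symmetric]) simp_all
    also have "{- (\<bar>C\<bar> + 1)..\<bar>C\<bar> + 1} \<inter> {0..\<bar>C\<bar> + 1} = {0..\<bar>C\<bar> + 1}" by auto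
    finally show ?thesis by (simp add: E_def spectral_op_carrier l2_fun_Abs[OF f])
  qed
  have sums: "(\<lambda>n. ell2_norm V (\<lambda>x. E (\<Union>i. B i) f x - (\<Sum>i<n. E (B i) f x))) \<longlonglongrightarrow> 0"
    if B: "range B \<subseteq> sets borel" "disjoint_family B" and f: "f \<in> ell2 V" for B :: "nat \<Rightarrow> real set" and f
  proof -
    let ?d = "\<lambda>n. ?P (\<Union>i. B i) (Abs_l2 f) - (\<Sum>i<n. ?P (B i) (Abs_l2 f))"
    have Bi: "B i \<in> sets borel" for i using B(1) by blast
    have UB: "(\<Union>i. B i) \<in> sets borel" using Bi by auto
    have cf: "c (Abs_l2 f) = Abs_l2 f" unfolding c_def by (rule cutoff_Abs[OF f])
    have "c (?d n) = ?d n" for n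
      using bounded_linear.linear[OF bounded_linear_cutoff[of V]]
      by (simp add: c_def linear_diff linear_sum P_c[OF UB, unfolded c_def] P_c[OF Bi, unfolded c_def]
          cf[unfolded c_def])
    then have "l2_fun (?d n) \<in> ell2 V" for n by (simp only: l2_fun_ell2_iff c_def)
    moreover have "(\<lambda>x. E (\<Union>i. B i) f x - (\<Sum>i<n. E (B i) f x)) = l2_fun (?d n)" for n
      by (simp add: E_def l2_fun_sum fun_eq_iff)
    ultimately have "ell2_norm V (\<lambda>x. E (\<Union>i. B i) f x - (\<Sum>i<n. E (B i) f x)) = norm (?d n)" for n
      by (simp only: ell2_norm_l2_fun)
    then show ?thesis using spectral_op_sums[OF B, of "Abs_l2 f"] by simp
  qed
  have form: "ell2_inner V (L f) f = complex_of_real (\<integral>t. t \<partial>scalar_spectral_measure V E f)"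
    if f: "f \<in> ell2 V" for f
  proof -
    have cf: "c (Abs_l2 f) = Abs_l2 f" unfolding c_def by (rule cutoff_Abs[OF f])
    have "scalar_spectral_measure V E f = moment_measure (Abs_l2 f)"
    proof (rule scalar_spectral_measure_eq[OF sets_moment])
      fix B :: "real set" assume B: "B \<in> sets borel"
      have "Re (ell2_inner V (E B f) f) = inner (?P B (Abs_l2 f)) (Abs_l2 f)"
        using Re_ell2_inner[of "?P B (Abs_l2 f)" V "Abs_l2 f"] E_ell2[OF B f]
        by (simp add: E_def l2_fun_Abs[OF f])
      then show "emeasure (moment_measure (Abs_l2 f)) B = ennreal (Re (ell2_inner V (E B f) f))"
        by (simp add: emeasure_moment[OF B])
    qed
    then have "(\<integral>t. t \<partial>scalar_spectral_measure V E f) = inner (A (Abs_l2 f)) (Abs_l2 f)"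
      by (simp add: inner_A_eq_integral)
    also have "\<dots> = Re (ell2_inner V (L f) f)"
      by (simp add: inner_A cf l2_fun_Abs[OF f])
    finally have "(\<integral>t. t \<partial>scalar_spectral_measure V E f) = Re (ell2_inner V (L f) f)" .
    \<comment> \<open>The real construction controls only real parts; symmetry of \<open>L\<close>
      makes the form real.\<close>
    moreover have "Im (ell2_inner V (L f) f) = 0"
      using sa[OF f f] ell2_inner_commute[of V f "L f"] by (simp add: complex_eq_iff)
    ultimately show ?thesis by (simp add: complex_eq_iff)
  qed
  have "is_spectral_measure V L E"
    unfolding is_spectral_measure_def
  proof (intro conjI ballI allI impI)
    show "E {} f = (\<lambda>x. 0)" for f
      by (simp add: E_def spectral_op_empty fun_eq_iff)
    show "\<exists>a. \<forall>f\<in>ell2 V. E {-a..a} f = f" using carrier by blast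
    show "E (B \<inter> D) f = E B (E D f)" if "B \<in> sets borel" "D \<in> sets borel" for B D f
      by (simp add: E_def l2_fun_inverse spectral_op_Int[OF that])
  qed (rule proj sums form; assumption)+
  then show ?thesis by blast
qed

text \<open>\<open>measure_of\<close> yields the zero measure when its argument is not countably additive, so bounding
  the scalar spectral measure from above needs no countable additivity.\<close>

lemma spectral_form_le:
  assumes E: "is_spectral_measure V L E" and f: "f \<in> ell2 V" "E {0..b} f = f" and "0 \<le> b"
  shows "Re (ell2_inner V (L f) f) \<le> b * (ell2_norm V f)\<^sup>2"
proof -
  let ?m = "\<lambda>B. ennreal (Re (ell2_inner V (E B f) f))"
  define \<nu> where "\<nu> = scalar_spectral_measure V E f"
  have sets: "sets \<nu> = sets borel"
    using sets.sigma_sets_eq[of "borel :: real measure"]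
    by (simp add: \<nu>_def scalar_spectral_measure_def)
  \<comment> \<open>E(B) f = E(B) E([0, b]) f, so only the part of B inside [0, b] matters; in
    particular the complement of [0, b] carries no mass.\<close>
  have Int: "E (B \<inter> {0..b}) f = E B f" if "B \<in> sets borel" for B
    using E f that unfolding is_spectral_measure_def by (metis atLeastAtMost_borel)
  have le: "emeasure \<nu> B \<le> ?m B" for B
    by (simp add: \<nu>_def scalar_spectral_measure_def emeasure_measure_of_conv)
  have "E UNIV f = f" using Int[of UNIV] f by simp
  then have "?m UNIV = ennreal ((ell2_norm V f)\<^sup>2)"
    by (simp add: ell2_inner_self[OF f(1)] ell2_norm_sq)
  with le[of UNIV] have top: "emeasure \<nu> UNIV \<le> ennreal ((ell2_norm V f)\<^sup>2)" by simp
  have space: "space \<nu> = UNIV" using sets_eq_imp_space_eq[OF sets] by simp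
  then interpret finite_measure \<nu>
    using top by (intro finite_measureI) (auto simp: top_unique)
  have "E (- {0..b}) f = (\<lambda>x. 0)"
    using Int[of "- {0..b}"] E f unfolding is_spectral_measure_def by auto
  then have "emeasure \<nu> (- {0..b}) = 0"
    using le[of "- {0..b}"] by (simp add: ell2_inner_def)
  then have "AE t in \<nu>. t \<in> {0..b}"
    by (intro AE_I[of _ _ "- {0..b}"]) (auto simp: sets)
  then have "AE t in \<nu>. t \<le> b" by eventually_elim simp
  \<comment> \<open>A nonnegative integrable majorant suffices: were t not integrable, its integral
    would be 0 by convention.\<close>
  then have "(\<integral>t. t \<partial>\<nu>) \<le> (\<integral>t. b \<partial>\<nu>)"
    using \<open>0 \<le> b\<close> by (intro integral_mono_AE') simp_all
  also have "\<dots> = b * measure \<nu> UNIV" by (simp add: space)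
  also have "measure \<nu> UNIV \<le> (ell2_norm V f)\<^sup>2"
    using top by (simp add: emeasure_eq_measure)
  finally have "(\<integral>t. t \<partial>\<nu>) \<le> b * (ell2_norm V f)\<^sup>2"
    using \<open>0 \<le> b\<close> by (simp add: mult_left_mono)
  moreover have "ell2_inner V (L f) f = complex_of_real (\<integral>t. t \<partial>\<nu>)"
    using E f(1) unfolding is_spectral_measure_def \<nu>_def by blast
  ultimately show ?thesis by simp
qed

section \<open>Weighted graph Laplacians\<close>

text \<open>Covers both the whole graph and a single finite block. The degree bound \<open>c\<close>
  makes the Laplacian bounded and, being positive, can serve as a divisor.\<close>

locale weighted_laplacian =
  fixes S :: "'v set" and w :: "'v \<Rightarrow> 'v \<Rightarrow> real" and c :: real
  assumes weight_nonneg: "\<And>u v. u \<in> S \<Longrightarrow> v \<in> S \<Longrightarrow> 0 \<le> w u v"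
    and weight_sym: "\<And>u v. u \<in> S \<Longrightarrow> v \<in> S \<Longrightarrow> w u v = w v u"
    and weight_summable: "\<And>v. v \<in> S \<Longrightarrow> (\<lambda>u. w v u) summable_on S"
    and degree_le: "\<And>v. v \<in> S \<Longrightarrow> (\<Sum>\<^sub>\<infinity>u\<in>S. w v u) \<le> c"
    and c_pos: "0 < c"
begin

lemma infsum_swap_square: "(\<Sum>\<^sub>\<infinity>(v, u)\<in>S \<times> S. p v u) = (\<Sum>\<^sub>\<infinity>(v, u)\<in>S \<times> S. p u v)"
proof -
  have "bij_betw prod.swap (S \<times> S) (S \<times> S)"
    by (rule bij_betwI[of _ _ _ prod.swap]) auto
  from infsum_reindex_bij_betw[OF this, of "\<lambda>(v, u). p u v"] show ?thesis
    by (simp add: case_prod_unfold)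
qed

lemma weight_sq_summable:
  assumes f: "f \<in> ell2 S"
  shows "(\<lambda>(v, u). w v u * (cmod (f v))\<^sup>2) summable_on S \<times> S"
    and "(\<Sum>\<^sub>\<infinity>(v, u)\<in>S \<times> S. w v u * (cmod (f v))\<^sup>2) \<le> c * (ell2_norm S f)\<^sup>2"
proof -
  define d where "d v = (\<Sum>\<^sub>\<infinity>u\<in>S. w v u)" for v
  have d: "0 \<le> d v" "d v \<le> c" if "v \<in> S" for v
    using that degree_le by (auto simp: d_def weight_nonneg intro!: infsum_nonneg)
  have hs: "((\<lambda>u. w v u * (cmod (f v))\<^sup>2) has_sum d v * (cmod (f v))\<^sup>2) S" if "v \<in> S" for v
    unfolding d_def by (intro has_sum_cmult_left has_sum_infsum weight_summable that)
  have csum: "(\<lambda>v. c * (cmod (f v))\<^sup>2) summable_on S"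
    by (intro summable_on_cmult_right ell2_summable f)
  have dsum: "(\<lambda>v. d v * (cmod (f v))\<^sup>2) summable_on S"
    by (rule summable_on_comparison_test[OF csum]) (auto intro!: mult_right_mono simp: d)
  show summ: "(\<lambda>(v, u). w v u * (cmod (f v))\<^sup>2) summable_on S \<times> S"
    by (rule summable_on_SigmaI[where g = "\<lambda>v. d v * (cmod (f v))\<^sup>2"])
       (use hs dsum in \<open>auto simp: weight_nonneg\<close>)
  have "(\<Sum>\<^sub>\<infinity>(v, u)\<in>S \<times> S. w v u * (cmod (f v))\<^sup>2) = (\<Sum>\<^sub>\<infinity>v\<in>S. \<Sum>\<^sub>\<infinity>u\<in>S. w v u * (cmod (f v))\<^sup>2)"
    by (rule infsum_Sigma'_banach[OF summ, symmetric])
  also have "\<dots> = (\<Sum>\<^sub>\<infinity>v\<in>S. d v * (cmod (f v))\<^sup>2)"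
    by (rule infsum_cong) (rule infsumI[OF hs])
  also have "\<dots> \<le> (\<Sum>\<^sub>\<infinity>v\<in>S. c * (cmod (f v))\<^sup>2)"
    by (rule infsum_mono[OF dsum csum]) (auto intro!: mult_right_mono simp: d)
  also have "\<dots> = c * (ell2_norm S f)\<^sup>2"
    by (simp add: ell2_norm_sq infsum_cmult_right')
  finally show "(\<Sum>\<^sub>\<infinity>(v, u)\<in>S \<times> S. w v u * (cmod (f v))\<^sup>2) \<le> c * (ell2_norm S f)\<^sup>2" .
qed

lemma weight_sq_summable':
  assumes f: "f \<in> ell2 S"
  shows "(\<lambda>(v, u). w v u * (cmod (f u))\<^sup>2) summable_on S \<times> S"
    and "(\<Sum>\<^sub>\<infinity>(v, u)\<in>S \<times> S. w v u * (cmod (f u))\<^sup>2) \<le> c * (ell2_norm S f)\<^sup>2"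
proof -
  have eq: "(case p of (v, u) \<Rightarrow> w u v * (cmod (f u))\<^sup>2) = (case p of (v, u) \<Rightarrow> w v u * (cmod (f u))\<^sup>2)"
    if "p \<in> S \<times> S" for p
    using that weight_sym by auto
  have "(\<lambda>(v, u). w u v * (cmod (f u))\<^sup>2) summable_on S \<times> S"
    using iffD1[OF summable_on_swap weight_sq_summable(1)[OF f]] by (simp only: prod.case)
  moreover have "(\<lambda>(v, u). w u v * (cmod (f u))\<^sup>2) summable_on S \<times> S
      \<longleftrightarrow> (\<lambda>(v, u). w v u * (cmod (f u))\<^sup>2) summable_on S \<times> S"
    by (rule summable_on_cong) (rule eq)
  ultimately show "(\<lambda>(v, u). w v u * (cmod (f u))\<^sup>2) summable_on S \<times> S" by (rule iffD1[rotated])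
  have "(\<Sum>\<^sub>\<infinity>(v, u)\<in>S \<times> S. w v u * (cmod (f u))\<^sup>2) = (\<Sum>\<^sub>\<infinity>(v, u)\<in>S \<times> S. w u v * (cmod (f u))\<^sup>2)"
    by (rule infsum_cong) (rule eq[symmetric])
  also have "\<dots> = (\<Sum>\<^sub>\<infinity>(v, u)\<in>S \<times> S. w v u * (cmod (f v))\<^sup>2)"
    by (rule infsum_swap_square)
  also have "\<dots> \<le> c * (ell2_norm S f)\<^sup>2" by (rule weight_sq_summable(2)[OF f])
  finally show "(\<Sum>\<^sub>\<infinity>(v, u)\<in>S \<times> S. w v u * (cmod (f u))\<^sup>2) \<le> c * (ell2_norm S f)\<^sup>2" .
qed

lemma cmod_diff_sq_le: "(cmod (a - b))\<^sup>2 \<le> 2 * (cmod a)\<^sup>2 + 2 * (cmod b)\<^sup>2"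
proof -
  have "(cmod (a - b))\<^sup>2 \<le> (cmod a + cmod b)\<^sup>2"
    by (intro power_mono norm_triangle_ineq4) simp
  also have "\<dots> \<le> 2 * (cmod a)\<^sup>2 + 2 * (cmod b)\<^sup>2"
    using sum_squares_bound[of "cmod a" "cmod b"] by (simp add: power2_sum)
  finally show ?thesis .
qed

text \<open>The sum runs over ordered pairs, so every edge counts twice and the quadratic form of
  the Laplacian is \<open>energy f / 2\<close>.\<close>

definition energy :: "('v \<Rightarrow> complex) \<Rightarrow> real" where
  "energy f = (\<Sum>\<^sub>\<infinity>(v, u)\<in>S \<times> S. w v u * (cmod (f v - f u))\<^sup>2)"

lemma energy_nonneg: "0 \<le> energy f"
  unfolding energy_def by (rule infsum_nonneg) (auto simp: weight_nonneg)

lemma energy_summable: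
  assumes f: "f \<in> ell2 S"
  shows "(\<lambda>(v, u). w v u * (cmod (f v - f u))\<^sup>2) summable_on S \<times> S"
    and "energy f \<le> 4 * c * (ell2_norm S f)\<^sup>2"
proof -
  let ?p = "\<lambda>p. 2 * (case p of (v, u) \<Rightarrow> w v u * (cmod (f v))\<^sup>2)
    + 2 * (case p of (v, u) \<Rightarrow> w v u * (cmod (f u))\<^sup>2)"
  have summ: "?p summable_on S \<times> S"
    by (intro summable_on_add summable_on_cmult_right weight_sq_summable weight_sq_summable' f)
  have le: "(case p of (v, u) \<Rightarrow> w v u * (cmod (f v - f u))\<^sup>2) \<le> ?p p" if "p \<in> S \<times> S" for p
  proof -
    obtain v u where p: "p = (v, u)" "v \<in> S" "u \<in> S" using \<open>p \<in> S \<times> S\<close> by blast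
    have "w v u * (cmod (f v - f u))\<^sup>2 \<le> w v u * (2 * (cmod (f v))\<^sup>2 + 2 * (cmod (f u))\<^sup>2)"
      by (intro mult_left_mono cmod_diff_sq_le weight_nonneg p)
    then show ?thesis by (simp add: p(1) algebra_simps)
  qed
  show e: "(\<lambda>(v, u). w v u * (cmod (f v - f u))\<^sup>2) summable_on S \<times> S"
    by (rule summable_on_comparison_test[OF summ le]) (auto simp: weight_nonneg)
  have "energy f \<le> infsum ?p (S \<times> S)"
    unfolding energy_def by (rule infsum_mono[OF e summ le])
  also have "\<dots> = 2 * (\<Sum>\<^sub>\<infinity>(v, u)\<in>S \<times> S. w v u * (cmod (f v))\<^sup>2)
      + 2 * (\<Sum>\<^sub>\<infinity>(v, u)\<in>S \<times> S. w v u * (cmod (f u))\<^sup>2)"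
    by (subst infsum_add)
       (simp_all only: infsum_cmult_right' summable_on_cmult_right weight_sq_summable weight_sq_summable' f)
  also have "\<dots> \<le> 4 * c * (ell2_norm S f)\<^sup>2"
    using weight_sq_summable(2)[OF f] weight_sq_summable'(2)[OF f] by simp
  finally show "energy f \<le> 4 * c * (ell2_norm S f)\<^sup>2" .
qed

lemma energy_section_summable:
  assumes "f \<in> ell2 S" "v \<in> S"
  shows "(\<lambda>u. w v u * (cmod (f v - f u))\<^sup>2) summable_on S"
  by (rule summable_on_SigmaD1[OF energy_summable(1)[OF assms(1)] assms(2)])

lemma weighted_diff_summable:
  assumes f: "f \<in> ell2 S" and v: "v \<in> S"
  shows "(\<lambda>u. w v u * cmod (f v - f u)) summable_on S"
    and "(\<lambda>u. (f v - f u) * complex_of_real (w v u)) summable_on S"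
proof -
  show 1: "(\<lambda>u. w v u * cmod (f v - f u)) summable_on S"
  proof (rule summable_on_comparison_test)
    show "(\<lambda>u. w v u + w v u * (cmod (f v - f u))\<^sup>2) summable_on S"
      by (intro summable_on_add weight_summable energy_section_summable f v)
    fix u assume u: "u \<in> S"
    have "cmod (f v - f u) \<le> 1 + (cmod (f v - f u))\<^sup>2"
      using sum_squares_bound[of 1 "cmod (f v - f u)"] norm_ge_zero[of "f v - f u"]
      unfolding power_one mult_1_right by linarith
    from mult_left_mono[OF this weight_nonneg[OF v u]]
    show "w v u * cmod (f v - f u) \<le> w v u + w v u * (cmod (f v - f u))\<^sup>2"
      by (simp add: distrib_left)
    show "0 \<le> w v u * cmod (f v - f u)" using weight_nonneg[OF v u] by simp
  qed
  have "(\<lambda>u. cmod ((f v - f u) * complex_of_real (w v u))) summable_on S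
      \<longleftrightarrow> (\<lambda>u. w v u * cmod (f v - f u)) summable_on S"
    by (rule summable_on_cong) (simp add: norm_mult weight_nonneg v)
  from iffD2[OF this 1] show "(\<lambda>u. (f v - f u) * complex_of_real (w v u)) summable_on S"
    by (rule abs_summable_summable)
qed

text \<open>Weighted Cauchy-Schwarz, (sum of w a)^2 \<le> (sum of w) (sum of w a^2) with the degree
  bounded by \<open>c\<close>. It follows by expanding the nonnegative sum of w (a - r)^2 at r = s1
  / c.\<close>

lemma laplacian_sq_le:
  assumes f: "f \<in> ell2 S" and v: "v \<in> S"
  shows "(cmod (laplacian S w f v))\<^sup>2 \<le> c * (\<Sum>\<^sub>\<infinity>u\<in>S. w v u * (cmod (f v - f u))\<^sup>2)"
proof -
  define a where "a u = cmod (f v - f u)" for u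
  define s1 where "s1 = (\<Sum>\<^sub>\<infinity>u\<in>S. w v u * a u)"
  define s2 where "s2 = (\<Sum>\<^sub>\<infinity>u\<in>S. w v u * (a u)\<^sup>2)"
  define d where "d = (\<Sum>\<^sub>\<infinity>u\<in>S. w v u)"
  have sums: "(\<lambda>u. w v u * a u) summable_on S" "(\<lambda>u. w v u * (a u)\<^sup>2) summable_on S"
    "(\<lambda>u. w v u) summable_on S"
    unfolding a_def by (intro weighted_diff_summable energy_section_summable weight_summable f v)+
  have "0 \<le> s1" unfolding s1_def a_def by (rule infsum_nonneg) (simp add: weight_nonneg v)
  define r where "r = s1 / c"
  have "((\<lambda>u. w v u * (a u)\<^sup>2 + (- 2 * r) * (w v u * a u) + r\<^sup>2 * w v u) has_sum
      s2 + (- 2 * r) * s1 + r\<^sup>2 * d) S"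
    unfolding s1_def s2_def d_def
    by (intro has_sum_add has_sum_cmult_right has_sum_infsum sums)
  moreover have "w v u * (a u)\<^sup>2 + (- 2 * r) * (w v u * a u) + r\<^sup>2 * w v u = w v u * (a u - r)\<^sup>2" for u
    by (simp add: power2_eq_square algebra_simps)
  ultimately have "((\<lambda>u. w v u * (a u - r)\<^sup>2) has_sum s2 + (- 2 * r) * s1 + r\<^sup>2 * d) S"
    by (simp only:)
  then have "0 \<le> s2 + (- 2 * r) * s1 + r\<^sup>2 * d"
    by (rule has_sum_nonneg) (simp add: weight_nonneg v)
  also have "\<dots> \<le> s2 + (- 2 * r) * s1 + r\<^sup>2 * c"
    using degree_le[OF v] by (intro add_left_mono mult_left_mono) (simp_all add: d_def)
  also have "\<dots> = s2 - s1\<^sup>2 / c"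
    using c_pos by (simp add: r_def power2_eq_square field_simps)
  finally have "s1\<^sup>2 \<le> c * s2" using c_pos by (simp add: field_simps)
  moreover have "cmod (laplacian S w f v) \<le> s1"
  proof -
    have eq: "(\<Sum>\<^sub>\<infinity>u\<in>S. cmod ((f v - f u) * complex_of_real (w v u))) = s1"
      unfolding s1_def a_def by (rule infsum_cong) (simp add: norm_mult weight_nonneg v)
    have "(\<lambda>u. cmod ((f v - f u) * complex_of_real (w v u))) summable_on S
        \<longleftrightarrow> (\<lambda>u. w v u * a u) summable_on S"
      by (rule summable_on_cong) (simp add: norm_mult weight_nonneg v a_def)
    then show ?thesis
      using norm_infsum_bound[of "\<lambda>u. (f v - f u) * complex_of_real (w v u)" S] sums(1) v eq
      by (simp add: laplacian_def)
  qed
  then have "(cmod (laplacian S w f v))\<^sup>2 \<le> s1\<^sup>2" by (rule power_mono) simp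
  ultimately show ?thesis by (simp add: s2_def a_def)
qed

text \<open>Summing the pointwise bound gives at most c times the energy, hence at most c * 4 c
  |f|^2, which is the square of 2 c |f|.\<close>

lemma laplacian_ell2:
  assumes f: "f \<in> ell2 S"
  shows "laplacian S w f \<in> ell2 S" "ell2_norm S (laplacian S w f) \<le> 2 * c * ell2_norm S f"
proof -
  have sec: "(\<lambda>v. \<Sum>\<^sub>\<infinity>u\<in>S. w v u * (cmod (f v - f u))\<^sup>2) summable_on S"
    by (rule summable_on_Sigma_banach[OF energy_summable(1)[OF f]])
  have bound: "(\<Sum>v\<in>F. (cmod (laplacian S w f v))\<^sup>2) \<le> (2 * c * ell2_norm S f)\<^sup>2"
    if F: "finite F" "F \<subseteq> S" for F
  proof -
    have "(\<Sum>v\<in>F. (cmod (laplacian S w f v))\<^sup>2) \<le> (\<Sum>v\<in>F. c * (\<Sum>\<^sub>\<infinity>u\<in>S. w v u * (cmod (f v - f u))\<^sup>2))"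
      by (rule sum_mono) (use F laplacian_sq_le[OF f] in blast)
    also have "\<dots> = c * (\<Sum>v\<in>F. \<Sum>\<^sub>\<infinity>u\<in>S. w v u * (cmod (f v - f u))\<^sup>2)"
      by (simp add: sum_distrib_left)
    also have "\<dots> \<le> c * (\<Sum>\<^sub>\<infinity>v\<in>S. \<Sum>\<^sub>\<infinity>u\<in>S. w v u * (cmod (f v - f u))\<^sup>2)"
      using c_pos by (intro mult_left_mono finite_sum_le_infsum sec F)
        (auto intro!: infsum_nonneg simp: weight_nonneg)
    also have "\<dots> = c * energy f"
      unfolding energy_def by (simp only: infsum_Sigma'_banach[OF energy_summable(1)[OF f]])
    also have "\<dots> \<le> c * (4 * c * (ell2_norm S f)\<^sup>2)"
      using c_pos by (intro mult_left_mono energy_summable f) simp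
    also have "\<dots> = (2 * c * ell2_norm S f)\<^sup>2" by (simp add: power2_eq_square)
    finally show ?thesis .
  qed
  have "laplacian S w f v = 0" if "v \<notin> S" for v using that by (simp add: laplacian_def)
  note b = ell2_sum_bound[of S "laplacian S w f", OF this bound]
  show "laplacian S w f \<in> ell2 S" using b(1) by simp
  show "ell2_norm S (laplacian S w f) \<le> 2 * c * ell2_norm S f"
  proof (rule power2_le_imp_le)
    show "(ell2_norm S (laplacian S w f))\<^sup>2 \<le> (2 * c * ell2_norm S f)\<^sup>2"
      unfolding ell2_norm_sq[of S "laplacian S w f"] using b(2) by simp
  qed (use c_pos in simp)
qed

lemma bounded_operator_laplacian: "bounded_operator S S (laplacian S w)"
  unfolding bounded_operator_def
proof (intro conjI ballI allI)
  fix f g a assume f: "f \<in> ell2 S" and g: "g \<in> ell2 S"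
  show "laplacian S w (\<lambda>x. f x + g x) = (\<lambda>y. laplacian S w f y + laplacian S w g y)"
  proof
    fix v
    have "(\<Sum>\<^sub>\<infinity>u\<in>S. (f v + g v - (f u + g u)) * complex_of_real (w v u))
        = (\<Sum>\<^sub>\<infinity>u\<in>S. (f v - f u) * complex_of_real (w v u) + (g v - g u) * complex_of_real (w v u))"
      by (rule infsum_cong) (simp add: algebra_simps)
    also have "\<dots> = (\<Sum>\<^sub>\<infinity>u\<in>S. (f v - f u) * complex_of_real (w v u))
        + (\<Sum>\<^sub>\<infinity>u\<in>S. (g v - g u) * complex_of_real (w v u))" if "v \<in> S"
      by (intro infsum_add weighted_diff_summable f g that)
    finally show "laplacian S w (\<lambda>x. f x + g x) v = laplacian S w f v + laplacian S w g v"
      by (simp add: laplacian_def)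
  qed
next
  fix f a assume f: "f \<in> ell2 S"
  show "laplacian S w f \<in> ell2 S" by (rule laplacian_ell2[OF f])
  have "(\<Sum>\<^sub>\<infinity>u\<in>S. (a * f v - a * f u) * complex_of_real (w v u))
      = (\<Sum>\<^sub>\<infinity>u\<in>S. a * ((f v - f u) * complex_of_real (w v u)))" for v
    by (rule infsum_cong) (simp add: algebra_simps)
  then show "laplacian S w (\<lambda>x. a * f x) = (\<lambda>y. a * laplacian S w f y)"
    by (simp add: laplacian_def infsum_cmult_right' fun_eq_iff)
next
  show "\<exists>C. \<forall>f\<in>ell2 S. ell2_norm S (laplacian S w f) \<le> C * ell2_norm S f"
    using laplacian_ell2(2) by blast
qed

text \<open>The discrete Green formula: the double sum equals its transpose, and the mean of the two
  is the symmetric expression. The work lies in the absolute summability of \<open>p\<close>,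
  dominated by weighted squares of f and g, which permits the interchange of sums.\<close>

lemma laplacian_inner:
  assumes f: "f \<in> ell2 S" and g: "g \<in> ell2 S"
  shows "ell2_inner S (laplacian S w f) g
       = (\<Sum>\<^sub>\<infinity>(v, u)\<in>S \<times> S. (f v - f u) * cnj (g v - g u) * complex_of_real (w v u)) / 2"
proof -
  define p where "p v u = (f v - f u) * complex_of_real (w v u) * cnj (g v)" for v u
  let ?q = "\<lambda>x. (case x of (v, u) \<Rightarrow> w v u * (cmod (f v))\<^sup>2) + (case x of (v, u) \<Rightarrow> w v u * (cmod (f u))\<^sup>2)
    + (case x of (v, u) \<Rightarrow> w v u * (cmod (g v))\<^sup>2)"
  have p: "(\<lambda>(v, u). p v u) summable_on S \<times> S"
  proof (rule abs_summable_summable, rule summable_on_comparison_test)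
    show "?q summable_on S \<times> S"
      by (intro summable_on_add weight_sq_summable weight_sq_summable' f g)
    fix x assume "x \<in> S \<times> S"
    then obtain v u where x: "x = (v, u)" "v \<in> S" "u \<in> S" by blast
    have "cmod (f v - f u) * cmod (g v) \<le> (cmod (f v) + cmod (f u)) * cmod (g v)"
      by (intro mult_right_mono norm_triangle_ineq4) simp
    also have "\<dots> \<le> (cmod (f v))\<^sup>2 + (cmod (f u))\<^sup>2 + (cmod (g v))\<^sup>2"
      using sum_squares_bound[of "cmod (f v)" "cmod (g v)"] sum_squares_bound[of "cmod (f u)" "cmod (g v)"]
        zero_le_power2[of "cmod (f v)"] zero_le_power2[of "cmod (f u)"]
      unfolding distrib_right mult.assoc by linarith
    finally have "w v u * (cmod (f v - f u) * cmod (g v))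
        \<le> w v u * ((cmod (f v))\<^sup>2 + (cmod (f u))\<^sup>2 + (cmod (g v))\<^sup>2)"
      by (rule mult_left_mono) (rule weight_nonneg[OF x(2,3)])
    then show "cmod (case x of (v, u) \<Rightarrow> p v u) \<le> ?q x"
      using weight_nonneg[OF x(2,3)]
      by (simp add: x(1) p_def norm_mult distrib_left mult_ac)
  qed simp
  have p': "(\<lambda>(v, u). p u v) summable_on S \<times> S"
    using iffD1[OF summable_on_swap p] by (simp only: prod.case)
  have "ell2_inner S (laplacian S w f) g = (\<Sum>\<^sub>\<infinity>v\<in>S. \<Sum>\<^sub>\<infinity>u\<in>S. p v u)"
    unfolding ell2_inner_def
    by (rule infsum_cong) (simp add: laplacian_def p_def infsum_cmult_left')
  also have "\<dots> = (\<Sum>\<^sub>\<infinity>(v, u)\<in>S \<times> S. p v u)"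
    by (rule infsum_Sigma'_banach[OF p])
  finally have "2 * ell2_inner S (laplacian S w f) g
      = (\<Sum>\<^sub>\<infinity>(v, u)\<in>S \<times> S. p v u) + (\<Sum>\<^sub>\<infinity>(v, u)\<in>S \<times> S. p u v)"
    using infsum_swap_square[of p] by simp
  also have "\<dots> = (\<Sum>\<^sub>\<infinity>x\<in>S \<times> S. (case x of (v, u) \<Rightarrow> p v u) + (case x of (v, u) \<Rightarrow> p u v))"
    by (rule infsum_add[OF p p', symmetric])
  also have "\<dots> = (\<Sum>\<^sub>\<infinity>(v, u)\<in>S \<times> S. (f v - f u) * cnj (g v - g u) * complex_of_real (w v u))"
    by (rule infsum_cong) (auto simp: p_def weight_sym algebra_simps)
  finally have eq: "2 * ell2_inner S (laplacian S w f) g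
      = (\<Sum>\<^sub>\<infinity>(v, u)\<in>S \<times> S. (f v - f u) * cnj (g v - g u) * complex_of_real (w v u))" .
  have "ell2_inner S (laplacian S w f) g = 2 * ell2_inner S (laplacian S w f) g / 2" by simp
  then show ?thesis by (simp only: eq)
qed

lemma laplacian_selfadjoint:
  assumes f: "f \<in> ell2 S" and g: "g \<in> ell2 S"
  shows "ell2_inner S (laplacian S w f) g = ell2_inner S f (laplacian S w g)"
proof -
  have "ell2_inner S f (laplacian S w g) = cnj (ell2_inner S (laplacian S w g) f)"
    by (rule ell2_inner_commute)
  also have "\<dots> = ell2_inner S (laplacian S w f) g"
    unfolding laplacian_inner[OF f g] laplacian_inner[OF g f] complex_cnj_divide infsum_cnj[symmetric]
      complex_cnj_numeral
    by (intro arg_cong[of _ _ "\<lambda>z. z / 2"] infsum_cong) (auto simp: mult_ac)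
  finally show ?thesis by simp
qed

lemma laplacian_form:
  assumes f: "f \<in> ell2 S"
  shows "ell2_inner S (laplacian S w f) f = complex_of_real (energy f / 2)"
proof -
  have "((\<lambda>x. complex_of_real (case x of (v, u) \<Rightarrow> w v u * (cmod (f v - f u))\<^sup>2)) has_sum
      complex_of_real (energy f)) (S \<times> S)"
    unfolding energy_def by (intro has_sum_of_real has_sum_infsum energy_summable f)
  moreover have "complex_of_real (case x of (v, u) \<Rightarrow> w v u * (cmod (f v - f u))\<^sup>2)
      = (case x of (v, u) \<Rightarrow> (f v - f u) * cnj (f v - f u) * complex_of_real (w v u))" for x
    by (cases x) (simp only: prod.case of_real_mult complex_norm_square mult.commute)
  ultimately show ?thesis
    unfolding laplacian_inner[OF f f] by (simp only: infsumI of_real_divide of_real_numeral)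
qed

lemma ex_spectral_measure_laplacian: "\<exists>E. is_spectral_measure S (laplacian S w) E"
  by (rule ex_spectral_measure[OF bounded_operator_laplacian laplacian_selfadjoint])
     (simp_all add: laplacian_form energy_nonneg)

lemma energy_cmult: "energy (\<lambda>x. a * f x) = (cmod a)\<^sup>2 * energy f"
proof -
  have eq: "(case p of (v, u) \<Rightarrow> w v u * (cmod (a * f v - a * f u))\<^sup>2)
      = (cmod a)\<^sup>2 * (case p of (v, u) \<Rightarrow> w v u * (cmod (f v - f u))\<^sup>2)" for p
    by (cases p) (simp add: right_diff_distrib[symmetric] norm_mult power_mult_distrib)
  show ?thesis
    unfolding energy_def infsum_cmult_right'[symmetric] by (rule infsum_cong) (rule eq)
qed

section \<open>Eigenvalues and the Poincare inequality on a finite connected graph\<close>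

lemma eigenvalue_nonneg:
  assumes "l \<in> laplacian_eigenvalues S w"
  shows "0 \<le> l"
proof -
  obtain f where f: "f \<in> ell2 S" "f \<noteq> (\<lambda>v. 0)" "laplacian S w f = (\<lambda>v. complex_of_real l * f v)"
    using assms unfolding laplacian_eigenvalues_def by blast
  have "complex_of_real (energy f / 2) = complex_of_real (l * (ell2_norm S f)\<^sup>2)"
    using laplacian_form[OF f(1)]
    by (simp only: f(3) ell2_inner_cmult_left ell2_inner_self[OF f(1)] ell2_norm_sq[symmetric] of_real_mult)
  then have "energy f / 2 = l * (ell2_norm S f)\<^sup>2" by (simp only: of_real_eq_iff)
  then have "0 \<le> l * (ell2_norm S f)\<^sup>2" using energy_nonneg[of f] by linarith
  moreover have "0 < (ell2_norm S f)\<^sup>2"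
    using ell2_norm_eq_0[OF f(1)] f(2) by auto
  ultimately show ?thesis by (simp add: zero_le_mult_iff)
qed

text \<open>The minimum of the Rayleigh quotient over functions of mean zero is an eigenvalue; the first
  variation at a minimizer in the direction of its own residual shows that the residual vanishes.\<close>

lemma ex_nonzero_eigenvalue_poincare:
  assumes S: "finite S" "1 < card S" and conn: "graph_connected S w"
  obtains m where "m \<in> laplacian_eigenvalues S w" "m \<noteq> 0"
    "\<And>f. f \<in> ell2 S \<Longrightarrow> (\<Sum>x\<in>S. f x) = 0 \<Longrightarrow> m * (ell2_norm S f)\<^sup>2 \<le> energy f / 2"
proof -
  define K where "K = {f :: 'v \<Rightarrow> complex. (\<forall>x. x \<notin> S \<longrightarrow> f x = 0) \<and> (\<Sum>x\<in>S. f x) = 0 \<and>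
           (\<Sum>x\<in>S. (cmod (f x))\<^sup>2) = 1}"
  have "compact K" unfolding K_def by (rule compact_unit_sphere_mean_zero[OF S(1)])
  have energy_eq: "energy f = (\<Sum>v\<in>S. \<Sum>u\<in>S. w v u * (cmod (f v - f u))\<^sup>2)" for f
    by (simp add: energy_def S(1) sum.cartesian_product)
  have coord: "continuous_on K (\<lambda>f. f x)" for x
    by (rule continuous_on_subset[OF continuous_on_product_coordinates subset_UNIV])
  have cont: "continuous_on K energy"
    unfolding energy_eq[abs_def]
    by (intro continuous_on_sum continuous_on_mult continuous_on_power continuous_on_norm
        continuous_on_diff coord continuous_on_const)
  have normalize: "(\<lambda>x. complex_of_real (1 / ell2_norm S f) * f x) \<in> K"
    if "f \<in> ell2 S" "(\<Sum>x\<in>S. f x) = 0" "ell2_norm S f \<noteq> 0" for f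
  proof -
    have "(ell2_norm S (\<lambda>x. complex_of_real (1 / ell2_norm S f) * f x))\<^sup>2 = 1"
      unfolding ell2_norm_cmult norm_of_real using that(3) by simp
    then show ?thesis
      using that(1,2) unfolding K_def ell2_norm_sq_finite[OF S(1)]
      by (simp add: ell2_outside sum_divide_distrib[symmetric])
  qed
  obtain a b where ab: "a \<in> S" "b \<in> S" "a \<noteq> b"
    using S by (metis card_le_Suc0_iff_eq One_nat_def not_less)
  \<comment> \<open>A difference of two point masses has mean zero and is not zero, so the set over
    which the energy is minimized is nonempty.\<close>
  define f0 where "f0 x = (if x = a then 1 else if x = b then - 1 else 0 :: complex)" for x
  have f0: "f0 \<in> ell2 S" by (rule ell2_finite[OF S(1)]) (use ab in \<open>auto simp: f0_def\<close>)
  have "(\<Sum>x\<in>S. f0 x) = (\<Sum>x\<in>{a, b}. f0 x)"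
    by (rule sum.mono_neutral_right) (use S ab in \<open>auto simp: f0_def\<close>)
  also have "\<dots> = 0" using ab by (simp add: f0_def)
  finally have "(\<Sum>x\<in>S. f0 x) = 0" .
  moreover have "ell2_norm S f0 \<noteq> 0"
    using fun_cong[OF ell2_norm_eq_0[OF f0], of a] by (auto simp: f0_def)
  ultimately have "K \<noteq> {}" using normalize[OF f0] by blast
  then obtain \<phi> where \<phi>: "\<phi> \<in> K" and min: "\<And>f. f \<in> K \<Longrightarrow> energy \<phi> \<le> energy f"
    using continuous_attains_inf[OF \<open>compact K\<close> _ cont] by blast
  define m where "m = energy \<phi> / 2"
  have \<phi>_ell2: "\<phi> \<in> ell2 S" using \<phi> by (intro ell2_finite[OF S(1)]) (simp add: K_def)
  have \<phi>_mean: "(\<Sum>x\<in>S. \<phi> x) = 0" and \<phi>_norm: "(ell2_norm S \<phi>)\<^sup>2 = 1"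
    using \<phi> unfolding ell2_norm_sq_finite[OF S(1)] by (simp_all add: K_def)
  have poincare: "m * (ell2_norm S f)\<^sup>2 \<le> energy f / 2"
    if f: "f \<in> ell2 S" "(\<Sum>x\<in>S. f x) = 0" for f
  proof (cases "ell2_norm S f = 0")
    case True
    then show ?thesis using energy_nonneg by simp
  next
    case False
    then have pos: "0 < (ell2_norm S f)\<^sup>2" by simp
    have "energy \<phi> \<le> (1 / ell2_norm S f)\<^sup>2 * energy f"
      using min[OF normalize[OF f False]] unfolding energy_cmult norm_of_real power2_abs .
    then have "energy \<phi> * (ell2_norm S f)\<^sup>2 \<le> energy f"
      using pos by (simp add: power_divide pos_le_divide_eq)
    then show ?thesis by (simp add: m_def)
  qed
  let ?L = "laplacian S w"
  \<comment> \<open>The form of L - m. It is nonnegative on functions of mean zero and vanishes at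
    the minimizer \<phi>.\<close>
  define b where "b f g = Re (ell2_inner S (?L f) g) - m * Re (ell2_inner S f g)" for f g
  have b_self: "b f f = energy f / 2 - m * (ell2_norm S f)\<^sup>2" if "f \<in> ell2 S" for f
    by (simp add: b_def laplacian_form[OF that] ell2_inner_self[OF that] ell2_norm_sq)
  have b_sym: "b f g = b g f" if "f \<in> ell2 S" "g \<in> ell2 S" for f g
    unfolding b_def laplacian_selfadjoint[OF that]
    using ell2_inner_commute[of S f] by simp
  have b_expand: "b (\<lambda>x. f x + complex_of_real t * h x) (\<lambda>x. f x + complex_of_real t * h x)
      = b f f + 2 * t * b f h + t\<^sup>2 * b h h" if f: "f \<in> ell2 S" and h: "h \<in> ell2 S" for f h t
  proof -
    have th: "(\<lambda>x. complex_of_real t * h x) \<in> ell2 S" by (rule ell2_cmult[OF h])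
    have "?L (\<lambda>x. f x + complex_of_real t * h x) = (\<lambda>x. ?L f x + complex_of_real t * ?L h x)"
      using bounded_operator_laplacian f h th by (simp add: bounded_operator_def)
    note lins = this ell2_inner_add_left ell2_inner_add_right ell2_inner_cmult_left ell2_inner_cmult_right
      f h th laplacian_ell2(1)[OF f] laplacian_ell2(1)[OF h] ell2_cmult ell2_add
    have "b (\<lambda>x. f x + complex_of_real t * h x) (\<lambda>x. f x + complex_of_real t * h x)
        = b f f + t * b f h + t * b h f + t * (t * b h h)"
      unfolding b_def by (simp add: lins algebra_simps)
    then show ?thesis using b_sym[OF f h] by (simp add: power2_eq_square)
  qed
  define h where "h v = ?L \<phi> v - complex_of_real m * \<phi> v" for v
  have h: "h \<in> ell2 S"
    unfolding h_def[abs_def] by (intro ell2_diff ell2_cmult laplacian_ell2 \<phi>_ell2)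
  \<comment> \<open>Green's formula against the constant 1 shows that L \<phi> has mean zero, so the
    residual \<open>h\<close> is an admissible direction of variation.\<close>
  have h_mean: "(\<Sum>x\<in>S. h x) = 0"
  proof -
    define e where "e x = (if x \<in> S then 1 else 0 :: complex)" for x
    have e: "e \<in> ell2 S" by (rule ell2_finite[OF S(1)]) (simp add: e_def)
    have "(\<Sum>x\<in>S. ?L \<phi> x) = ell2_inner S (?L \<phi>) e"
      unfolding ell2_inner_def using S(1) by (simp add: e_def)
    also have "\<dots> = (\<Sum>\<^sub>\<infinity>(v, u)\<in>S \<times> S. 0) / 2"
      unfolding laplacian_inner[OF \<phi>_ell2 e]
      by (intro arg_cong[of _ _ "\<lambda>z. z / 2"] infsum_cong) (auto simp: e_def)
    finally have "(\<Sum>x\<in>S. ?L \<phi> x) = 0" by (simp add: case_prod_unfold)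
    then show ?thesis
      using \<phi>_mean by (simp add: h_def sum_subtractf sum_distrib_left[symmetric])
  qed
  define n where "n = (ell2_norm S h)\<^sup>2"
  have "b \<phi> \<phi> = 0" using b_self[OF \<phi>_ell2] \<phi>_norm by (simp add: m_def)
  have "b \<phi> h = n"
  proof -
    have "b \<phi> h = Re (ell2_inner S (?L \<phi>) h + ell2_inner S (\<lambda>v. - complex_of_real m * \<phi> v) h)"
      by (simp only: b_def ell2_inner_cmult_left) simp
    also have "ell2_inner S (?L \<phi>) h + ell2_inner S (\<lambda>v. - complex_of_real m * \<phi> v) h
        = ell2_inner S (\<lambda>v. ?L \<phi> v + - complex_of_real m * \<phi> v) h"
      by (rule ell2_inner_add_left[OF laplacian_ell2(1)[OF \<phi>_ell2] ell2_cmult[OF \<phi>_ell2] h, symmetric])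
    also have "(\<lambda>v. ?L \<phi> v + - complex_of_real m * \<phi> v) = h" by (simp add: h_def fun_eq_iff)
    finally show ?thesis by (simp add: ell2_inner_self[OF h] n_def ell2_norm_sq)
  qed
  define q where "q = b h h"
  have "0 \<le> q" unfolding q_def b_self[OF h] using poincare[OF h h_mean] by simp
  have "0 \<le> 2 * t * n + t\<^sup>2 * q" for t
  proof -
    let ?\<psi> = "\<lambda>x. \<phi> x + complex_of_real t * h x"
    have \<psi>: "?\<psi> \<in> ell2 S" by (intro ell2_add ell2_cmult \<phi>_ell2 h)
    have "(\<Sum>x\<in>S. ?\<psi> x) = 0"
      using \<phi>_mean h_mean by (simp add: sum.distrib sum_distrib_left[symmetric])
    then have "0 \<le> b ?\<psi> ?\<psi>" unfolding b_self[OF \<psi>] using poincare[OF \<psi>] by simp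
    then show ?thesis
      unfolding b_expand[OF \<phi>_ell2 h] \<open>b \<phi> \<phi> = 0\<close> \<open>b \<phi> h = n\<close> q_def by simp
  qed
  note quadratic = this
  \<comment> \<open>At t = - n r the quadratic is at most - n^2 r, which forces n = 0; the summand 1
    covers the case q = 0.\<close>
  define r where "r = 1 / (q + 1)"
  have r: "0 < r" "r * q \<le> 1" using \<open>0 \<le> q\<close> by (simp_all add: r_def)
  have "0 \<le> 2 * (- n * r) * n + (- n * r)\<^sup>2 * q" by (rule quadratic)
  also have "\<dots> = (n\<^sup>2 * r) * (r * q - 2)" by (simp add: power2_eq_square algebra_simps)
  also have "\<dots> \<le> (n\<^sup>2 * r) * (- 1)" using r by (intro mult_left_mono) auto
  finally have "n\<^sup>2 * r \<le> 0" by simp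
  then have "n = 0" using r(1) by (simp add: mult_le_0_iff)
  then have "h = (\<lambda>x. 0)" using ell2_norm_eq_0[OF h] by (simp add: n_def)
  then have eig: "?L \<phi> = (\<lambda>v. complex_of_real m * \<phi> v)" by (simp add: h_def fun_eq_iff)
  have nz: "\<phi> \<noteq> (\<lambda>v. 0)" using \<phi>_norm by (auto simp: ell2_norm_def)
  \<comment> \<open>Zero energy makes \<phi> equal at the two ends of every edge, hence constant by
    connectedness; mean zero then makes it vanish, against its norm 1.\<close>
  have "m \<noteq> 0"
  proof
    assume "m = 0"
    then have "(\<Sum>v\<in>S. \<Sum>u\<in>S. w v u * (cmod (\<phi> v - \<phi> u))\<^sup>2) = 0" by (simp add: m_def energy_eq)
    then have z: "w v u * (cmod (\<phi> v - \<phi> u))\<^sup>2 = 0" if "v \<in> S" "u \<in> S" for v u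
      using that S(1) by (simp add: sum_nonneg_eq_0_iff sum_nonneg weight_nonneg)
    have "\<phi> x = \<phi> y" if "(x, y) \<in> {(x, y). x \<in> S \<and> y \<in> S \<and> w x y \<noteq> 0}\<^sup>*" for x y
      using that by (induction rule: rtrancl_induct) (use z in fastforce)+
    then have const: "\<phi> x = \<phi> a" if "x \<in> S" for x
      using conn ab(1) that unfolding graph_connected_def by blast
    have "(\<Sum>x\<in>S. \<phi> x) = of_nat (card S) * \<phi> a" using const by simp
    then have "\<phi> a = 0" using \<phi>_mean S ab(1) by auto
    then have "\<phi> x = 0" for x
      using const ell2_outside[OF \<phi>_ell2] by (cases "x \<in> S") auto
    then show False using nz by (simp add: fun_eq_iff)
  qed
  moreover have "m \<in> laplacian_eigenvalues S w"
    unfolding laplacian_eigenvalues_def using \<phi>_ell2 nz eig by blast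
  ultimately show ?thesis using that poincare by blast
qed

text \<open>The Rayleigh minimum m is itself a nonzero eigenvalue, so the infimum is at most m and
  inherits the inequality. Nonnegativity of eigenvalues bounds the set from below, as
  \<open>Inf\<close> on the reals requires.\<close>

lemma first_nonzero_eigenvalue_poincare:
  assumes "finite S" "1 < card S" "graph_connected S w"
  shows "0 \<le> first_nonzero_eigenvalue S w"
    and "f \<in> ell2 S \<Longrightarrow> (\<Sum>x\<in>S. f x) = 0 \<Longrightarrow>
      first_nonzero_eigenvalue S w * (ell2_norm S f)\<^sup>2 \<le> energy f / 2"
proof -
  obtain m where m: "m \<in> laplacian_eigenvalues S w" "m \<noteq> 0"
    "\<And>f. f \<in> ell2 S \<Longrightarrow> (\<Sum>x\<in>S. f x) = 0 \<Longrightarrow> m * (ell2_norm S f)\<^sup>2 \<le> energy f / 2"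
    using ex_nonzero_eigenvalue_poincare[OF assms] by metis
  let ?E = "{l \<in> laplacian_eigenvalues S w. l \<noteq> 0}"
  show "0 \<le> first_nonzero_eigenvalue S w"
    unfolding first_nonzero_eigenvalue_def
    by (rule cInf_greatest) (use m eigenvalue_nonneg in auto)
  have "bdd_below ?E" by (rule bdd_belowI[of _ 0]) (simp add: eigenvalue_nonneg)
  then have le: "first_nonzero_eigenvalue S w \<le> m"
    unfolding first_nonzero_eigenvalue_def by (rule cInf_lower[rotated]) (use m in simp)
  show "first_nonzero_eigenvalue S w * (ell2_norm S f)\<^sup>2 \<le> energy f / 2"
    if "f \<in> ell2 S" "(\<Sum>x\<in>S. f x) = 0"
    using mult_right_mono[OF le, of "(ell2_norm S f)\<^sup>2"] m(3)[OF that] by simp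
qed

end

section \<open>Reconstruction from averages over a cover\<close>

text \<open>The total weight bounds each degree; the added 1 keeps the bound positive when there are
  no edges.\<close>

lemma weighted_laplacian_finite:
  assumes "finite S" "\<And>u v. u \<in> S \<Longrightarrow> v \<in> S \<Longrightarrow> 0 \<le> w u v" "\<And>u v. u \<in> S \<Longrightarrow> v \<in> S \<Longrightarrow> w u v = w v u"
  shows "weighted_laplacian S w (1 + (\<Sum>v\<in>S. \<Sum>u\<in>S. w v u))"
proof
  show "0 \<le> w u v" "w u v = w v u" if "u \<in> S" "v \<in> S" for u v
    using that assms by blast+
  show "(\<lambda>u. w v u) summable_on S" for v using assms(1) by simp
  show "(\<Sum>\<^sub>\<infinity>u\<in>S. w v u) \<le> 1 + (\<Sum>v\<in>S. \<Sum>u\<in>S. w v u)" if "v \<in> S" for v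
    using member_le_sum[OF that, of "\<lambda>v. \<Sum>u\<in>S. w v u"] assms by (simp add: sum_nonneg)
  show "0 < 1 + (\<Sum>v\<in>S. \<Sum>u\<in>S. w v u)"
    using sum_nonneg[of S "\<lambda>v. \<Sum>u\<in>S. w v u"] sum_nonneg[of S "w _"] assms(2)
    by (smt (verit) sum_nonneg)
qed

lemma weighted_graph_imp_weighted_laplacian:
  assumes "weighted_graph V w"
  shows "\<exists>c. weighted_laplacian V w c"
proof (cases "finite V")
  case True
  then show ?thesis
    using weighted_laplacian_finite[OF True, of w] assms unfolding weighted_graph_def by blast
next
  case False
  then obtain c where c: "\<And>v. v \<in> V \<Longrightarrow> (\<lambda>u. w u v) summable_on V" "\<And>v. v \<in> V \<Longrightarrow> (\<Sum>\<^sub>\<infinity>u\<in>V. w u v) \<le> c"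
    using assms unfolding weighted_graph_def by blast
  have w: "0 \<le> w u v" "w u v = w v u" if "u \<in> V" "v \<in> V" for u v
    using assms that unfolding weighted_graph_def by blast+
  \<comment> \<open>The given degree bound need not be positive. It concerns sums over the first
    argument of \<open>w\<close>, and symmetry transfers it to the second.\<close>
  have "weighted_laplacian V w (max c 1)"
  proof
    fix v assume v: "v \<in> V"
    show "(\<lambda>u. w v u) summable_on V"
      using c(1)[OF v] summable_on_cong[of V "\<lambda>u. w u v" "\<lambda>u. w v u"] w(2) v by blast
    have "(\<Sum>\<^sub>\<infinity>u\<in>V. w v u) = (\<Sum>\<^sub>\<infinity>u\<in>V. w u v)" by (rule infsum_cong) (rule w(2)[OF v])
    then show "(\<Sum>\<^sub>\<infinity>u\<in>V. w v u) \<le> max c 1" using c(2)[OF v] by simp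
  qed (use w in auto)
  then show ?thesis by blast
qed

text \<open>The variance identity: f - m is orthogonal to the constants on \<open>S\<close>. Its
  nonnegative left side yields the Bessel inequality for the averages in
  \<open>averages_block_le\<close>.\<close>

lemma sum_cmod_diff_mean:
  fixes f :: "'a \<Rightarrow> complex"
  assumes S: "finite S" "S \<noteq> {}"
  defines "m \<equiv> (\<Sum>v\<in>S. f v) / of_nat (card S)"
  shows "(\<Sum>v\<in>S. (cmod (f v - m))\<^sup>2) = (\<Sum>v\<in>S. (cmod (f v))\<^sup>2) - (cmod (\<Sum>v\<in>S. f v))\<^sup>2 / real (card S)"
proof -
  define s where "s = (\<Sum>v\<in>S. f v)"
  have card: "card S \<noteq> 0" using S by simp
  have "complex_of_real (\<Sum>v\<in>S. (cmod (f v - m))\<^sup>2) = (\<Sum>v\<in>S. (f v - m) * cnj (f v - m))"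
    by (simp only: of_real_sum complex_norm_square)
  also have "\<dots> = (\<Sum>v\<in>S. f v * cnj (f v)) - s * cnj m - m * cnj s + of_nat (card S) * (m * cnj m)"
    by (simp add: algebra_simps sum.distrib sum_subtractf sum_distrib_left[symmetric]
        sum_distrib_right[symmetric] s_def)
  also have "\<dots> = (\<Sum>v\<in>S. f v * cnj (f v)) - s * cnj s / of_nat (card S)"
    using card by (simp add: m_def s_def[symmetric] field_simps)
  also have "\<dots> = complex_of_real ((\<Sum>v\<in>S. (cmod (f v))\<^sup>2) - (cmod s)\<^sup>2 / real (card S))"
    by (simp only: of_real_diff of_real_divide of_real_sum complex_norm_square of_real_of_nat_eq)
  finally show ?thesis by (simp only: of_real_eq_iff s_def)
qed

section \<open>Averages over a partition into finite connected blocks\<close>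

locale finite_block_cover = weighted_laplacian V w c
  for V :: "'v set" and w :: "'v \<Rightarrow> 'v \<Rightarrow> real" and c :: real +
  fixes \<Xi> :: "'v set set"
  assumes partition: "partition_on V \<Xi>"
    and blocks: "\<And>\<Omega>. \<Omega> \<in> \<Xi> \<Longrightarrow> finite \<Omega> \<and> 1 < card \<Omega> \<and> graph_connected \<Omega> w"
    and cover_pos: "0 < cover_bound \<Xi> w"
begin

lemma block_finite: "\<Omega> \<in> \<Xi> \<Longrightarrow> finite \<Omega>"
  and block_card: "\<Omega> \<in> \<Xi> \<Longrightarrow> 0 < card \<Omega>"
  and block_subset: "\<Omega> \<in> \<Xi> \<Longrightarrow> \<Omega> \<subseteq> V"
  and block_disjoint: "\<Omega> \<in> \<Xi> \<Longrightarrow> \<Omega>' \<in> \<Xi> \<Longrightarrow> \<Omega> \<noteq> \<Omega>' \<Longrightarrow> \<Omega> \<inter> \<Omega>' = {}"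
  using blocks partition by (force simp: partition_on_def disjoint_def)+

definition block :: "'v \<Rightarrow> 'v set" where
  "block v = (THE \<Omega>. \<Omega> \<in> \<Xi> \<and> v \<in> \<Omega>)"

lemma block_eq: "\<Omega> \<in> \<Xi> \<Longrightarrow> v \<in> \<Omega> \<Longrightarrow> block v = \<Omega>"
  unfolding block_def by (rule the_equality) (use block_disjoint in blast)+

lemma block: "v \<in> V \<Longrightarrow> block v \<in> \<Xi> \<and> v \<in> block v"
  using partition block_eq unfolding partition_on_def by fastforce

lemma finite_Union_blocks: "finite G \<Longrightarrow> G \<subseteq> \<Xi> \<Longrightarrow> finite (\<Union>\<Omega>\<in>G. \<Omega>)"
  using block_finite by (intro finite_UN_I) auto

lemma sum_Union_blocks:
  assumes G: "finite G" "G \<subseteq> \<Xi>"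
  shows "sum g (\<Union>\<Omega>\<in>G. \<Omega>) = (\<Sum>\<Omega>\<in>G. sum g \<Omega>)"
proof (rule sum.UNION_disjoint[OF G(1)])
  show "\<forall>\<Omega>\<in>G. finite \<Omega>" using G(2) block_finite by auto
  show "\<forall>\<Omega>\<in>G. \<forall>\<Omega>'\<in>G. \<Omega> \<noteq> \<Omega>' \<longrightarrow> \<Omega> \<inter> \<Omega>' = {}"
    using G(2) block_disjoint by (meson subsetD)
qed

lemma sum_Union_block_squares:
  assumes G: "finite G" "G \<subseteq> \<Xi>"
  shows "sum g (\<Union>\<Omega>\<in>G. \<Omega> \<times> \<Omega>) = (\<Sum>\<Omega>\<in>G. sum g (\<Omega> \<times> \<Omega>))"
proof (rule sum.UNION_disjoint[OF G(1)])
  show "\<forall>\<Omega>\<in>G. finite (\<Omega> \<times> \<Omega>)" using G(2) block_finite by auto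
  show "\<forall>\<Omega>\<in>G. \<forall>\<Omega>'\<in>G. \<Omega> \<noteq> \<Omega>' \<longrightarrow> \<Omega> \<times> \<Omega> \<inter> \<Omega>' \<times> \<Omega>' = {}"
  proof (intro ballI impI)
    fix \<Omega> \<Omega>' assume "\<Omega> \<in> G" "\<Omega>' \<in> G" "\<Omega> \<noteq> \<Omega>'"
    then have "\<Omega> \<inter> \<Omega>' = {}" using G(2) block_disjoint by (meson subsetD)
    then show "\<Omega> \<times> \<Omega> \<inter> \<Omega>' \<times> \<Omega>' = {}" by (simp add: Times_Int_Times)
  qed
qed

text \<open>Enlarges a finite set to the union of the blocks it meets, so that estimates known for
  whole blocks reach arbitrary finite partial sums.\<close>

lemma sum_over_blocks_le:
  fixes g :: "'v \<Rightarrow> real"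
  assumes F: "finite F" "F \<subseteq> V" and nonneg: "\<And>v. 0 \<le> g v"
  shows "(\<Sum>v\<in>F. g v) \<le> (\<Sum>\<Omega>\<in>block ` F. \<Sum>v\<in>\<Omega>. g v)"
proof -
  have bF: "block ` F \<subseteq> \<Xi>" using F block by blast
  have "(\<Sum>v\<in>F. g v) \<le> (\<Sum>v\<in>(\<Union>\<Omega>\<in>block ` F. \<Omega>). g v)"
  proof (rule sum_mono2)
    show "finite (\<Union>\<Omega>\<in>block ` F. \<Omega>)" by (rule finite_Union_blocks[OF _ bF]) (simp add: F)
    show "F \<subseteq> (\<Union>\<Omega>\<in>block ` F. \<Omega>)" using F block by blast
  qed (rule nonneg)
  also have "\<dots> = (\<Sum>\<Omega>\<in>block ` F. \<Sum>v\<in>\<Omega>. g v)"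
    by (rule sum_Union_blocks[OF _ bF]) (simp add: F)
  finally show ?thesis .
qed

text \<open>The sum of a(\<Omega>) times the normalized indicator of \<Omega>, and so the adjoint of
  \<open>averages\<close>. At each vertex only its own block contributes, so no infinite sum
  appears. After \<open>averages\<close> it replaces f by its block means.\<close>

definition synthesis :: "('v set \<Rightarrow> complex) \<Rightarrow> 'v \<Rightarrow> complex" where
  "synthesis a v = (if v \<in> V then a (block v) / complex_of_real (sqrt (real (card (block v)))) else 0)"

lemma averages_eq:
  assumes "\<Omega> \<in> \<Xi>"
  shows "averages V \<Xi> f \<Omega> = (\<Sum>v\<in>\<Omega>. f v) / complex_of_real (sqrt (real (card \<Omega>)))"
proof -
  have "averages V \<Xi> f \<Omega> = (\<Sum>\<^sub>\<infinity>v\<in>V. f v * cnj (normalized_indicator \<Omega> v))"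
    using assms by (simp add: averages_def ell2_inner_def)
  also have "\<dots> = (\<Sum>\<^sub>\<infinity>v\<in>\<Omega>. f v / complex_of_real (sqrt (real (card \<Omega>))))"
    by (rule infsum_cong_neutral)
       (use block_subset[OF assms] in \<open>auto simp: normalized_indicator_def\<close>)
  finally show ?thesis using block_finite[OF assms] by (simp add: sum_divide_distrib)
qed

lemma averages_sq:
  assumes "\<Omega> \<in> \<Xi>"
  shows "(cmod (averages V \<Xi> f \<Omega>))\<^sup>2 = (cmod (\<Sum>v\<in>\<Omega>. f v))\<^sup>2 / real (card \<Omega>)"
  by (simp add: averages_eq[OF assms] norm_divide power_divide)

lemma synthesis_averages:
  assumes "v \<in> V"
  shows "synthesis (averages V \<Xi> f) v = (\<Sum>u\<in>block v. f u) / of_nat (card (block v))"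
proof -
  have "complex_of_real (sqrt (real n)) * complex_of_real (sqrt (real n)) = of_nat n" for n
    by (simp flip: of_real_mult)
  then show ?thesis
    using block[OF assms] assms by (simp add: synthesis_def averages_eq divide_divide_eq_left)
qed

lemma averages_block_le:
  assumes "\<Omega> \<in> \<Xi>"
  shows "(cmod (averages V \<Xi> f \<Omega>))\<^sup>2 \<le> (\<Sum>v\<in>\<Omega>. (cmod (f v))\<^sup>2)"
proof -
  have "\<Omega> \<noteq> {}" using block_card[OF assms] by auto
  have "0 \<le> (\<Sum>v\<in>\<Omega>. (cmod (f v - (\<Sum>v\<in>\<Omega>. f v) / of_nat (card \<Omega>)))\<^sup>2)"
    by (rule sum_nonneg) simp
  then show ?thesis
    unfolding sum_cmod_diff_mean[OF block_finite[OF assms] \<open>\<Omega> \<noteq> {}\<close>] averages_sq[OF assms] by simp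
qed

lemma bounded_operator_averages: "bounded_operator V \<Xi> (averages V \<Xi>)"
proof (rule bounded_operatorI[where C = 1])
  fix f assume f: "f \<in> ell2 V"
  have bound: "(\<Sum>\<Omega>\<in>G. (cmod (averages V \<Xi> f \<Omega>))\<^sup>2) \<le> (ell2_norm V f)\<^sup>2"
    if G: "finite G" "G \<subseteq> \<Xi>" for G
  proof -
    have "(\<Sum>\<Omega>\<in>G. (cmod (averages V \<Xi> f \<Omega>))\<^sup>2) \<le> (\<Sum>\<Omega>\<in>G. \<Sum>v\<in>\<Omega>. (cmod (f v))\<^sup>2)"
      by (rule sum_mono) (use G averages_block_le in blast)
    also have "\<dots> = (\<Sum>v\<in>(\<Union>\<Omega>\<in>G. \<Omega>). (cmod (f v))\<^sup>2)"
      by (rule sum_Union_blocks[OF G, symmetric])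
    also have "\<dots> \<le> (ell2_norm V f)\<^sup>2"
      unfolding ell2_norm_sq
    proof (rule finite_sum_le_infsum[OF ell2_summable[OF f] finite_Union_blocks[OF G]])
      show "(\<Union>\<Omega>\<in>G. \<Omega>) \<subseteq> V" using G(2) block_subset by blast
    qed simp
    finally show ?thesis .
  qed
  have "averages V \<Xi> f \<Omega> = 0" if "\<Omega> \<notin> \<Xi>" for \<Omega> using that by (simp add: averages_def)
  note b = ell2_sum_bound[of \<Xi> "averages V \<Xi> f", OF this bound]
  show "averages V \<Xi> f \<in> ell2 \<Xi>" using b(1) by simp
  show "ell2_norm \<Xi> (averages V \<Xi> f) \<le> 1 * ell2_norm V f"
  proof (rule power2_le_imp_le)
    show "(ell2_norm \<Xi> (averages V \<Xi> f))\<^sup>2 \<le> (1 * ell2_norm V f)\<^sup>2"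
      unfolding ell2_norm_sq[of \<Xi>] using b(2) by simp
  qed simp
  show "averages V \<Xi> (\<lambda>x. a * f x) = (\<lambda>\<Omega>. a * averages V \<Xi> f \<Omega>)" for a
  proof
    fix \<Omega> show "averages V \<Xi> (\<lambda>x. a * f x) \<Omega> = a * averages V \<Xi> f \<Omega>"
      by (cases "\<Omega> \<in> \<Xi>") (simp_all add: averages_eq sum_distrib_left[symmetric], simp add: averages_def)
  qed
next
  fix f g :: "'v \<Rightarrow> complex"
  show "averages V \<Xi> (\<lambda>x. f x + g x) = (\<lambda>\<Omega>. averages V \<Xi> f \<Omega> + averages V \<Xi> g \<Omega>)"
  proof
    fix \<Omega> show "averages V \<Xi> (\<lambda>x. f x + g x) \<Omega> = averages V \<Xi> f \<Omega> + averages V \<Xi> g \<Omega>"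
      by (cases "\<Omega> \<in> \<Xi>") (simp_all add: averages_eq sum.distrib add_divide_distrib, simp add: averages_def)
  qed
qed

text \<open>A block of k vertices carries k values of squared modulus |a(\<Omega>)|^2 / k, so it
  contributes exactly |a(\<Omega>)|^2 and the norm bound is 1.\<close>

lemma bounded_operator_synthesis: "bounded_operator \<Xi> V synthesis"
proof (rule bounded_operatorI[where C = 1])
  fix a :: "'v set \<Rightarrow> complex" assume a: "a \<in> ell2 \<Xi>"
  have bound: "(\<Sum>v\<in>F. (cmod (synthesis a v))\<^sup>2) \<le> (ell2_norm \<Xi> a)\<^sup>2"
    if F: "finite F" "F \<subseteq> V" for F
  proof -
    have bF: "block ` F \<subseteq> \<Xi>" using F block by blast
    have "(\<Sum>v\<in>F. (cmod (synthesis a v))\<^sup>2) \<le> (\<Sum>\<Omega>\<in>block ` F. \<Sum>v\<in>\<Omega>. (cmod (synthesis a v))\<^sup>2)"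
      by (rule sum_over_blocks_le[OF F]) simp
    also have "\<dots> = (\<Sum>\<Omega>\<in>block ` F. (cmod (a \<Omega>))\<^sup>2)"
    proof (rule sum.cong[OF refl])
      fix \<Omega> assume "\<Omega> \<in> block ` F"
      then have \<Omega>: "\<Omega> \<in> \<Xi>" using bF by blast
      have "(\<Sum>v\<in>\<Omega>. (cmod (synthesis a v))\<^sup>2) = (\<Sum>v\<in>\<Omega>. (cmod (a \<Omega>))\<^sup>2 / real (card \<Omega>))"
        by (rule sum.cong)
           (use block_eq[OF \<Omega>] block_subset[OF \<Omega>] in \<open>auto simp: synthesis_def norm_divide power_divide\<close>)
      then show "(\<Sum>v\<in>\<Omega>. (cmod (synthesis a v))\<^sup>2) = (cmod (a \<Omega>))\<^sup>2"
        using block_card[OF \<Omega>] by simp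
    qed
    also have "\<dots> \<le> (ell2_norm \<Xi> a)\<^sup>2"
      unfolding ell2_norm_sq
      by (rule finite_sum_le_infsum[OF ell2_summable[OF a]]) (use F bF in simp_all)
    finally show ?thesis .
  qed
  have "synthesis a v = 0" if "v \<notin> V" for v using that by (simp add: synthesis_def)
  note b = ell2_sum_bound[of V "synthesis a", OF this bound]
  show "synthesis a \<in> ell2 V" using b(1) by simp
  show "ell2_norm V (synthesis a) \<le> 1 * ell2_norm \<Xi> a"
  proof (rule power2_le_imp_le)
    show "(ell2_norm V (synthesis a))\<^sup>2 \<le> (1 * ell2_norm \<Xi> a)\<^sup>2"
      unfolding ell2_norm_sq[of V] using b(2) by simp
  qed simp
  show "synthesis (\<lambda>x. k * a x) = (\<lambda>v. k * synthesis a v)" for k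
    by (simp add: synthesis_def fun_eq_iff)
next
  fix a b :: "'v set \<Rightarrow> complex"
  show "synthesis (\<lambda>x. a x + b x) = (\<lambda>v. synthesis a v + synthesis b v)"
    by (simp add: synthesis_def fun_eq_iff add_divide_distrib)
qed

lemma block_laplacian:
  assumes "\<Omega> \<in> \<Xi>"
  shows "weighted_laplacian \<Omega> w (1 + (\<Sum>v\<in>\<Omega>. \<Sum>u\<in>\<Omega>. w v u))"
  by (rule weighted_laplacian_finite)
     (use assms block_finite block_subset weight_nonneg weight_sym in blast)+

text \<open>The infimum is a lower bound only once the values are bounded below, which is the
  nonnegativity of the first nonzero eigenvalue of each block.\<close>

lemma cover_bound_le:
  assumes "\<Omega> \<in> \<Xi>"
  shows "cover_bound \<Xi> w \<le> first_nonzero_eigenvalue \<Omega> w"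
  unfolding cover_bound_def
proof (rule cINF_lower[OF _ assms])
  show "bdd_below ((\<lambda>\<Omega>. first_nonzero_eigenvalue \<Omega> w) ` \<Xi>)"
    by (rule bdd_belowI2[of _ 0])
       (use blocks weighted_laplacian.first_nonzero_eigenvalue_poincare(1)[OF block_laplacian] in blast)
qed

lemma block_poincare:
  assumes \<Omega>: "\<Omega> \<in> \<Xi>"
  shows "cover_bound \<Xi> w * (\<Sum>v\<in>\<Omega>. (cmod (f v - (\<Sum>u\<in>\<Omega>. f u) / of_nat (card \<Omega>)))\<^sup>2)
       \<le> (\<Sum>(v, u)\<in>\<Omega> \<times> \<Omega>. w v u * (cmod (f v - f u))\<^sup>2) / 2"
proof -
  interpret B: weighted_laplacian \<Omega> w "1 + (\<Sum>v\<in>\<Omega>. \<Sum>u\<in>\<Omega>. w v u)" by (rule block_laplacian[OF \<Omega>])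
  note fin = block_finite[OF \<Omega>]
  define m where "m = (\<Sum>u\<in>\<Omega>. f u) / of_nat (card \<Omega>)"
  \<comment> \<open>Membership in \<open>ell2 \<Omega>\<close> requires vanishing off the block.
    Inside it, subtracting the mean leaves all differences unchanged, and with them the
    energy.\<close>
  define g where "g v = (if v \<in> \<Omega> then f v - m else 0)" for v
  have g: "g \<in> ell2 \<Omega>" by (rule ell2_finite[OF fin]) (simp add: g_def)
  have "(\<Sum>v\<in>\<Omega>. g v) = (\<Sum>v\<in>\<Omega>. f v - m)" by (rule sum.cong) (simp_all add: g_def)
  also have "\<dots> = 0" using block_card[OF \<Omega>] by (simp add: sum_subtractf m_def)
  finally have mean: "(\<Sum>v\<in>\<Omega>. g v) = 0" .
  have norm: "(ell2_norm \<Omega> g)\<^sup>2 = (\<Sum>v\<in>\<Omega>. (cmod (f v - m))\<^sup>2)"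
    unfolding ell2_norm_sq_finite[OF fin] by (rule sum.cong) (simp_all add: g_def)
  have "B.energy g = (\<Sum>(v, u)\<in>\<Omega> \<times> \<Omega>. w v u * (cmod (g v - g u))\<^sup>2)"
    unfolding B.energy_def using fin by simp
  also have "\<dots> = (\<Sum>(v, u)\<in>\<Omega> \<times> \<Omega>. w v u * (cmod (f v - f u))\<^sup>2)"
    by (rule sum.cong) (auto simp: g_def)
  finally have en: "B.energy g = (\<Sum>(v, u)\<in>\<Omega> \<times> \<Omega>. w v u * (cmod (f v - f u))\<^sup>2)" .
  have "cover_bound \<Xi> w * (ell2_norm \<Omega> g)\<^sup>2 \<le> first_nonzero_eigenvalue \<Omega> w * (ell2_norm \<Omega> g)\<^sup>2"
    by (intro mult_right_mono cover_bound_le \<Omega>) simp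
  also have "\<dots> \<le> B.energy g / 2"
    by (rule B.first_nonzero_eigenvalue_poincare(2)) (use blocks[OF \<Omega>] g mean in simp_all)
  finally show ?thesis unfolding norm en m_def .
qed

lemma residual_norm_le:
  assumes f: "f \<in> ell2 V"
  shows "cover_bound \<Xi> w * (ell2_norm V (\<lambda>v. f v - synthesis (averages V \<Xi> f) v))\<^sup>2 \<le> energy f / 2"
proof -
  define q where "q v = f v - synthesis (averages V \<Xi> f) v" for v
  let ?e = "\<lambda>(v, u). w v u * (cmod (f v - f u))\<^sup>2"
  have bound: "(\<Sum>v\<in>F. (cmod (q v))\<^sup>2) \<le> energy f / 2 / cover_bound \<Xi> w" if F: "finite F" "F \<subseteq> V" for F
  proof -
    have bF: "block ` F \<subseteq> \<Xi>" using F block by blast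
    have "cover_bound \<Xi> w * (\<Sum>v\<in>F. (cmod (q v))\<^sup>2)
        \<le> cover_bound \<Xi> w * (\<Sum>\<Omega>\<in>block ` F. \<Sum>v\<in>\<Omega>. (cmod (q v))\<^sup>2)"
      using cover_pos by (intro mult_left_mono sum_over_blocks_le F) simp_all
    also have "\<dots> = (\<Sum>\<Omega>\<in>block ` F. cover_bound \<Xi> w * (\<Sum>v\<in>\<Omega>. (cmod (q v))\<^sup>2))"
      by (rule sum_distrib_left)
    also have "\<dots> \<le> (\<Sum>\<Omega>\<in>block ` F. sum ?e (\<Omega> \<times> \<Omega>) / 2)"
    proof (rule sum_mono)
      fix \<Omega> assume "\<Omega> \<in> block ` F"
      then have \<Omega>: "\<Omega> \<in> \<Xi>" using bF by blast
      have "q v = f v - (\<Sum>u\<in>\<Omega>. f u) / of_nat (card \<Omega>)" if "v \<in> \<Omega>" for v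
        using that block_eq[OF \<Omega> that] block_subset[OF \<Omega>] synthesis_averages[of v f]
        by (auto simp: q_def)
      then have "(\<Sum>v\<in>\<Omega>. (cmod (q v))\<^sup>2)
          = (\<Sum>v\<in>\<Omega>. (cmod (f v - (\<Sum>u\<in>\<Omega>. f u) / of_nat (card \<Omega>)))\<^sup>2)" by simp
      then show "cover_bound \<Xi> w * (\<Sum>v\<in>\<Omega>. (cmod (q v))\<^sup>2) \<le> sum ?e (\<Omega> \<times> \<Omega>) / 2"
        using block_poincare[OF \<Omega>, of f] by simp
    qed
    also have "\<dots> = (\<Sum>\<Omega>\<in>block ` F. sum ?e (\<Omega> \<times> \<Omega>)) / 2" by (simp add: sum_divide_distrib)
    also have "(\<Sum>\<Omega>\<in>block ` F. sum ?e (\<Omega> \<times> \<Omega>)) = sum ?e (\<Union>\<Omega>\<in>block ` F. \<Omega> \<times> \<Omega>)"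
      by (rule sum_Union_block_squares[OF _ bF, symmetric]) (simp add: F)
    \<comment> \<open>Edges between different blocks are discarded here; their terms are
      nonnegative.\<close>
    also have "\<dots> \<le> energy f"
      unfolding energy_def
    proof (rule finite_sum_le_infsum[OF energy_summable(1)[OF f]])
      show "finite (\<Union>\<Omega>\<in>block ` F. \<Omega> \<times> \<Omega>)"
        using F(1) bF block_finite by (intro finite_UN_I finite_cartesian_product) auto
      show "(\<Union>\<Omega>\<in>block ` F. \<Omega> \<times> \<Omega>) \<subseteq> V \<times> V" using bF block_subset by blast
    qed (auto simp: weight_nonneg)
    finally show ?thesis using cover_pos by (simp add: field_simps)
  qed
  have "q v = 0" if "v \<notin> V" for v
    using that by (simp add: q_def synthesis_def ell2_outside[OF f])
  then have "(ell2_norm V q)\<^sup>2 \<le> energy f / 2 / cover_bound \<Xi> w"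
    unfolding ell2_norm_sq using ell2_sum_bound(2)[of V q, OF _ bound] by simp
  then show ?thesis using cover_pos by (simp add: q_def[abs_def] field_simps)
qed

end

theorem theorem9p2:
  fixes V :: "'v set" and w :: "'v \<Rightarrow> 'v \<Rightarrow> real" and \<Xi> :: "'v set set"
    and \<alpha> \<omega> :: real
  assumes "weighted_graph V w"
    and "graph_connected V w"
    and "partition_on V \<Xi>"
    and "\<And>\<Omega>. \<Omega> \<in> \<Xi> \<Longrightarrow> finite \<Omega> \<and> 1 < card \<Omega> \<and> graph_connected \<Omega> w"
    and "cover_bound \<Xi> w > 0"
    and "\<alpha> > 0" and "\<omega> > 0"
    and "(1 + \<alpha>) / \<alpha> * (\<omega> / cover_bound \<Xi> w) < 1"
  shows "(\<forall>f\<in>paley_wiener V w \<omega>. \<forall>g\<in>paley_wiener V w \<omega>.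
            (\<forall>\<Omega>\<in>\<Xi>. ell2_inner V f (normalized_indicator \<Omega>)
                   = ell2_inner V g (normalized_indicator \<Omega>)) \<longrightarrow> f = g)
       \<and> (\<exists>R. bounded_operator \<Xi> V R
            \<and> (\<forall>a\<in>ell2 \<Xi>. R a \<in> paley_wiener V w \<omega>)
            \<and> (\<forall>f\<in>paley_wiener V w \<omega>.
                 averages V \<Xi> f \<in> ell2 \<Xi> \<and> R (averages V \<Xi> f) = f))"
proof -
  obtain c where "weighted_laplacian V w c"
    using weighted_graph_imp_weighted_laplacian[OF assms(1)] by blast
  then interpret weighted_laplacian V w c .
  interpret finite_block_cover V w c \<Xi>
    by unfold_locales (use assms(3-5) in blast)+
  define \<Lambda> where "\<Lambda> = cover_bound \<Xi> w"
  have "0 < \<Lambda>" using assms(5) by (simp add: \<Lambda>_def)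
  define P where "P = spectral_projector V (laplacian V w) {0..\<omega>}"
  \<comment> \<open>The same choice as inside \<open>spectral_projector\<close>. Existence of a
    spectral measure makes the chosen object a genuine one.\<close>
  define E where "E = (SOME E. is_spectral_measure V (laplacian V w) E)"
  have E: "is_spectral_measure V (laplacian V w) E"
    unfolding E_def by (rule someI_ex[OF ex_spectral_measure_laplacian])
  have PE: "P = E {0..\<omega>}" by (simp add: P_def spectral_projector_def E_def)
  have P: "orthogonal_projection V P"
    using E unfolding is_spectral_measure_def PE by simp
  have PW: "paley_wiener V w \<omega> = P ` ell2 V" by (simp add: paley_wiener_def P_def)
  \<comment> \<open>The residual estimate reads \<Lambda> |Q f|^2 \<le> \<omega> |f|^2, hence the
    square root. Below, \<omega> / \<Lambda> < 1 follows from \<gamma> < 1.\<close>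
  define \<kappa> where "\<kappa> = sqrt (\<omega> / \<Lambda>)"
  have "1 \<le> (1 + \<alpha>) / \<alpha>" using assms(6) by simp
  then have "1 * (\<omega> / \<Lambda>) \<le> (1 + \<alpha>) / \<alpha> * (\<omega> / \<Lambda>)"
    using assms(7) \<open>0 < \<Lambda>\<close> by (intro mult_right_mono) simp_all
  also have "\<dots> < 1" using assms(8) by (simp only: \<Lambda>_def)
  finally have \<kappa>: "0 \<le> \<kappa>" "\<kappa> < 1" "\<kappa>\<^sup>2 = \<omega> / \<Lambda>"
    using assms(7) \<open>0 < \<Lambda>\<close> by (simp_all add: \<kappa>_def)
  have le: "ell2_norm V (\<lambda>v. f v - synthesis (averages V \<Xi> f) v) \<le> \<kappa> * ell2_norm V f"
    if f: "f \<in> ell2 V" "P f = f" for f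
  proof (rule power2_le_imp_le)
    have "energy f / 2 = Re (ell2_inner V (laplacian V w f) f)"
      unfolding laplacian_form[OF f(1)] by simp
    also have "\<dots> \<le> \<omega> * (ell2_norm V f)\<^sup>2"
      by (rule spectral_form_le[OF E f(1)]) (use f(2) assms(7) in \<open>simp_all add: PE\<close>)
    finally have "\<Lambda> * (ell2_norm V (\<lambda>v. f v - synthesis (averages V \<Xi> f) v))\<^sup>2 \<le> \<omega> * (ell2_norm V f)\<^sup>2"
      using residual_norm_le[OF f(1)] unfolding \<Lambda>_def by linarith
    then show "(ell2_norm V (\<lambda>v. f v - synthesis (averages V \<Xi> f) v))\<^sup>2 \<le> (\<kappa> * ell2_norm V f)\<^sup>2"
      using \<open>0 < \<Lambda>\<close> by (simp add: power_mult_distrib \<kappa>(3) field_simps)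
  qed (use \<kappa>(1) in simp)
  have "\<exists>R. bounded_operator \<Xi> V R \<and> (\<forall>a\<in>ell2 \<Xi>. R a \<in> P ` ell2 V) \<and>
      (\<forall>f\<in>P ` ell2 V. R (averages V \<Xi> f) = f)"
    by (rule ex_stable_reconstruction[OF P bounded_operator_averages bounded_operator_synthesis \<kappa>(1,2) le])
  then obtain R where R: "bounded_operator \<Xi> V R" "\<And>a. a \<in> ell2 \<Xi> \<Longrightarrow> R a \<in> P ` ell2 V"
    "\<And>f. f \<in> P ` ell2 V \<Longrightarrow> R (averages V \<Xi> f) = f"
    by blast
  have bP: "bounded_operator V V P" using P by (simp add: orthogonal_projection_def)
  have av: "averages V \<Xi> f \<in> ell2 \<Xi>" if "f \<in> P ` ell2 V" for f
    using that by (auto intro!: bounded_operatorD(1)[OF bounded_operator_averages] bounded_operatorD(1)[OF bP])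
  show ?thesis
    unfolding PW
  proof (intro conjI ballI impI)
    fix f g assume f: "f \<in> P ` ell2 V" and g: "g \<in> P ` ell2 V"
      and eq: "\<forall>\<Omega>\<in>\<Xi>. ell2_inner V f (normalized_indicator \<Omega>) = ell2_inner V g (normalized_indicator \<Omega>)"
    \<comment> \<open>Off the cover both sequences are 0 by definition, so agreement on its members
      is equality of functions.\<close>
    have av_eq: "averages V \<Xi> f = averages V \<Xi> g" by (rule ext) (simp add: averages_def eq)
    have "f = R (averages V \<Xi> f)" by (rule R(3)[OF f, symmetric])
    also have "\<dots> = g" unfolding av_eq by (rule R(3)[OF g])
    finally show "f = g" .
  next
    show "\<exists>R. bounded_operator \<Xi> V R \<and> (\<forall>a\<in>ell2 \<Xi>. R a \<in> P ` ell2 V) \<and>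
        (\<forall>f\<in>P ` ell2 V. averages V \<Xi> f \<in> ell2 \<Xi> \<and> R (averages V \<Xi> f) = f)"
      by (intro exI[of _ R] conjI ballI) (simp_all only: R av)
  qed
qed

end
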